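(* Let $m$ be a positive integer and let $\lambda$ be a partition of $n$ with $\ell(\lambda)\le m$, where $n$ is odd, and suppose that $\gcd(m,p)=1$ for every odd prime $p$ with $p\le n$. Then every orbit in $SP(\lambda,2m)$ under the action of $G=\langle\sigma\rangle$, where $\sigma=\sigma_1\sigma_2\cdots\sigma_m$, has cardinality $2m$.
   Context: Partitions: $\lambda=(\lambda_1\ge\cdots\ge\lambda_k>0)$ is a partition of a positive integer $n=\sum\lambda_i$, with length $\ell(\lambda)=k$ and Young diagram with left-justified rows of lengths $\lambda_i$. Kashiwara–Nakashima (KN) tableaux: let $\mathcal M=\{1<2<\cdots<m<\overline m<\cdots<\overline2<\overline1\}$. $SP(\lambda,2m)$ is the set of fillings $T$ of the Young diagram of $\lambda$ with letters of $\mathcal M$ such that: (1) entries weakly increase along rows (left to right) and strictly increase down columns; (2) whenever a column contains both $i$ and $\overline i$, with $i$ in the $p$-th box from the top of the column and $\overline i$ in the $q$-th box from the bottom, then $p+q\le i$; (3) for any two adjacent columns, any $i\le j$ in $\{1,\dots,m\}$, and rows (counted from the top) $p\le q<r\le s$: if either [the left column has $i$ in row $p$ and the right column has $j$ in row $q$, $\overline j$ in row $r$, $\overline i$ in row $s$] or [the left column has $i$ in row $p$, $j$ in row $q$, $\overline j$ in row $r$ and the right column has $\overline i$ in row $s$], then $(q-p)+(s-r)<j-i$. Weight: $\mathrm{wt}(T)=(\chi_1,\ldots,\chi_m)$, $\chi_i$ = (number of $i$'s in $T$) $-$ (number of $\overline i$'s in $T$). Crystal operators: identify $T$ with its column reading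 word $x_1x_2\cdots x_n$, obtained by reading each column from bottom to top, starting with the leftmost column and moving right. For $1\le i\le m$ the operator $f_i$ acts on words as follows. If $i<m$, label each $x_s\in\{i,\overline{i+1}\}$ with $-$ and each $x_s\in\{i+1,\overline i\}$ with $+$; if $i=m$, label each $m$ with $-$ and each $\overline m$ with $+$. Repeatedly bracket a $+$ with a $-$ to its right having no unbracketed signs between them, until all unbracketed $-$'s lie left of all unbracketed $+$'s. If there is no unbracketed $-$, then $f_i$ gives $0$; otherwise $f_i$ changes the letter carrying the rightmost unbracketed $-$, by $i\mapsto i+1$ or $\overline{i+1}\mapsto\overline i$ (if $i<m$), or $m\mapsto\overline m$ (if $i=m$). The operator $e_i$ is the partial inverse: $e_i(b')=b$ iff $f_i(b)=b'$, and $e_i(b')=0$ if there is no such $b$. These operators preserve $SP(\lambda,2m)\sqcup\{0\}$, giving the crystal $\mathcal B(\lambda)$ of the irreducible $U_q(\mathfrak{sp}(2m))$-module of highest weight $\lambda$. Reflections: for $T$ with weight $\chi$, let $k=\chi_i-\chi_{i+1}$ if $i<m$ and $k=\chi_m$ if $i=m$; put $\sigma_i(T)=f_i^k(T)$ if $k\ge0$ and $\sigma_i(T)=e_i^{-k}(T)$ if $k<0$. Each $\sigma_i$ is a bijection of $SP(\lambda,2m)$, and $\sigma=\sigma_1\sigma_2\cdots\sigma_m$ is the composition (with $\sigma_m$ applied first). *)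

theory Defs
  imports
    "HOL-Library.FuncSet"
    "HOL-Computational_Algebra.Primes"
    "HOL-Algebra.Bij"
    "HOL-Algebra.Generated_Groups"
    "HOL-Algebra.Group_Action"
begin

section \<open>Partitions and Young diagrams\<close>

definition is_partition :: "nat list \<Rightarrow> nat \<Rightarrow> bool" where
  "is_partition lam n \<longleftrightarrow>
     n > 0 \<and> sorted_wrt (\<ge>) lam \<and> (\<forall>l \<in> set lam. l > 0) \<and> sum_list lam = n"

text \<open>Boxes are pairs (row, column), both counted from 0.\<close>

definition cells :: "nat list \<Rightarrow> (nat \<times> nat) set" where
  "cells lam = {(r, c). r < length lam \<and> c < lam ! r}"

definition column_length :: "nat list \<Rightarrow> nat \<Rightarrow> nat" where
  "column_length lam c = card {r. (r, c) \<in> cells lam}"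

definition num_columns :: "nat list \<Rightarrow> nat" where
  "num_columns lam = card {c. (0, c) \<in> cells lam}"


section \<open>Kashiwara--Nakashima tableaux\<close>

datatype letter = Plain nat | Barred nat

instantiation letter :: linorder
begin

fun less_eq_letter :: "letter \<Rightarrow> letter \<Rightarrow> bool" where
  "Plain i \<le> Plain j \<longleftrightarrow> i \<le> j"
| "Plain i \<le> Barred j \<longleftrightarrow> True"
| "Barred i \<le> Plain j \<longleftrightarrow> False"
| "Barred i \<le> Barred j \<longleftrightarrow> j \<le> i"

definition less_letter :: "letter \<Rightarrow> letter \<Rightarrow> bool" where
  "less_letter x y \<longleftrightarrow> x \<le> y \<and> \<not> y \<le> x"

instance
proof
  fix x y z :: letter
  show "x < y \<longleftrightarrow> x \<le> y \<and> \<not> y \<le> x" by (rule less_letter_def)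
  show "x \<le> x" by (cases x) auto
  show "x \<le> y \<Longrightarrow> y \<le> z \<Longrightarrow> x \<le> z" by (cases x; cases y; cases z) auto
  show "x \<le> y \<Longrightarrow> y \<le> x \<Longrightarrow> x = y" by (cases x; cases y) auto
  show "x \<le> y \<or> y \<le> x" by (cases x; cases y) auto
qed

end

definition alphabet :: "nat \<Rightarrow> letter set" where
  "alphabet m = Plain ` {1..m} \<union> Barred ` {1..m}"

text \<open>Fillings are extensional, so that a filling is determined by its values on the diagram.\<close>

type_synonym filling = "nat \<times> nat \<Rightarrow> letter"

definition has_entry :: "nat list \<Rightarrow> filling \<Rightarrow> nat \<Rightarrow> nat \<Rightarrow> letter \<Rightarrow> bool" where
  "has_entry lam T r c x \<longleftrightarrow> (r, c) \<in> cells lam \<and> T (r, c) = x"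

definition semistandard :: "nat list \<Rightarrow> filling \<Rightarrow> bool" where
  "semistandard lam T \<longleftrightarrow>
     (\<forall>r c c'. (r, c) \<in> cells lam \<longrightarrow> (r, c') \<in> cells lam \<longrightarrow> c < c' \<longrightarrow> T (r, c) \<le> T (r, c')) \<and>
     (\<forall>r r' c. (r, c) \<in> cells lam \<longrightarrow> (r', c) \<in> cells lam \<longrightarrow> r < r' \<longrightarrow> T (r, c) < T (r', c))"

text \<open>
  Row a is box number a + 1 from the top, and row b is box number (length of the column) - b
  from the bottom.
\<close>

definition column_condition :: "nat list \<Rightarrow> filling \<Rightarrow> bool" where
  "column_condition lam T \<longleftrightarrow>
     (\<forall>c i a b. has_entry lam T a c (Plain i) \<longrightarrow> has_entry lam T b c (Barred i) \<longrightarrow>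
        (a + 1) + (column_length lam c - b) \<le> i)"

definition adjacent_columns_condition :: "nat list \<Rightarrow> nat \<Rightarrow> filling \<Rightarrow> bool" where
  "adjacent_columns_condition lam m T \<longleftrightarrow>
     (\<forall>c i j p q r s.
        1 \<le> i \<longrightarrow> i \<le> j \<longrightarrow> j \<le> m \<longrightarrow> p \<le> q \<longrightarrow> q < r \<longrightarrow> r \<le> s \<longrightarrow>
        has_entry lam T p c (Plain i) \<and> has_entry lam T q (Suc c) (Plain j) \<and>
        has_entry lam T r (Suc c) (Barred j) \<and> has_entry lam T s (Suc c) (Barred i)
        \<or>
        has_entry lam T p c (Plain i) \<and> has_entry lam T q c (Plain j) \<and>
        has_entry lam T r c (Barred j) \<and> has_entry lam T s (Suc c) (Barred i)
        \<longrightarrow> (q - p) + (s - r) < j - i)"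

text \<open>The set usually written \<open>SP(\<lambda>, 2m)\<close>; the second argument is the rank m.\<close>

definition SP :: "nat list \<Rightarrow> nat \<Rightarrow> filling set" where
  "SP lam m = {T \<in> cells lam \<rightarrow>\<^sub>E alphabet m.
     semistandard lam T \<and> column_condition lam T \<and> adjacent_columns_condition lam m T}"

definition wt :: "nat list \<Rightarrow> filling \<Rightarrow> nat \<Rightarrow> int" where
  "wt lam T i = int (card {x \<in> cells lam. T x = Plain i}) - int (card {x \<in> cells lam. T x = Barred i})"


section \<open>Crystal operators on words\<close>

datatype sign = Minus | Plus

definition sign_of :: "nat \<Rightarrow> nat \<Rightarrow> letter \<Rightarrow> sign option" where
  "sign_of m i x =
     (if i < m then
        if x = Plain i \<or> x = Barred (i + 1) then Some Minus
        else if x = Plain (i + 1) \<or> x = Barred i then Some Plus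
        else None
      else
        if x = Plain m then Some Minus
        else if x = Barred m then Some Plus
        else None)"

definition signature :: "nat \<Rightarrow> nat \<Rightarrow> letter list \<Rightarrow> (nat \<times> sign) list" where
  "signature m i w =
     List.map_filter (\<lambda>s. map_option (Pair s) (sign_of m i (w ! s))) [0..<length w]"

text \<open>
  The pairs that survive the bracketing. The list is scanned from the right; at every step the
  part already scanned has been reduced to minuses followed by pluses, so a new plus is
  bracketed with the leftmost remaining minus, if that is the next unbracketed sign.
\<close>

fun unbracketed :: "(nat \<times> sign) list \<Rightarrow> (nat \<times> sign) list" where
  "unbracketed [] = []"
| "unbracketed ((s, Minus) # xs) = (s, Minus) # unbracketed xs"
| "unbracketed ((s, Plus) # xs) =
     (case unbracketed xs of
        (t, Minus) # ys \<Rightarrow> ys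
      | ys \<Rightarrow> (s, Plus) # ys)"

text \<open>
  This computes the result of the nondeterministic procedure: one step removes a plus and a
  minus to its right between which no sign is left, and at the end all minuses precede all pluses.
\<close>

inductive bracket_step :: "(nat \<times> sign) list \<Rightarrow> (nat \<times> sign) list \<Rightarrow> bool" where
  "bracket_step (us @ (s, Plus) # (t, Minus) # vs) (us @ vs)"

lemma bracket_step_Cons: "bracket_step xs ys \<Longrightarrow> bracket_step (x # xs) (x # ys)"
  by (elim bracket_step.cases) (metis append_Cons bracket_step.intros)

lemma bracket_steps_Cons: "bracket_step\<^sup>*\<^sup>* xs ys \<Longrightarrow> bracket_step\<^sup>*\<^sup>* (x # xs) (x # ys)"
  by (induction rule: rtranclp_induct) (auto intro: rtranclp.rtrancl_into_rtrancl bracket_step_Cons)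

lemma bracket_steps_unbracketed: "bracket_step\<^sup>*\<^sup>* xs (unbracketed xs)"
proof (induction xs rule: unbracketed.induct)
  case (3 s xs)
  have *: "bracket_step\<^sup>*\<^sup>* ((s, Plus) # xs) ((s, Plus) # unbracketed xs)"
    by (rule bracket_steps_Cons) (rule 3)
  have "bracket_step ((s, Plus) # (t, Minus) # ys) ys" for t ys
    using bracket_step.intros[of "[]" s t ys] by simp
  with * show ?case
    by (auto split: list.splits sign.splits intro: rtranclp.rtrancl_into_rtrancl)
qed (auto intro: bracket_steps_Cons)

lemma unbracketed_minuses_pluses:
  "\<exists>us vs. unbracketed xs = us @ vs \<and> snd ` set us \<subseteq> {Minus} \<and> snd ` set vs \<subseteq> {Plus}"
proof (induction xs rule: unbracketed.induct)
  case (2 s xs)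
  then obtain us vs where "unbracketed xs = us @ vs" "snd ` set us \<subseteq> {Minus}" "snd ` set vs \<subseteq> {Plus}"
    by blast
  then show ?case
    by (intro exI[of _ "(s, Minus) # us"] exI[of _ vs]) auto
next
  case (3 s xs)
  then obtain us vs where uv: "unbracketed xs = us @ vs" "snd ` set us \<subseteq> {Minus}" "snd ` set vs \<subseteq> {Plus}"
    by blast
  show ?case
  proof (cases us)
    case Nil
    then show ?thesis
      using uv by (intro exI[of _ "[]"] exI[of _ "(s, Plus) # vs"])
        (auto split: list.splits sign.splits)
  next
    case (Cons u us')
    then show ?thesis
      using uv by (intro exI[of _ us'] exI[of _ vs]) (cases u; auto)
  qed
qed auto

text \<open>None plays the role of the symbol 0 of crystal theory.\<close>

definition f_letter :: "nat \<Rightarrow> nat \<Rightarrow> letter \<Rightarrow> letter" where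
  "f_letter m i x =
     (if i < m then (if x = Plain i then Plain (i + 1) else Barred i) else Barred m)"

definition f_word :: "nat \<Rightarrow> nat \<Rightarrow> letter list \<Rightarrow> letter list option" where
  "f_word m i w =
     (let minuses = filter (\<lambda>(s, g). g = Minus) (unbracketed (signature m i w)) in
      if minuses = [] then None
      else let s = fst (last minuses) in Some (w[s := f_letter m i (w ! s)]))"

definition e_word :: "nat \<Rightarrow> nat \<Rightarrow> letter list \<Rightarrow> letter list option" where
  "e_word m i w' =
     (if \<exists>w. f_word m i w = Some w' then Some (THE w. f_word m i w = Some w') else None)"


section \<open>Crystal operators and reflections on tableaux\<close>

definition reading_order :: "nat list \<Rightarrow> (nat \<times> nat) list" where
  "reading_order lam =
     concat (map (\<lambda>c. map (\<lambda>r. (r, c)) (rev [0..<column_length lam c])) [0..<num_columns lam])"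

definition reading_word :: "nat list \<Rightarrow> filling \<Rightarrow> letter list" where
  "reading_word lam T = map T (reading_order lam)"

definition filling_of_word :: "nat list \<Rightarrow> letter list \<Rightarrow> filling" where
  "filling_of_word lam = the_inv_into (extensional (cells lam)) (reading_word lam)"

definition f_op :: "nat list \<Rightarrow> nat \<Rightarrow> nat \<Rightarrow> filling \<Rightarrow> filling option" where
  "f_op lam m i T = map_option (filling_of_word lam) (f_word m i (reading_word lam T))"

definition e_op :: "nat list \<Rightarrow> nat \<Rightarrow> nat \<Rightarrow> filling \<Rightarrow> filling option" where
  "e_op lam m i T = map_option (filling_of_word lam) (e_word m i (reading_word lam T))"

definition iterate :: "nat \<Rightarrow> ('a \<Rightarrow> 'a option) \<Rightarrow> 'a \<Rightarrow> 'a option" where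
  "iterate k h x = ((\<lambda>y. Option.bind y h) ^^ k) (Some x)"

definition reflection :: "nat list \<Rightarrow> nat \<Rightarrow> nat \<Rightarrow> filling \<Rightarrow> filling" where
  "reflection lam m i T =
     (let k = (if i < m then wt lam T i - wt lam T (i + 1) else wt lam T m) in
      the (if k \<ge> 0 then iterate (nat k) (f_op lam m i) T
           else iterate (nat (- k)) (e_op lam m i) T))"

definition sigma :: "nat list \<Rightarrow> nat \<Rightarrow> filling \<Rightarrow> filling" where
  "sigma lam m = foldr (\<lambda>i g. reflection lam m i \<circ> g) [1..<Suc m] id"

text \<open>
  The subgroup of the symmetric group on \<open>SP lam m\<close> generated by sigma; its elements act on
  tableaux by evaluation.
\<close>

definition sigma_group :: "nat list \<Rightarrow> nat \<Rightarrow> (filling \<Rightarrow> filling) monoid" where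
  "sigma_group lam m =
     subgroup_generated (BijGroup (SP lam m)) {restrict (sigma lam m) (SP lam m)}"

end

theory Submission
  imports Defs "HOL-Library.Multiset"
begin

text \<open>
  The group is cyclic, so the orbit of a tableau \<open>T\<close> consists of the \<open>\<sigma>\<^sup>k T\<close>. It has \<open>2m\<close> elements
  because \<open>\<sigma>\<close> maps \<open>SP(\<lambda>, 2m)\<close> to itself with \<open>\<sigma>\<^bsup>2m\<^esup> = 1\<close> (\<open>sigma_SP\<close>, \<open>sigma_order\<close>), and because
  \<open>\<sigma>\<^sup>t T \<noteq> T\<close> for \<open>0 < t < 2m\<close> (\<open>sigma_power_neq\<close>).

  The relation \<open>\<sigma>\<^bsup>2m\<^esup> = 1\<close> is an identity on words, and the braid relations are not needed for it. The
  reflection \<open>\<sigma>\<^sub>i\<close> changes the sign of a letter \<open>x\<close> in \<open>w = u x v\<close> exactly if the rest of the word, read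
  cyclically as \<open>v u\<close>, has no unmatched plus (for \<open>x\<close> a minus) or no unmatched minus (for \<open>x\<close> a plus).
  Hence reflections commute with rotations of the word. In type A they also commute with the Knuth
  moves, each performed at fixed positions. Rotations and Knuth moves connect every word with a
  weakly increasing one (\<open>knuth_rotate_induct\<close>), and on weakly increasing words a reflection only
  permutes the multiplicities of the letters. So a composition of type A reflections that is trivial
  on multiplicities is trivial on all words (\<open>foldr_reflect_A_eq_self\<close>). Type C words of rank \<open>m\<close> embed
  into type A words over \<open>1, \<dots>, 2m\<close> in such a way that \<open>\<sigma>\<^sub>i\<close> becomes the product of the type A reflections
  with indices \<open>i\<close> and \<open>2m - i\<close> for \<open>i < m\<close>, and \<open>\<sigma>\<^sub>m\<close> the one with index \<open>m\<close>. The image of \<open>\<sigma>\<close> permutes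
  the letters in a cycle of length \<open>2m\<close> (\<open>coxeter_reflect_order\<close>).

  That the crystal operators preserve Kashiwara--Nakashima tableaux follows from a reformulation of
  the defining conditions: for each column and each pair of adjacent columns they say that certain
  differences of letter counts are bounded by others (\<open>SP_iff_good_filling\<close>). An operator with index \<open>i\<close>
  alters these counts at the index \<open>i\<close> only, and the bounds at \<open>i - 1\<close> and \<open>i + 1\<close> together with the
  bracketing rule give the new bounds at \<open>i\<close> (\<open>SP_flip\<close>).

  Finally \<open>\<sigma>\<close> acts on weights by \<open>(\<chi>\<^sub>1, \<dots>, \<chi>\<^sub>m) \<mapsto> (-\<chi>\<^sub>m, \<chi>\<^sub>1, \<dots>, \<chi>\<^bsub>m-1\<^esub>)\<close>, a shift of the extension of
  \<open>\<chi>\<close> to the integers with \<open>\<chi>\<^bsub>z+m\<^esub> = -\<chi>\<^sub>z\<close>. Suppose \<open>\<sigma>\<^sup>t T = T\<close> with \<open>0 < t < 2m\<close>. Then the extension has a period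
  \<open>2m / q\<close> with \<open>q > 1\<close>. If \<open>q\<close> is even, then \<open>m\<close> is a period, so \<open>\<chi> = 0\<close>, but the sum of the weight is
  congruent to the odd number \<open>n\<close> modulo 2. If \<open>q\<close> is odd, then an odd prime \<open>p\<close> divides \<open>q\<close> and \<open>m\<close>, and
  the absolute values of \<open>\<chi>\<close> have period \<open>m / p\<close>, so their sum, which is at most \<open>n\<close>, is at least \<open>p\<close>. This
  contradicts the coprimality hypothesis (\<open>antiperiodic_not_periodic\<close>).
\<close>

section \<open>Words of signs\<close>

text \<open>
  The numbers of unmatched minuses and unmatched pluses of a sign word. A reduced sign word has all
  its minuses before its pluses, so this pair determines it. Concatenation of words becomes the product
  \<open>meld\<close>: the pluses on the left cancel against the minuses on the right. The pairs form the bicyclic monoid.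
\<close>

type_synonym unmatched = "nat \<times> nat"

fun sign_excess :: "sign option \<Rightarrow> unmatched" where
  "sign_excess None = (0, 0)"
| "sign_excess (Some Minus) = (1, 0)"
| "sign_excess (Some Plus) = (0, 1)"

definition meld :: "unmatched \<Rightarrow> unmatched \<Rightarrow> unmatched" (infixr \<open>\<bullet>\<close> 70) where
  "x \<bullet> y = (fst x + (fst y - snd x), snd y + (snd x - fst y))"

lemma meld_assoc: "(x \<bullet> y) \<bullet> z = x \<bullet> (y \<bullet> z)"
  by (auto simp: meld_def)

lemma meld_unit [simp]: "(0, 0) \<bullet> x = x" "x \<bullet> (0, 0) = x"
  by (auto simp: meld_def)

text \<open>
  The unmatched signs of a word whose letters have signs given by \<open>s\<close>, with None for a neutral letter.
\<close>

fun excess :: "('a \<Rightarrow> sign option) \<Rightarrow> 'a list \<Rightarrow> unmatched" where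
  "excess s [] = (0, 0)"
| "excess s (x # w) = sign_excess (s x) \<bullet> excess s w"

lemma excess_append: "excess s (u @ v) = excess s u \<bullet> excess s v"
  by (induction u) (auto simp: meld_assoc)

text \<open>
  Applies \<open>t\<close> to those letters \<open>x\<close> of a word for which \<open>P\<close> holds of the sign of \<open>x\<close> and of the unmatched
  signs to the left and to the right of \<open>x\<close>. The word itself stands between contexts with unmatched signs
  \<open>L\<close> and \<open>R\<close>, so that relabelling distributes over concatenation. All conditions refer to the word
  before the relabelling.
\<close>

fun relabel :: "(sign option \<Rightarrow> unmatched \<Rightarrow> unmatched \<Rightarrow> bool) \<Rightarrow> ('a \<Rightarrow> sign option) \<Rightarrow> ('a \<Rightarrow> 'a)
    \<Rightarrow> unmatched \<Rightarrow> 'a list \<Rightarrow> unmatched \<Rightarrow> 'a list" where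
  "relabel P s t L [] R = []"
| "relabel P s t L (x # w) R =
     (if P (s x) L (excess s w \<bullet> R) then t x else x) # relabel P s t (L \<bullet> sign_excess (s x)) w R"

lemma length_relabel [simp]: "length (relabel P s t L w R) = length w"
  by (induction w arbitrary: L) auto

lemma relabel_append:
  "relabel P s t L (u @ v) R =
     relabel P s t L u (excess s v \<bullet> R) @ relabel P s t (L \<bullet> excess s u) v R"
  by (induction u arbitrary: L) (auto simp: excess_append meld_assoc)

text \<open>
  The right context followed by the left context is the rest of the word, read cyclically from the
  letter in question. A minus is selected if no plus of the rest is unmatched, a plus if no minus is.
\<close>

fun cyclic :: "sign option \<Rightarrow> unmatched \<Rightarrow> unmatched \<Rightarrow> bool" where
  "cyclic None L R \<longleftrightarrow> False"
| "cyclic (Some Minus) L R \<longleftrightarrow> snd (R \<bullet> L) = 0"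
| "cyclic (Some Plus) L R \<longleftrightarrow> fst (R \<bullet> L) = 0"

text \<open>
  The crystal reflection of a word. That it agrees with the iterated crystal operators is shown in
  \<open>reflect_eq_lower\<close>, \<open>reflect_eq_raise\<close> and \<open>iterate_reflect_word\<close>.
\<close>

definition reflect :: "('a \<Rightarrow> sign option) \<Rightarrow> ('a \<Rightarrow> 'a) \<Rightarrow> 'a list \<Rightarrow> 'a list" where
  "reflect s t w = relabel cyclic s t (0, 0) w (0, 0)"

lemma length_reflect [simp]: "length (reflect s t w) = length w"
  by (simp add: reflect_def)

text \<open>
  The selection depends only on the product of the right and the left context, so a factor may be
  moved around the circle.
\<close>

lemma relabel_cyclic_shift:
  "relabel cyclic s t (X \<bullet> L) w R = relabel cyclic s t L w (R \<bullet> X)"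
proof (induction w arbitrary: L)
  case (Cons x w)
  have "cyclic g (X \<bullet> L) Y = cyclic g L (Y \<bullet> X)" for g Y
    by (cases "(g, L, Y)" rule: cyclic.cases) (auto simp: meld_assoc)
  then show ?case
    by (simp add: meld_assoc Cons)
qed simp

lemma reflect_rotate:
  "reflect s t (u @ v) = relabel cyclic s t (excess s v) u (0, 0) @ relabel cyclic s t (excess s u) v (0, 0)"
  using relabel_cyclic_shift[of s t "excess s v" "(0, 0)" u "(0, 0)"]
  by (simp add: reflect_def relabel_append)

section \<open>Reflections as iterated changes of one sign\<close>

fun opposite :: "sign \<Rightarrow> sign" where
  "opposite Minus = Plus"
| "opposite Plus = Minus"

text \<open>
  Selects the last \<open>j\<close> unmatched minuses of a word: a minus is unmatched if no unmatched plus stands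
  to its left, and the unmatched minuses to its right are then unmatched in the whole word.
  Dually, \<open>raise_first\<close> selects the first \<open>j\<close> unmatched pluses.
\<close>

fun lower_last :: "nat \<Rightarrow> sign option \<Rightarrow> unmatched \<Rightarrow> unmatched \<Rightarrow> bool" where
  "lower_last j g L R \<longleftrightarrow> g = Some Minus \<and> snd L = 0 \<and> fst R < j"

fun raise_first :: "nat \<Rightarrow> sign option \<Rightarrow> unmatched \<Rightarrow> unmatched \<Rightarrow> bool" where
  "raise_first j g L R \<longleftrightarrow> g = Some Plus \<and> fst R = 0 \<and> snd L < j"

declare lower_last.simps [simp del] raise_first.simps [simp del]

lemma relabel_cong:
  assumes "\<And>u x v. w = u @ x # v \<Longrightarrow>
      P (s x) (L \<bullet> excess s u) (excess s v \<bullet> R) = P' (s x) (L' \<bullet> excess s u) (excess s v \<bullet> R')"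
  shows "relabel P s t L w R = relabel P' s t L' w R'"
  using assms
proof (induction w arbitrary: L L')
  case (Cons x w)
  have "relabel P s t (L \<bullet> sign_excess (s x)) w R = relabel P' s t (L' \<bullet> sign_excess (s x)) w R'"
  proof (rule Cons.IH)
    fix u y v assume "w = u @ y # v"
    then show "P (s y) ((L \<bullet> sign_excess (s x)) \<bullet> excess s u) (excess s v \<bullet> R) =
        P' (s y) ((L' \<bullet> sign_excess (s x)) \<bullet> excess s u) (excess s v \<bullet> R')"
      using Cons.prems[of "x # u" y v] by (simp add: meld_assoc)
  qed
  then show ?case
    using Cons.prems[of "[]" x w] by simp
qed simp

lemma relabel_ident:
  assumes "\<And>u x v. w = u @ x # v \<Longrightarrow> \<not> P (s x) (L \<bullet> excess s u) (excess s v \<bullet> R)"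
  shows "relabel P s t L w R = w"
proof -
  have "relabel (\<lambda>_ _ _. False) s t L w R = w"
    by (induction w arbitrary: L) simp_all
  then show ?thesis
    using assms by (subst relabel_cong[where P' = "\<lambda>_ _ _. False"]) auto
qed

text \<open>
  Changing the last \<open>j + 1\<close> unmatched minuses amounts to changing the last one, which is the letter \<open>x\<close>,
  and then the last \<open>j\<close> of the resulting word.
\<close>

lemma lower_step:
  assumes "s x = Some Minus" "s (t x) = Some Plus" "snd (excess s u) = 0" "fst (excess s v) = 0"
  shows "relabel (lower_last (Suc j)) s t (0, 0) (u @ x # v) (0, 0) =
    relabel (lower_last j) s t (0, 0) (u @ t x # v) (0, 0)"
proof -
  have "relabel (lower_last (Suc j)) s t (0, 0) u (excess s (x # v)) =
      relabel (lower_last j) s t (0, 0) u (excess s (t x # v))"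
  proof (rule relabel_cong)
    fix u1 y u2 assume "u = u1 @ y # u2"
    then show "lower_last (Suc j) (s y) ((0, 0) \<bullet> excess s u1) (excess s u2 \<bullet> excess s (x # v)) =
        lower_last j (s y) ((0, 0) \<bullet> excess s u1) (excess s u2 \<bullet> excess s (t x # v))"
      using assms by (auto simp: excess_append meld_def lower_last.simps)
  qed
  moreover have "relabel (lower_last (Suc j)) s t (excess s (u @ [x])) v (0, 0) = v"
    by (rule relabel_ident) (use assms in \<open>auto simp: excess_append meld_def lower_last.simps\<close>)
  moreover have "relabel (lower_last j) s t (excess s (u @ [t x])) v (0, 0) = v"
    by (rule relabel_ident) (use assms in \<open>auto simp: excess_append meld_def lower_last.simps\<close>)
  ultimately show ?thesis
    using assms by (auto simp: relabel_append excess_append lower_last.simps meld_def)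
qed

lemma raise_step:
  assumes "s x = Some Plus" "s (t x) = Some Minus" "snd (excess s u) = 0" "fst (excess s v) = 0"
  shows "relabel (raise_first (Suc j)) s t (0, 0) (u @ x # v) (0, 0) =
    relabel (raise_first j) s t (0, 0) (u @ t x # v) (0, 0)"
proof -
  have "relabel (raise_first (Suc j)) s t (0, 0) u (excess s (x # v)) = u"
    by (rule relabel_ident) (use assms in \<open>auto simp: excess_append meld_def raise_first.simps\<close>)
  moreover have "relabel (raise_first j) s t (0, 0) u (excess s (t x # v)) = u"
    by (rule relabel_ident) (use assms in \<open>auto simp: excess_append meld_def raise_first.simps\<close>)
  moreover have "relabel (raise_first (Suc j)) s t (excess s (u @ [x])) v (0, 0) =
     relabel (raise_first j) s t (excess s (u @ [t x])) v (0, 0)"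
  proof (rule relabel_cong)
    fix u1 y u2 assume "v = u1 @ y # u2"
    then show "raise_first (Suc j) (s y) (excess s (u @ [x]) \<bullet> excess s u1) (excess s u2 \<bullet> (0, 0)) =
        raise_first j (s y) (excess s (u @ [t x]) \<bullet> excess s u1) (excess s u2 \<bullet> (0, 0))"
      using assms by (auto simp: excess_append meld_def raise_first.simps)
  qed
  ultimately show ?thesis
    using assms by (auto simp: relabel_append excess_append raise_first.simps meld_def)
qed

text \<open>
  With \<open>p\<close> unmatched minuses and \<open>q \<le> p\<close> unmatched pluses, the pluses bracket cyclically with the first \<open>q\<close>
  minuses, so the cyclic rule selects the last \<open>p - q\<close> minuses.
\<close>

lemma reflect_eq_lower:
  assumes "excess s w = (p, q)" "q \<le> p"
  shows "reflect s t w = relabel (lower_last (p - q)) s t (0, 0) w (0, 0)"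
  unfolding reflect_def
proof (rule relabel_cong)
  fix u x v assume "w = u @ x # v"
  then show "cyclic (s x) ((0, 0) \<bullet> excess s u) (excess s v \<bullet> (0, 0)) =
      lower_last (p - q) (s x) ((0, 0) \<bullet> excess s u) (excess s v \<bullet> (0, 0))"
    using assms by (cases "s x" rule: sign_excess.cases) (auto simp: excess_append meld_def lower_last.simps)
qed

lemma reflect_eq_raise:
  assumes "excess s w = (p, q)" "p \<le> q"
  shows "reflect s t w = relabel (raise_first (q - p)) s t (0, 0) w (0, 0)"
  unfolding reflect_def
proof (rule relabel_cong)
  fix u x v assume "w = u @ x # v"
  then show "cyclic (s x) ((0, 0) \<bullet> excess s u) (excess s v \<bullet> (0, 0)) =
      raise_first (q - p) (s x) ((0, 0) \<bullet> excess s u) (excess s v \<bullet> (0, 0))"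
    using assms by (cases "s x" rule: sign_excess.cases) (auto simp: excess_append meld_def raise_first.simps)
qed

lemma relabel_lower_0: "relabel (lower_last 0) s t L w R = w"
  by (rule relabel_ident) (simp add: lower_last.simps)

lemma relabel_raise_0: "relabel (raise_first 0) s t L w R = w"
  by (rule relabel_ident) (simp add: raise_first.simps)

section \<open>The crystal operators and their iterates\<close>

text \<open>
  The involution of the letters that exchanges the two signs for index \<open>i\<close>: the letter change of \<open>f\<^sub>i\<close>
  together with its inverse.
\<close>

definition flip_letter :: "nat \<Rightarrow> nat \<Rightarrow> letter \<Rightarrow> letter" where
  "flip_letter m i x =
     (if i < m then
        if x = Plain i then Plain (i + 1) else if x = Plain (i + 1) then Plain i
        else if x = Barred i then Barred (i + 1) else if x = Barred (i + 1) then Barred i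
        else x
      else if x = Plain m then Barred m else if x = Barred m then Plain m else x)"

lemma flip_letter_flip_letter [simp]: "flip_letter m i (flip_letter m i x) = x"
  by (auto simp: flip_letter_def)

lemma sign_of_flip_letter:
  "sign_of m i (flip_letter m i x) = map_option opposite (sign_of m i x)"
  by (auto simp: flip_letter_def sign_of_def)

lemma f_letter_eq_flip_letter: "sign_of m i x = Some Minus \<Longrightarrow> f_letter m i x = flip_letter m i x"
  by (auto simp: flip_letter_def sign_of_def f_letter_def split: if_splits)

text \<open>
  The signed positions of a word, with positions counted from \<open>k\<close>; a recursive form of the signature.
\<close>

fun indexed_signs :: "('a \<Rightarrow> sign option) \<Rightarrow> nat \<Rightarrow> 'a list \<Rightarrow> (nat \<times> sign) list" where
  "indexed_signs s k [] = []"
| "indexed_signs s k (x # w) =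
     (case s x of None \<Rightarrow> [] | Some g \<Rightarrow> [(k, g)]) @ indexed_signs s (Suc k) w"

lemma indexed_signs_append:
  "indexed_signs s k (u @ v) = indexed_signs s k u @ indexed_signs s (k + length u) v"
  by (induction u arbitrary: k) auto

lemma signature_eq_indexed_signs: "signature m i w = indexed_signs (sign_of m i) 0 w"
proof (induction w rule: rev_induct)
  case Nil
  then show ?case by (simp add: signature_def List.map_filter_def)
next
  case (snoc x w)
  let ?f = "\<lambda>w s. map_option (Pair s) (sign_of m i (w ! s))"
  have "List.map_filter (?f (w @ [x])) [0..<length w] = List.map_filter (?f w) [0..<length w]"
    by (auto simp: List.map_filter_def nth_append intro!: map_cong filter_cong)
  moreover have "List.map_filter (?f (w @ [x])) [length w] =
      (case sign_of m i x of None \<Rightarrow> [] | Some g \<Rightarrow> [(length w, g)])"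
    by (auto simp: List.map_filter_def split: option.splits)
  moreover have "List.map_filter (?f (w @ [x])) ([0..<length w] @ [length w]) =
     List.map_filter (?f (w @ [x])) [0..<length w] @ List.map_filter (?f (w @ [x])) [length w]"
    by (simp add: List.map_filter_def)
  ultimately show ?case
    using snoc by (simp add: signature_def indexed_signs_append)
qed

text \<open>
  The bracketing procedure leaves as many minuses and pluses as \<open>excess\<close> computes, and its last minus
  stands at the only position with no unmatched plus before it and no unmatched minus after it.
\<close>

lemma unbracketed_indexed_signs:
  "\<exists>us vs. unbracketed (indexed_signs s k w) = us @ vs \<and>
     snd ` set us \<subseteq> {Minus} \<and> snd ` set vs \<subseteq> {Plus} \<and>
     excess s w = (length us, length vs) \<and>
     (us \<noteq> [] \<longrightarrow> (\<exists>u x v. w = u @ x # v \<and> s x = Some Minus \<and>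
        snd (excess s u) = 0 \<and> fst (excess s v) = 0 \<and> fst (last us) = k + length u))"
proof (induction w arbitrary: k)
  case (Cons y w)
  from Cons[of "Suc k"] obtain us vs where
    uv: "unbracketed (indexed_signs s (Suc k) w) = us @ vs"
      "snd ` set us \<subseteq> {Minus}" "snd ` set vs \<subseteq> {Plus}"
      "excess s w = (length us, length vs)"
    and last: "us \<noteq> [] \<longrightarrow> (\<exists>u x v. w = u @ x # v \<and> s x = Some Minus \<and>
        snd (excess s u) = 0 \<and> fst (excess s v) = 0 \<and> fst (last us) = Suc k + length u)"
    by blast
  show ?case
  proof (cases "s y")
    case None
    have "\<exists>u x v. y # w = u @ x # v \<and> s x = Some Minus \<and>
        snd (excess s u) = 0 \<and> fst (excess s v) = 0 \<and> fst (last us) = k + length u" if "us \<noteq> []"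
    proof -
      from last that obtain u x v where "w = u @ x # v" "s x = Some Minus"
        "snd (excess s u) = 0" "fst (excess s v) = 0" "fst (last us) = Suc k + length u"
        by blast
      then show ?thesis
        using None by (intro exI[of _ "y # u"] exI[of _ x] exI[of _ v]) simp
    qed
    then show ?thesis
      using uv None by (intro exI[of _ us] exI[of _ vs]) auto
  next
    case (Some g)
    show ?thesis
    proof (cases g)
      case Minus
      have "\<exists>u x v. y # w = u @ x # v \<and> s x = Some Minus \<and>
        snd (excess s u) = 0 \<and> fst (excess s v) = 0 \<and> fst (last ((k, Minus) # us)) = k + length u"
      proof (cases "us = []")
        case True
        then show ?thesis
          using Some Minus uv by (intro exI[of _ "[]"] exI[of _ y] exI[of _ w]) simp
      next
        case False
        with last obtain u x v where "w = u @ x # v" "s x = Some Minus"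
          "snd (excess s u) = 0" "fst (excess s v) = 0" "fst (last us) = Suc k + length u"
          by blast
        then show ?thesis
          using False Some Minus
          by (intro exI[of _ "y # u"] exI[of _ x] exI[of _ v]) (simp add: meld_def)
      qed
      then show ?thesis
        using uv Some Minus by (intro exI[of _ "(k, Minus) # us"] exI[of _ vs]) (auto simp: meld_def)
    next
      case Plus
      show ?thesis
      proof (cases us)
        case Nil
        then show ?thesis
          using uv Some Plus by (intro exI[of _ "[]"] exI[of _ "(k, Plus) # vs"])
            (auto simp: meld_def split: list.splits sign.splits)
      next
        case (Cons a us')
        have "\<exists>u x v. y # w = u @ x # v \<and> s x = Some Minus \<and>
          snd (excess s u) = 0 \<and> fst (excess s v) = 0 \<and> fst (last us') = k + length u" if "us' \<noteq> []"
        proof -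
          from last Cons obtain u x v where *: "w = u @ x # v" "s x = Some Minus"
            "snd (excess s u) = 0" "fst (excess s v) = 0" "fst (last us) = Suc k + length u"
            by blast
          moreover have "fst (excess s u) > 0"
            using uv(4) Cons * that by (auto simp: excess_append meld_def)
          ultimately show ?thesis
            using Some Plus that Cons
            by (intro exI[of _ "y # u"] exI[of _ x] exI[of _ v]) (auto simp: meld_def)
        qed
        moreover have "unbracketed (indexed_signs s k (y # w)) = us' @ vs"
          using uv Some Plus Cons by (cases a) auto
        ultimately show ?thesis
          using uv Some Plus Cons by (intro exI[of _ us'] exI[of _ vs]) (auto simp: meld_def)
      qed
    qed
  qed
qed simp

lemma filter_minuses:
  assumes "snd ` set us \<subseteq> {Minus}" "snd ` set vs \<subseteq> {Plus}"
  shows "filter (\<lambda>(s, g). g = Minus) (us @ vs) = us"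
  using assms by (induction us) (force simp: filter_empty_conv)+

lemma f_word_None:
  assumes "fst (excess (sign_of m i) w) = 0"
  shows "f_word m i w = None"
proof -
  from unbracketed_indexed_signs[of "sign_of m i" 0 w] assms obtain vs where
    "unbracketed (indexed_signs (sign_of m i) 0 w) = [] @ vs" "snd ` set vs \<subseteq> {Plus}"
    by auto
  then show ?thesis
    using filter_minuses[of "[]" vs] by (simp add: f_word_def signature_eq_indexed_signs)
qed

lemma f_word_Some:
  assumes "fst (excess (sign_of m i) w) > 0"
  obtains u x v where "w = u @ x # v" "sign_of m i x = Some Minus"
    "snd (excess (sign_of m i) u) = 0" "fst (excess (sign_of m i) v) = 0"
    "f_word m i w = Some (u @ flip_letter m i x # v)"
proof -
  from unbracketed_indexed_signs[of "sign_of m i" 0 w] assms obtain us vs u x v where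
    *: "unbracketed (indexed_signs (sign_of m i) 0 w) = us @ vs"
      "snd ` set us \<subseteq> {Minus}" "snd ` set vs \<subseteq> {Plus}" "us \<noteq> []"
      "w = u @ x # v" "sign_of m i x = Some Minus"
      "snd (excess (sign_of m i) u) = 0" "fst (excess (sign_of m i) v) = 0"
      "fst (last us) = length u"
    by auto
  then have "f_word m i w = Some (u @ flip_letter m i x # v)"
    by (simp add: f_word_def signature_eq_indexed_signs filter_minuses f_letter_eq_flip_letter
        del: filter_append)
  with * that show thesis by blast
qed

lemma unmatched_sign_unique:
  assumes "u @ x # v = u' @ x' # v'"
    and "s x = Some g" "snd (excess s u) = 0" "fst (excess s v) = 0"
    and "s x' = Some g" "snd (excess s u') = 0" "fst (excess s v') = 0"
  shows "u = u' \<and> x = x' \<and> v = v'"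
proof -
  consider us where "u = u' @ us" "us @ x # v = x' # v'" | us where "u @ us = u'" "x # v = us @ x' # v'"
    using assms(1) by (auto simp: append_eq_append_conv2)
  then show ?thesis
  proof cases
    case 1
    then show ?thesis
      using assms(2-) by (cases us; cases g) (auto simp: excess_append meld_def)
  next
    case 2
    then show ?thesis
      using assms(2-) by (cases us; cases g) (auto simp: excess_append meld_def)
  qed
qed

lemma f_word_unmatched:
  assumes "sign_of m i x = Some Minus"
    "snd (excess (sign_of m i) u) = 0" "fst (excess (sign_of m i) v) = 0"
  shows "f_word m i (u @ x # v) = Some (u @ flip_letter m i x # v)"
proof -
  have "fst (excess (sign_of m i) (u @ x # v)) > 0"
    using assms by (simp add: excess_append meld_def)
  then obtain u' x' v' where *: "u @ x # v = u' @ x' # v'" "sign_of m i x' = Some Minus"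
    "snd (excess (sign_of m i) u') = 0" "fst (excess (sign_of m i) v') = 0"
    "f_word m i (u @ x # v) = Some (u' @ flip_letter m i x' # v')"
    by (rule f_word_Some)
  then show ?thesis
    using unmatched_sign_unique[OF *(1) assms *(2-4)] by simp
qed

lemma f_word_SomeD:
  assumes "f_word m i w = Some w'"
  obtains u x v where "w = u @ x # v" "sign_of m i x = Some Minus"
    "snd (excess (sign_of m i) u) = 0" "fst (excess (sign_of m i) v) = 0"
    "w' = u @ flip_letter m i x # v"
proof -
  have "fst (excess (sign_of m i) w) > 0"
    using assms f_word_None[of m i w] by fastforce
  then show thesis
    by (rule f_word_Some) (use that assms in auto)
qed

lemma e_word_unmatched:
  assumes "sign_of m i x = Some Plus"
    "snd (excess (sign_of m i) u) = 0" "fst (excess (sign_of m i) v) = 0"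
  shows "e_word m i (u @ x # v) = Some (u @ flip_letter m i x # v)"
proof -
  let ?w = "u @ flip_letter m i x # v"
  have f: "f_word m i ?w = Some (u @ x # v)"
    using f_word_unmatched[of m i "flip_letter m i x" u v] assms by (simp add: sign_of_flip_letter)
  moreover have "w = ?w" if "f_word m i w = Some (u @ x # v)" for w
    using that
  proof (rule f_word_SomeD)
    fix u' x' v'
    assume *: "w = u' @ x' # v'" "sign_of m i x' = Some Minus"
      "snd (excess (sign_of m i) u') = 0" "fst (excess (sign_of m i) v') = 0"
      "u @ x # v = u' @ flip_letter m i x' # v'"
    have "sign_of m i (flip_letter m i x') = Some Plus"
      using *(2) by (simp add: sign_of_flip_letter)
    from unmatched_sign_unique[OF *(5) assms this *(3,4)] show "w = ?w"
      using *(1) by simp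
  qed
  ultimately have "(THE w. f_word m i w = Some (u @ x # v)) = ?w"
    by (rule the_equality)
  then show ?thesis
    using f unfolding e_word_def by metis
qed

lemma e_word_SomeD:
  assumes "e_word m i w = Some w'"
  obtains u x v where "w = u @ x # v" "sign_of m i x = Some Plus"
    "snd (excess (sign_of m i) u) = 0" "fst (excess (sign_of m i) v) = 0"
    "w' = u @ flip_letter m i x # v"
proof -
  obtain w'' where "f_word m i w'' = Some w"
    using assms by (auto simp: e_word_def split: if_splits)
  then show thesis
  proof (rule f_word_SomeD)
    fix u x v
    assume *: "w'' = u @ x # v" "sign_of m i x = Some Minus"
      "snd (excess (sign_of m i) u) = 0" "fst (excess (sign_of m i) v) = 0"
      "w = u @ flip_letter m i x # v"
    have "sign_of m i (flip_letter m i x) = Some Plus"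
      using *(2) by (simp add: sign_of_flip_letter)
    moreover from e_word_unmatched[OF this *(3,4)] have "w' = u @ flip_letter m i (flip_letter m i x) # v"
      using assms *(5) by simp
    ultimately show thesis
      using that[of u "flip_letter m i x" v] * by blast
  qed
qed

lemma unmatched_plus_exists:
  assumes "snd (excess s w) > 0"
  shows "\<exists>u x v. w = u @ x # v \<and> s x = Some Plus \<and> snd (excess s u) = 0 \<and> fst (excess s v) = 0"
  using assms
proof (induction w rule: rev_induct)
  case (snoc y w)
  show ?case
  proof (cases "s y = Some Plus \<and> snd (excess s w) = 0")
    case True
    then show ?thesis
      by (intro exI[of _ w] exI[of _ y] exI[of _ "[]"]) simp
  next
    case False
    have "snd (excess s w) > 0"
      using False snoc.prems
      by (cases "s y" rule: sign_excess.cases) (auto simp: excess_append meld_def)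
    with snoc.IH obtain u x v where *: "w = u @ x # v" "s x = Some Plus"
      "snd (excess s u) = 0" "fst (excess s v) = 0"
      by blast
    then show ?thesis
      using snoc.prems
      by (intro exI[of _ u] exI[of _ x] exI[of _ "v @ [y]"], cases "s y" rule: sign_excess.cases)
        (auto simp: excess_append meld_def)
  qed
qed simp

lemma iterate_0 [simp]: "iterate 0 h x = Some x"
  by (simp add: iterate_def)

lemma iterate_Suc_bind: "iterate (Suc k) h x = Option.bind (h x) (iterate k h)"
proof -
  have "((\<lambda>y. Option.bind y h) ^^ k) None = None"
    by (induction k) simp_all
  then show ?thesis
    unfolding iterate_def funpow_Suc_right by (cases "h x") simp_all
qed

lemma iterate_Suc: "h x = Some y \<Longrightarrow> iterate (Suc k) h x = iterate k h y"
  by (simp add: iterate_Suc_bind)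

text \<open>
  The weight of a word, the pairing of a weight with the \<open>i\<close>-th simple coroot, and the \<open>i\<close>-th simple
  root in the coordinates of weights.
\<close>

definition word_weight :: "letter list \<Rightarrow> nat \<Rightarrow> int" where
  "word_weight w j = int (count_list w (Plain j)) - int (count_list w (Barred j))"

definition coroot_value :: "nat \<Rightarrow> nat \<Rightarrow> (nat \<Rightarrow> int) \<Rightarrow> int" where
  "coroot_value m i \<chi> = (if i < m then \<chi> i - \<chi> (i + 1) else \<chi> m)"

definition simple_root :: "nat \<Rightarrow> nat \<Rightarrow> nat \<Rightarrow> int" where
  "simple_root m i j = (if i < m then (if j = i then 1 else if j = i + 1 then -1 else 0)
     else if j = m then 2 else 0)"

text \<open>
  The exponent in the definition of the reflections is thus the surplus of unmatched minuses over
  unmatched pluses.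
\<close>

lemma coroot_value_word_weight:
  "coroot_value m i (word_weight w) =
     int (fst (excess (sign_of m i) w)) - int (snd (excess (sign_of m i) w))"
proof (induction w)
  case (Cons x w)
  then show ?case
    by (auto simp: coroot_value_def word_weight_def sign_of_def meld_def)
qed (simp add: coroot_value_def word_weight_def)

lemma word_weight_flip_Minus:
  assumes "sign_of m i x = Some Minus"
  shows "word_weight (u @ flip_letter m i x # v) j = word_weight (u @ x # v) j - simple_root m i j"
  using assms by (auto simp: word_weight_def sign_of_def flip_letter_def simple_root_def split: if_splits)

lemma word_weight_flip_Plus:
  assumes "sign_of m i x = Some Plus"
  shows "word_weight (u @ flip_letter m i x # v) j = word_weight (u @ x # v) j + simple_root m i j"
  using assms by (auto simp: word_weight_def sign_of_def flip_letter_def simple_root_def split: if_splits)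

abbreviation reflect_word :: "nat \<Rightarrow> nat \<Rightarrow> letter list \<Rightarrow> letter list" where
  "reflect_word m i \<equiv> reflect (sign_of m i) (flip_letter m i)"

lemma iterate_f_word:
  assumes "k \<le> fst (excess (sign_of m i) w)"
  shows "iterate k (f_word m i) w =
      Some (relabel (lower_last k) (sign_of m i) (flip_letter m i) (0, 0) w (0, 0)) \<and>
    word_weight (relabel (lower_last k) (sign_of m i) (flip_letter m i) (0, 0) w (0, 0)) j =
      word_weight w j - int k * simple_root m i j"
  using assms
proof (induction k arbitrary: w)
  case (Suc k)
  from Suc.prems have "fst (excess (sign_of m i) w) > 0" by simp
  then obtain u x v where *: "w = u @ x # v" "sign_of m i x = Some Minus"
    "snd (excess (sign_of m i) u) = 0" "fst (excess (sign_of m i) v) = 0"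
    "f_word m i w = Some (u @ flip_letter m i x # v)"
    by (rule f_word_Some)
  have "k \<le> fst (excess (sign_of m i) (u @ flip_letter m i x # v))"
    using Suc.prems * by (simp add: excess_append meld_def sign_of_flip_letter)
  from Suc.IH[OF this] show ?case
    using * by (simp add: iterate_Suc lower_step sign_of_flip_letter word_weight_flip_Minus algebra_simps)
qed (simp add: relabel_lower_0)

lemma iterate_e_word:
  assumes "k \<le> snd (excess (sign_of m i) w)"
  shows "iterate k (e_word m i) w =
      Some (relabel (raise_first k) (sign_of m i) (flip_letter m i) (0, 0) w (0, 0)) \<and>
    word_weight (relabel (raise_first k) (sign_of m i) (flip_letter m i) (0, 0) w (0, 0)) j =
      word_weight w j + int k * simple_root m i j"
  using assms
proof (induction k arbitrary: w)
  case (Suc k)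
  from Suc.prems have "snd (excess (sign_of m i) w) > 0" by simp
  then obtain u x v where *: "w = u @ x # v" "sign_of m i x = Some Plus"
    "snd (excess (sign_of m i) u) = 0" "fst (excess (sign_of m i) v) = 0"
    using unmatched_plus_exists by blast
  have e: "e_word m i w = Some (u @ flip_letter m i x # v)"
    using * e_word_unmatched by simp
  have "k \<le> snd (excess (sign_of m i) (u @ flip_letter m i x # v))"
    using Suc.prems * by (simp add: excess_append meld_def sign_of_flip_letter)
  from Suc.IH[OF this] show ?case
    using * e by (simp add: iterate_Suc raise_step sign_of_flip_letter word_weight_flip_Plus algebra_simps)
qed (simp add: relabel_raise_0)

theorem iterate_reflect_word:
  fixes m i j :: nat and w :: "letter list"
  defines "k \<equiv> coroot_value m i (word_weight w)"
  shows "(if k \<ge> 0 then iterate (nat k) (f_word m i) w else iterate (nat (- k)) (e_word m i) w) =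
      Some (reflect_word m i w)"
    and "word_weight (reflect_word m i w) j = word_weight w j - k * simple_root m i j"
proof -
  obtain p q where pq: "excess (sign_of m i) w = (p, q)" by fastforce
  have k: "k = int p - int q"
    using pq by (simp add: k_def coroot_value_word_weight)
  have "(if k \<ge> 0 then iterate (nat k) (f_word m i) w else iterate (nat (- k)) (e_word m i) w) =
      Some (reflect_word m i w) \<and>
    word_weight (reflect_word m i w) j = word_weight w j - k * simple_root m i j"
  proof (cases "q \<le> p")
    case True
    have "reflect_word m i w = relabel (lower_last (p - q)) (sign_of m i) (flip_letter m i) (0, 0) w (0, 0)"
      by (rule reflect_eq_lower[OF pq True])
    moreover have "nat k = p - q" "k \<ge> 0" "int (p - q) = k"
      using k True by simp_all
    ultimately show ?thesis
      using iterate_f_word[of "p - q" m i w j] pq by simp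
  next
    case False
    then have "reflect_word m i w = relabel (raise_first (q - p)) (sign_of m i) (flip_letter m i) (0, 0) w (0, 0)"
      by (intro reflect_eq_raise[OF pq]) simp
    moreover have "nat (- k) = q - p" "\<not> k \<ge> 0" "int (q - p) = - k"
      using k False by simp_all
    ultimately show ?thesis
      using iterate_e_word[of "q - p" m i w j] pq by simp
  qed
  then show "(if k \<ge> 0 then iterate (nat k) (f_word m i) w else iterate (nat (- k)) (e_word m i) w) =
      Some (reflect_word m i w)"
    and "word_weight (reflect_word m i w) j = word_weight w j - k * simple_root m i j"
    by (rule conjunct1, rule conjunct2)
qed

section \<open>Weyl group action on words in type A\<close>

text \<open>
  In type A the letters are natural numbers; for the index \<open>i\<close> the letter \<open>i\<close> is a minus, \<open>i + 1\<close> is a plus,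
  and the others are neutral.
\<close>

definition step_sign :: "nat \<Rightarrow> nat \<Rightarrow> sign option" where
  "step_sign i x = (if x = i then Some Minus else if x = Suc i then Some Plus else None)"

definition step_flip :: "nat \<Rightarrow> nat \<Rightarrow> nat" where
  "step_flip i x = (if x = i then Suc i else if x = Suc i then i else x)"

abbreviation reflect_A :: "nat \<Rightarrow> nat list \<Rightarrow> nat list" where
  "reflect_A i \<equiv> reflect (step_sign i) (step_flip i)"

text \<open>
  The elementary Knuth transformation of a word of three letters, as a total involution: the classes
  \<open>bac\<close>, \<open>bca\<close> with \<open>a < b \<le> c\<close> and \<open>acb\<close>, \<open>cab\<close> with \<open>a \<le> b < c\<close> are exchanged, and words that are weakly
  increasing or strictly decreasing are fixed.
\<close>

definition knuth :: "nat \<Rightarrow> nat \<Rightarrow> nat \<Rightarrow> nat list" where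
  "knuth a b c =
     (if b < a \<and> a \<le> c \<or> c < a \<and> a \<le> b then [a, c, b]
      else if a \<le> c \<and> c < b \<or> b \<le> c \<and> c < a then [b, a, c]
      else [a, b, c])"

lemma knuth_knuth: "knuth a b c = [x, y, z] \<Longrightarrow> knuth x y z = [a, b, c]"
  by (auto simp: knuth_def split: if_splits)

lemma step_sign_simps [simp]:
  "step_sign i i = Some Minus" "step_sign i (Suc i) = Some Plus"
  by (auto simp: step_sign_def)

lemma step_sign_None: "step_sign i x = None \<longleftrightarrow> x \<noteq> i \<and> x \<noteq> Suc i"
  by (auto simp: step_sign_def)

lemma step_flip_simps [simp]: "step_flip i i = Suc i" "step_flip i (Suc i) = i"
  by (auto simp: step_flip_def)

lemma knuth_cases:
  obtains (down) "b < a" "a \<le> c" "knuth a b c = [a, c, b]"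
  | (down') "c < a" "a \<le> b" "knuth a b c = [a, c, b]"
  | (up) "a \<le> c" "c < b" "knuth a b c = [b, a, c]"
  | (up') "b \<le> c" "c < a" "knuth a b c = [b, a, c]"
  | (increasing) "a \<le> b" "b \<le> c" "knuth a b c = [a, b, c]"
  | (decreasing) "b < a" "c < b" "knuth a b c = [a, b, c]"
  unfolding knuth_def by (metis not_le)

abbreviation relabel_A :: "nat \<Rightarrow> unmatched \<Rightarrow> nat list \<Rightarrow> unmatched \<Rightarrow> nat list" where
  "relabel_A i \<equiv> relabel cyclic (step_sign i) (step_flip i)"

lemma relabel_A_context: "relabel_A i L w R = relabel_A i (0, 0) w (R \<bullet> L)"
  using relabel_cyclic_shift[of "step_sign i" "step_flip i" L "(0, 0)" w R] by simp

lemma relabel_A_pair_aux: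
  "\<exists>x y. relabel_A i (0, 0) [a, b] (p, q) = [x, y] \<and> (x \<le> y \<longleftrightarrow> a \<le> b)"
proof -
  consider "step_sign i a = None" | "step_sign i b = None"
    | "a = i" "b = i" | "a = i" "b = Suc i" | "a = Suc i" "b = i" | "a = Suc i" "b = Suc i"
    by (metis step_sign_None)
  then show ?thesis
    by cases (auto simp: meld_def step_sign_def step_flip_def split: if_splits)
qed

lemma relabel_A_pair:
  "\<exists>x y. relabel_A i L [a, b] R = [x, y] \<and> (x \<le> y \<longleftrightarrow> a \<le> b)"
  using relabel_A_pair_aux[of i a b "fst (R \<bullet> L)" "snd (R \<bullet> L)"]
  by (subst relabel_A_context) simp

lemma step_flip_neutral:
  assumes "step_sign i n = None"
  shows "n < step_flip i x \<longleftrightarrow> n < x" "n \<le> step_flip i x \<longleftrightarrow> n \<le> x"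
    "step_flip i x < n \<longleftrightarrow> x < n" "step_flip i x \<le> n \<longleftrightarrow> x \<le> n"
  using assms by (auto simp: step_sign_def step_flip_def split: if_splits)

text \<open>
  A neutral letter affects neither the contexts of other letters nor its order relative to them.
\<close>

lemma relabel_A_triple_neutral:
  assumes "step_sign i n = None" "relabel_A i L [a, b] R = [x, y]"
  shows "relabel_A i L [n, a, b] R = [n, x, y]" "relabel_A i L [a, n, b] R = [x, n, y]"
    "relabel_A i L [a, b, n] R = [x, y, n]"
    "n < x \<longleftrightarrow> n < a" "n \<le> x \<longleftrightarrow> n \<le> a" "x < n \<longleftrightarrow> a < n" "x \<le> n \<longleftrightarrow> a \<le> n"
    "n < y \<longleftrightarrow> n < b" "n \<le> y \<longleftrightarrow> n \<le> b" "y < n \<longleftrightarrow> b < n" "y \<le> n \<longleftrightarrow> b \<le> n"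
  using assms by (auto simp: step_flip_neutral split: if_splits)

lemma knuth_down: "b < a \<Longrightarrow> a \<le> c \<Longrightarrow> knuth a b c = [a, c, b]"
  by (auto simp: knuth_def)

lemma knuth_up: "a \<le> c \<Longrightarrow> c < b \<Longrightarrow> knuth a b c = [b, a, c]"
  by (auto simp: knuth_def)

lemma relabel_A_down:
  assumes "b < a" "a \<le> c"
  shows "\<exists>x y z. relabel_A i L [a, b, c] R = [x, y, z] \<and> relabel_A i L [a, c, b] R = knuth x y z
    \<and> excess (step_sign i) [a, b, c] = excess (step_sign i) [a, c, b]"
proof -
  have "step_sign i b = None \<or> step_sign i c = None \<or> a = Suc i \<and> b = i \<and> c = Suc i"
    using assms unfolding step_sign_None by arith
  then consider "step_sign i b = None" | "step_sign i c = None" | "a = Suc i" "b = i" "c = Suc i"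
    by metis
  then show ?thesis
  proof cases
    case 1
    obtain x z where xz: "relabel_A i L [a, c] R = [x, z]" "x \<le> z \<longleftrightarrow> a \<le> c"
      using relabel_A_pair by blast
    note n = relabel_A_triple_neutral[OF 1 xz(1)]
    show ?thesis
      unfolding n using n(4) xz assms 1 by (simp add: knuth_down)
  next
    case 2
    obtain x y where xy: "relabel_A i L [a, b] R = [x, y]" "x \<le> y \<longleftrightarrow> a \<le> b"
      using relabel_A_pair by blast
    note n = relabel_A_triple_neutral[OF 2 xy(1)]
    show ?thesis
      unfolding n using n(7) xy assms 2 by (simp add: knuth_down)
  next
    case 3
    obtain p q where "R \<bullet> L = (p, q)" by fastforce
    then show ?thesis
      unfolding 3 relabel_A_context[of i L _ R] by (auto simp: meld_def knuth_def)
  qed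
qed

lemma relabel_A_up:
  assumes "a \<le> c" "c < b"
  shows "\<exists>x y z. relabel_A i L [a, b, c] R = [x, y, z] \<and> relabel_A i L [b, a, c] R = knuth x y z
    \<and> excess (step_sign i) [a, b, c] = excess (step_sign i) [b, a, c]"
proof -
  have "step_sign i a = None \<or> step_sign i b = None \<or> a = i \<and> b = Suc i \<and> c = i"
    using assms unfolding step_sign_None by arith
  then consider "step_sign i a = None" | "step_sign i b = None" | "a = i" "b = Suc i" "c = i"
    by metis
  then show ?thesis
  proof cases
    case 1
    obtain y z where yz: "relabel_A i L [b, c] R = [y, z]" "y \<le> z \<longleftrightarrow> b \<le> c"
      using relabel_A_pair by blast
    note n = relabel_A_triple_neutral[OF 1 yz(1)]
    show ?thesis
      unfolding n using n(9) yz assms 1 by (simp add: knuth_up)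
  next
    case 2
    obtain x z where xz: "relabel_A i L [a, c] R = [x, z]" "x \<le> z \<longleftrightarrow> a \<le> c"
      using relabel_A_pair by blast
    note n = relabel_A_triple_neutral[OF 2 xz(1)]
    show ?thesis
      unfolding n using n(10) xz assms 2 by (simp add: knuth_up)
  next
    case 3
    obtain p q where "R \<bullet> L = (p, q)" by fastforce
    then show ?thesis
      unfolding 3 relabel_A_context[of i L _ R] by (auto simp: meld_def knuth_def)
  qed
qed

lemma relabel_A_monotone:
  assumes "a \<le> b \<and> b \<le> c \<or> b < a \<and> c < b"
  shows "\<exists>x y z. relabel_A i L [a, b, c] R = [x, y, z] \<and> knuth x y z = [x, y, z]"
proof -
  obtain x y where xy: "relabel_A i L [a, b] (excess (step_sign i) [c] \<bullet> R) = [x, y]" "x \<le> y \<longleftrightarrow> a \<le> b"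
    using relabel_A_pair by blast
  obtain y' z where yz: "relabel_A i (L \<bullet> excess (step_sign i) [a]) [b, c] R = [y', z]" "y' \<le> z \<longleftrightarrow> b \<le> c"
    using relabel_A_pair by blast
  have "relabel_A i L ([a, b] @ [c]) R = [x, y] @ relabel_A i (L \<bullet> excess (step_sign i) [a, b]) [c] R"
    unfolding relabel_append xy(1) ..
  moreover have "relabel_A i L ([a] @ [b, c]) R = relabel_A i L [a] (excess (step_sign i) [b, c] \<bullet> R) @ [y', z]"
    unfolding relabel_append yz(1) ..
  ultimately have "relabel_A i L [a, b, c] R = [x, y, z] \<and> y = y'"
    by auto
  then show ?thesis
    using assms xy(2) yz(2) by (auto simp: knuth_def)
qed

text \<open>
  A Knuth transformation and a reflection commute. The kind of the transformation may change, but
  not its position.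
\<close>

lemma relabel_knuth:
  "\<exists>x y z. relabel_A i L [a, b, c] R = [x, y, z] \<and> relabel_A i L (knuth a b c) R = knuth x y z \<and>
     excess (step_sign i) (knuth a b c) = excess (step_sign i) [a, b, c]"
proof (cases rule: knuth_cases[of b a c])
  case down
  then show ?thesis
    using relabel_A_down[OF down(1,2), of i L R] unfolding down(3) by metis
next
  case down'
  obtain x y z where xyz: "relabel_A i L (knuth a b c) R = [x, y, z]"
    "relabel_A i L [a, b, c] R = knuth x y z"
    "excess (step_sign i) (knuth a b c) = excess (step_sign i) [a, b, c]"
    using relabel_A_down[OF down'(1,2), of i L R] unfolding down'(3) by blast
  obtain x' y' z' where k: "knuth x y z = [x', y', z']"
    by (cases rule: knuth_cases[of y x z]) blast+
  from xyz(2,3) show ?thesis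
    unfolding xyz(1) k using knuth_knuth[OF k, symmetric] by blast
next
  case up
  then show ?thesis
    using relabel_A_up[OF up(1,2), of i L R] unfolding up(3) by metis
next
  case up'
  obtain x y z where xyz: "relabel_A i L (knuth a b c) R = [x, y, z]"
    "relabel_A i L [a, b, c] R = knuth x y z"
    "excess (step_sign i) (knuth a b c) = excess (step_sign i) [a, b, c]"
    using relabel_A_up[OF up'(1,2), of i L R] unfolding up'(3) by blast
  obtain x' y' z' where k: "knuth x y z = [x', y', z']"
    by (cases rule: knuth_cases[of y x z]) blast+
  from xyz(2,3) show ?thesis
    unfolding xyz(1) k using knuth_knuth[OF k, symmetric] by blast
next
  case increasing
  then show ?thesis
    using relabel_A_monotone[of a b c i L R] by auto
next
  case decreasing
  then show ?thesis
    using relabel_A_monotone[of a b c i L R] by auto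
qed

lemma reflect_A_knuth:
  "\<exists>u' x y z v'. reflect_A i (u @ [a, b, c] @ v) = u' @ [x, y, z] @ v' \<and>
     reflect_A i (u @ knuth a b c @ v) = u' @ knuth x y z @ v' \<and> length u' = length u"
proof -
  let ?s = "step_sign i" and ?t = "step_flip i"
  obtain x y z where *:
    "relabel cyclic ?s ?t (excess ?s u) [a, b, c] (excess ?s v) = [x, y, z]"
    "relabel cyclic ?s ?t (excess ?s u) (knuth a b c) (excess ?s v) = knuth x y z"
    and ex: "excess ?s (knuth a b c) = excess ?s [a, b, c]"
    using relabel_knuth by blast
  have "reflect_A i (u @ w @ v) = relabel cyclic ?s ?t (0, 0) u (excess ?s w \<bullet> excess ?s v) @
      relabel cyclic ?s ?t (excess ?s u) w (excess ?s v) @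
      relabel cyclic ?s ?t (excess ?s u \<bullet> excess ?s w) v (0, 0)" for w
    by (simp add: reflect_def relabel_append excess_append)
  note this[of "[a, b, c]", unfolded *] this[of "knuth a b c", unfolded * ex]
  then show ?thesis
    using length_relabel by blast
qed

lemma foldr_reflect_A_knuth:
  "\<exists>u' x y z v'. foldr reflect_A js (u @ [a, b, c] @ v) = u' @ [x, y, z] @ v' \<and>
     foldr reflect_A js (u @ knuth a b c @ v) = u' @ knuth x y z @ v' \<and> length u' = length u"
proof (induction js)
  case Nil
  show ?case unfolding foldr.simps id_apply by blast
next
  case (Cons j js)
  then obtain u' x y z v' where *: "foldr reflect_A js (u @ [a, b, c] @ v) = u' @ [x, y, z] @ v'"
     "foldr reflect_A js (u @ knuth a b c @ v) = u' @ knuth x y z @ v'" "length u' = length u"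
    by blast
  show ?case
    using reflect_A_knuth[of j u' x y z v'] unfolding foldr.simps comp_apply * .
qed

lemma foldr_reflect_A_rotate:
  "\<exists>u' v'. foldr reflect_A js (u @ v) = u' @ v' \<and> foldr reflect_A js (v @ u) = v' @ u' \<and>
     length u' = length u \<and> length v' = length v"
proof (induction js)
  case (Cons j js)
  then obtain u' v' where *: "foldr reflect_A js (u @ v) = u' @ v'"
    "foldr reflect_A js (v @ u) = v' @ u'" "length u' = length u" "length v' = length v"
    by blast
  show ?case
    unfolding foldr.simps comp_apply *(1,2) reflect_rotate
    using length_relabel *(3,4) by metis
qed auto

text \<open>
  The two moves of row insertion: with \<open>z < y\<close>, the inserted letter \<open>z\<close> travels left past the larger letters
  of the row, and the bumped letter \<open>y\<close> travels left past the smaller ones.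
\<close>

lemma knuth_move_left:
  assumes knuth: "\<And>u a b c v. P (u @ knuth a b c @ v) \<Longrightarrow> P (u @ [a, b, c] @ v)"
    and "sorted (y # b)" "z < y" "P (u @ y # z # b @ v)"
  shows "P (u @ y # b @ z # v)"
  using assms(2-)
proof (induction b arbitrary: v rule: rev_induct)
  case (snoc c b)
  obtain e d where d: "y # b = e @ [d]"
    by (cases "y # b" rule: rev_cases) auto
  have "d \<in> set (y # b)" unfolding d by simp
  then have "y \<le> d" "d \<le> c"
    using snoc.prems(1) by (auto simp: sorted_append)
  then have k: "knuth d c z = [d, z, c]"
    using \<open>z < y\<close> by (auto simp: knuth_def)
  have "P (u @ (y # b) @ z # c # v)"
    using snoc.IH[of "c # v"] snoc.prems by (auto simp: sorted_append)
  then have "P ((u @ e) @ knuth d c z @ v)"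
    unfolding k d by simp
  then have "P ((u @ e) @ [d, c, z] @ v)"
    by (rule knuth)
  then have "P (u @ (y # b) @ c # z # v)"
    unfolding d by simp
  then show ?case by simp
qed simp

lemma knuth_move_right:
  assumes knuth: "\<And>u a b c v. P (u @ knuth a b c @ v) \<Longrightarrow> P (u @ [a, b, c] @ v)"
    and "sorted (a @ [z])" "z < y" "P (u @ y # a @ z # v)"
  shows "P (u @ a @ y # z # v)"
  using assms(2-)
proof (induction a arbitrary: z v rule: rev_induct)
  case (snoc c a)
  have "c \<le> z"
    using snoc.prems(1) by (auto simp: sorted_append)
  then have k: "knuth c y z = [y, c, z]"
    using \<open>z < y\<close> by (auto simp: knuth_def)
  have "P (u @ a @ y # c # z # v)"
    by (rule snoc.IH) (use snoc.prems \<open>c \<le> z\<close> in \<open>auto simp: sorted_append\<close>)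
  then have "P ((u @ a) @ knuth c y z @ v)"
    unfolding k by simp
  then have "P ((u @ a) @ [c, y, z] @ v)"
    by (rule knuth)
  then show ?case by simp
qed simp

text \<open>
  Every word is connected with a weakly increasing one. Write the word as \<open>v r\<close> with \<open>r\<close> weakly increasing,
  rotate the first letter of \<open>v\<close> to the end and insert it into the row \<open>r\<close>. Either \<open>r\<close> grows, or a letter of \<open>r\<close>
  is replaced by a smaller one and the bumped letter joins the end of \<open>v\<close>. In both cases the length of
  \<open>v\<close> and the sum of \<open>r\<close> decrease lexicographically.
\<close>

theorem knuth_rotate_induct:
  assumes knuth: "\<And>u a b c v. P (u @ knuth a b c @ v) \<Longrightarrow> P (u @ [a, b, c] @ v)"
    and rotate: "\<And>u v. P (v @ u) \<Longrightarrow> P (u @ v)"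
    and sorted: "\<And>w. sorted w \<Longrightarrow> P w"
  shows "P w"
proof -
  have "P (v @ r)" if "sorted r" for v r
    using that
  proof (induction "(length v, sum_list r)" arbitrary: v r
      rule: wf_induct_rule[OF wf_lex_prod[OF wf_less_than wf_less_than]])
    case 1
    show ?case
    proof (cases v)
      case Nil
      then show ?thesis using sorted 1 by simp
    next
      case (Cons z v')
      show ?thesis
      proof (cases "\<forall>y\<in>set r. y \<le> z")
        case True
        have "P (v' @ (r @ [z]))"
          by (rule "1.hyps") (use Cons True "1.prems" in \<open>auto simp: sorted_append\<close>)
        then have "P ((v' @ r) @ [z])" by simp
        from rotate[OF this] Cons show ?thesis by simp
      next
        case False
        then have "\<exists>y\<in>set r. \<not> y \<le> z" by blast
        from split_list_first_prop[OF this] obtain a y b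
          where "r = a @ y # b" "\<not> y \<le> z" "\<forall>x\<in>set a. \<not> \<not> x \<le> z"
          by blast
        then have r: "r = a @ y # b" "z < y" "\<forall>x\<in>set a. x \<le> z"
          by auto
        have s: "sorted (a @ z # b)" "sorted (a @ [z])" "sorted (y # b)"
          using "1.prems" r by (auto simp: sorted_append)
        have "P ((v' @ [y]) @ (a @ z # b))"
          by (rule "1.hyps") (use Cons r s in auto)
        then have "P (v' @ a @ y # z # b)"
          using knuth_move_right[where P = P, OF knuth s(2) \<open>z < y\<close>, of v' b] by simp
        then have "P ((v' @ a) @ y # z # b @ [])" by simp
        then have "P ((v' @ a) @ y # b @ [z])"
          using knuth_move_left[where P = P, OF knuth s(3) \<open>z < y\<close>, of "v' @ a" "[]"] by simp
        then have "P ((v' @ a @ y # b) @ [z])" by simp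
        from rotate[OF this] show ?thesis using Cons r by simp
      qed
    qed
  qed
  from this[of "[]" w] show ?thesis by simp
qed

lemma sorted_split:
  fixes w :: "nat list"
  assumes "sorted w"
  shows "w = filter (\<lambda>x. x < i) w @ replicate (count_list w i) i @
    replicate (count_list w (Suc i)) (Suc i) @ filter (\<lambda>x. Suc i < x) w"
  using assms
proof (induction w)
  case (Cons x w)
  then have le: "\<forall>y\<in>set w. x \<le> y" by simp
  have e: "filter (\<lambda>x. x < i) w = []" if "i \<le> x"
    using le that by (auto simp: filter_empty_conv)
  have c1: "count_list w i = 0" if "i < x"
    using le that by (auto simp: count_list_0_iff)
  have c2: "count_list w (Suc i) = 0" if "Suc i < x"
    using le that by (auto simp: count_list_0_iff)
  consider "x < i" | "x = i" | "x = Suc i" | "Suc i < x" by linarith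
  then show ?case
    using Cons e c1 c2 by cases auto
qed simp

lemma excess_replicate:
  "excess s (replicate n x) = (case s x of None \<Rightarrow> (0, 0) | Some Minus \<Rightarrow> (n, 0) | Some Plus \<Rightarrow> (0, n))"
  by (induction n) (auto simp: meld_def split: option.splits sign.splits)

lemma excess_neutral: "(\<And>x. x \<in> set w \<Longrightarrow> s x = None) \<Longrightarrow> excess s w = (0, 0)"
  by (induction w) auto

lemma relabel_neutral: "(\<And>x. x \<in> set w \<Longrightarrow> s x = None) \<Longrightarrow> relabel cyclic s t L w R = w"
  by (rule relabel_ident) auto

lemma reflect_neutral_ends:
  assumes "\<And>x. x \<in> set u \<Longrightarrow> s x = None" "\<And>x. x \<in> set v \<Longrightarrow> s x = None"
  shows "reflect s t (u @ w @ v) = u @ reflect s t w @ v"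
proof -
  have "excess s u = (0, 0)" "excess s v = (0, 0)"
    using assms by (auto intro: excess_neutral)
  moreover have "relabel cyclic s t L u R = u" "relabel cyclic s t L v R = v" for L R
    using assms by (auto intro: relabel_neutral)
  ultimately show ?thesis
    by (simp add: reflect_def relabel_append excess_append)
qed

lemma lower_replicate:
  assumes "s x = Some Minus"
  shows "j \<le> fst R \<Longrightarrow> relabel (lower_last j) s t L (replicate n x) R = replicate n x"
    and "snd L = 0 \<Longrightarrow> n + fst R \<le> j \<Longrightarrow> relabel (lower_last j) s t L (replicate n x) R = replicate n (t x)"
  using assms by (induction n arbitrary: L) (auto simp: lower_last.simps excess_replicate meld_def)

lemma raise_replicate:
  assumes "s x = Some Plus"
  shows "j \<le> snd L \<Longrightarrow> relabel (raise_first j) s t L (replicate n x) R = replicate n x"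
    and "fst R = 0 \<Longrightarrow> snd L + n \<le> j \<Longrightarrow> relabel (raise_first j) s t L (replicate n x) R = replicate n (t x)"
  using assms by (induction n arbitrary: L) (auto simp: raise_first.simps excess_replicate meld_def)

lemma lower_replicate_Plus:
  "s x = Some Plus \<Longrightarrow> relabel (lower_last j) s t L (replicate n x) R = replicate n x"
  by (induction n arbitrary: L) (auto simp: lower_last.simps)

lemma raise_replicate_Minus:
  "s x = Some Minus \<Longrightarrow> relabel (raise_first j) s t L (replicate n x) R = replicate n x"
  by (induction n arbitrary: L) (auto simp: raise_first.simps)

text \<open>
  On a sorted word the reflection exchanges the multiplicities of \<open>i\<close> and \<open>i + 1\<close>.
\<close>

lemma reflect_A_block:
  "reflect_A i (replicate p i @ replicate q (Suc i)) = replicate q i @ replicate p (Suc i)"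
proof (cases "q \<le> p")
  case True
  then obtain d where p: "p = q + d" using le_Suc_ex by blast
  have "excess (step_sign i) (replicate p i @ replicate q (Suc i)) = (p, q)"
    by (simp add: excess_append excess_replicate meld_def)
  from reflect_eq_lower[OF this True] show ?thesis
    by (simp add: p replicate_add relabel_append excess_append excess_replicate meld_def
        lower_replicate lower_replicate_Plus)
      (simp add: replicate_add[symmetric] add.commute)
next
  case False
  then obtain d where q: "q = p + d" using le_Suc_ex nat_le_linear by metis
  have "excess (step_sign i) (replicate p i @ replicate q (Suc i)) = (p, q)"
    by (simp add: excess_append excess_replicate meld_def)
  moreover have "p \<le> q" using q by simp
  moreover have q': "q = d + p" using q by simp
  ultimately show ?thesis
    by (simp add: reflect_eq_raise)
      (simp add: q' replicate_add relabel_append excess_append excess_replicate meld_def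
        raise_replicate raise_replicate_Minus,
       simp add: replicate_add[symmetric] add.commute)
qed

lemma reflect_A_sorted:
  assumes "sorted w"
  shows "sorted (reflect_A i w) \<and> mset (reflect_A i w) = image_mset (step_flip i) (mset w)"
proof -
  let ?lo = "filter (\<lambda>x. x < i) w" and ?hi = "filter (\<lambda>x. Suc i < x) w"
  let ?p = "count_list w i" and ?q = "count_list w (Suc i)"
  let ?M = "replicate ?p i @ replicate ?q (Suc i)" and ?M' = "replicate ?q i @ replicate ?p (Suc i)"
  have lo: "step_sign i x = None" "step_flip i x = x" if "x \<in> set ?lo" for x
    using that by (auto simp: step_sign_def step_flip_def)
  have hi: "step_sign i x = None" "step_flip i x = x" if "x \<in> set ?hi" for x
    using that by (auto simp: step_sign_def step_flip_def)
  have w: "w = ?lo @ ?M @ ?hi"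
    using sorted_split[OF assms, of i] by simp
  have "reflect_A i (?lo @ ?M @ ?hi) = ?lo @ reflect_A i ?M @ ?hi"
    by (rule reflect_neutral_ends) (use lo(1) hi(1) in blast)+
  then have r: "reflect_A i w = ?lo @ ?M' @ ?hi"
    unfolding reflect_A_block using w by simp
  have "image_mset (step_flip i) (mset ?lo) = mset ?lo" "image_mset (step_flip i) (mset ?hi) = mset ?hi"
    using lo(2) hi(2) by (auto intro!: image_mset_cong[where g = "\<lambda>x. x", simplified])
  then have "image_mset (step_flip i) (mset (?lo @ ?M @ ?hi)) = mset (?lo @ ?M' @ ?hi)"
    by (simp add: ac_simps)
  from this[folded w] have "mset (?lo @ ?M' @ ?hi) = image_mset (step_flip i) (mset w)" ..
  moreover have "sorted (?lo @ ?M' @ ?hi)"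
    using assms by (auto simp: sorted_append sorted_filter[where f = "\<lambda>x. x", simplified])
  ultimately show ?thesis
    unfolding r by blast
qed

lemma foldr_reflect_A_sorted:
  assumes "sorted w"
  shows "sorted (foldr reflect_A js w) \<and>
    mset (foldr reflect_A js w) = image_mset (foldr step_flip js) (mset w)"
proof (induction js)
  case (Cons j js)
  then show ?case
    using reflect_A_sorted[of "foldr reflect_A js w" j] by (simp add: multiset.map_comp comp_def)
qed (use assms in simp)

text \<open>
  The property of being fixed by a composition of reflections is invariant under rotations and Knuth
  transformations, because the composition commutes with them, and a sorted word is determined by
  its multiset of letters.
\<close>

theorem foldr_reflect_A_eq_self:
  assumes "\<And>x. foldr step_flip js x = x"
  shows "foldr reflect_A js w = w"
proof (induction w rule: knuth_rotate_induct)
  case (1 u a b c v)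
  obtain x y z where k: "knuth a b c = [x, y, z]"
    by (cases rule: knuth_cases[of b a c]) blast+
  show ?case
    using foldr_reflect_A_knuth[of js u x y z v] 1 unfolding k knuth_knuth[OF k]
    by (auto simp: knuth_knuth[OF k])
next
  case (2 u v)
  then show ?case
    using foldr_reflect_A_rotate[of js u v] by auto
next
  case (3 w)
  have "foldr step_flip js = (\<lambda>x. x)"
    using assms by auto
  with foldr_reflect_A_sorted[OF 3, of js] have
    "sorted (foldr reflect_A js w)" "mset (foldr reflect_A js w) = mset w"
    by simp_all
  then show ?case
    using 3 by (metis properties_for_sort)
qed

section \<open>Embedding type C words into type A words\<close>

text \<open>
  The reading word of the column with all the entries \<open>1, \<dots>, 2m\<close> except \<open>y\<close>. As an element of a type A
  crystal it behaves like a letter dual to \<open>y\<close> (\<open>punctured_column_reflection\<close>), with signs given by \<open>dual_sign\<close>.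
\<close>

definition punctured_column :: "nat \<Rightarrow> nat \<Rightarrow> nat list" where
  "punctured_column m y = filter (\<lambda>z. z \<noteq> y) (rev [1..<Suc (2 * m)])"

lemma upt_split:
  assumes "1 \<le> k" "k < 2 * m"
  shows "rev [1..<Suc (2 * m)] = rev [Suc (Suc k)..<Suc (2 * m)] @ [Suc k, k] @ rev [1..<k]"
proof -
  have "[1..<Suc (2 * m)] = [1..<k] @ [k..<Suc (2 * m)]"
    using upt_add_eq_append[of 1 k "Suc (2 * m) - k"] assms by simp
  also have "[k..<Suc (2 * m)] = k # Suc k # [Suc (Suc k)..<Suc (2 * m)]"
    using assms by (simp add: upt_conv_Cons)
  finally show ?thesis by simp
qed

lemma punctured_column_split:
  assumes "1 \<le> k" "k < 2 * m"
  obtains u v where "\<forall>x \<in> set u \<union> set v. step_sign k x = None"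
    "punctured_column m k = u @ [Suc k] @ v" "punctured_column m (Suc k) = u @ [k] @ v"
proof -
  have "filter (\<lambda>z. z \<noteq> y) (rev [Suc (Suc k)..<Suc (2 * m)]) = rev [Suc (Suc k)..<Suc (2 * m)]"
    "filter (\<lambda>z. z \<noteq> y) (rev [1..<k]) = rev [1..<k]" if "y = k \<or> y = Suc k" for y
    using that by (auto simp: filter_id_conv)
  then have "punctured_column m y = rev [Suc (Suc k)..<Suc (2 * m)] @ filter (\<lambda>z. z \<noteq> y) [Suc k, k] @ rev [1..<k]"
    if "y = k \<or> y = Suc k" for y
    using that unfolding punctured_column_def upt_split[OF assms] filter_append by metis
  moreover have "step_sign k x = None" if "x \<in> set (rev [Suc (Suc k)..<Suc (2 * m)]) \<union> set (rev [1..<k])" for x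
    using that by (auto simp: step_sign_None simp del: upt_Suc)
  ultimately show thesis
    using that[of "rev [Suc (Suc k)..<Suc (2 * m)]" "rev [1..<k]"] by simp
qed

definition dual_sign :: "nat \<Rightarrow> nat \<Rightarrow> sign option" where
  "dual_sign k y = map_option opposite (step_sign k y)"

lemma relabel_A_neutral_ends:
  assumes "\<And>x. x \<in> set u \<union> set v \<Longrightarrow> step_sign k x = None"
  shows "relabel_A k L (u @ w @ v) R = u @ relabel_A k L w R @ v"
    and "excess (step_sign k) (u @ w @ v) = excess (step_sign k) w"
proof -
  have 1: "excess (step_sign k) u = (0, 0)" "excess (step_sign k) v = (0, 0)"
    using assms by (auto intro: excess_neutral)
  have "relabel_A k L u R = u" "relabel_A k L v R = v" for L R
    using assms by (auto intro: relabel_neutral)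
  with 1 show "relabel_A k L (u @ w @ v) R = u @ relabel_A k L w R @ v"
    by (simp add: relabel_append)
  from 1 show "excess (step_sign k) (u @ w @ v) = excess (step_sign k) w"
    by (simp add: excess_append)
qed

lemma punctured_column_reflection:
  assumes "1 \<le> k" "k < 2 * m"
  shows "relabel_A k L (punctured_column m y) R =
      punctured_column m (if cyclic (dual_sign k y) L R then step_flip k y else y)" (is ?A)
    and "excess (step_sign k) (punctured_column m y) = sign_excess (dual_sign k y)" (is ?B)
proof -
  have "?A \<and> ?B"
  proof (cases "y = k \<or> y = Suc k")
    case True
    obtain u v where uv: "\<forall>x \<in> set u \<union> set v. step_sign k x = None"
      "punctured_column m k = u @ [Suc k] @ v" "punctured_column m (Suc k) = u @ [k] @ v"
      by (rule punctured_column_split[OF assms])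
    note ends = relabel_A_neutral_ends[OF uv(1)[rule_format]]
    show ?thesis
      using True uv(2,3) ends(1)[where L = L and w = "[Suc k]" and R = R] ends(1)[where L = L and w = "[k]" and R = R] ends(2)[where w = "[Suc k]"] ends(2)[where w = "[k]"]
      by (auto simp: dual_sign_def)
  next
    case False
    have "\<forall>x \<in> set (filter (\<lambda>z. z \<noteq> y) (rev [Suc (Suc k)..<Suc (2 * m)])) \<union>
        set (filter (\<lambda>z. z \<noteq> y) (rev [1..<k])). step_sign k x = None"
      by (auto simp: step_sign_None simp del: upt_Suc)
    moreover have "punctured_column m y = filter (\<lambda>z. z \<noteq> y) (rev [Suc (Suc k)..<Suc (2 * m)]) @ [Suc k, k] @
        filter (\<lambda>z. z \<noteq> y) (rev [1..<k])"
      using False unfolding punctured_column_def upt_split[OF assms] filter_append by simp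
    ultimately obtain u v where n: "\<forall>x \<in> set u \<union> set v. step_sign k x = None"
      and c: "punctured_column m y = u @ [Suc k, k] @ v"
      by blast
    note ends = relabel_A_neutral_ends[OF n[rule_format]]
    have pair: "relabel_A k L [Suc k, k] R = [Suc k, k]" "excess (step_sign k) [Suc k, k] = (0, 0)"
      by (simp_all add: meld_def)
    have "dual_sign k y = None"
      using False by (simp add: dual_sign_def step_sign_None)
    then have "(if cyclic (dual_sign k y) L R then step_flip k y else y) = y"
      "sign_excess (dual_sign k y) = (0, 0)"
      by simp_all
    then show ?thesis
      unfolding c[symmetric] by (simp only: c ends pair simp_thms)
  qed
  then show ?A ?B by blast+
qed

text \<open>
  The position of a letter in the ordered alphabet of rank \<open>m\<close>.
\<close>

fun letter_index :: "nat \<Rightarrow> letter \<Rightarrow> nat" where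
  "letter_index m (Plain j) = j"
| "letter_index m (Barred j) = 2 * m + 1 - j"

text \<open>
  A letter with index \<open>e\<close> is embedded as \<open>doubled m e e\<close>, the letter \<open>e\<close> followed by the column that omits the
  complementary letter \<open>2m + 1 - e\<close>. The two parts are kept separate because the type A reflection with
  index \<open>i\<close> changes only one of them, and the one with index \<open>2m - i\<close> the other.
\<close>

definition doubled :: "nat \<Rightarrow> nat \<Rightarrow> nat \<Rightarrow> nat list" where
  "doubled m e e' = e # punctured_column m (2 * m + 1 - e')"

lemma step_sign_complement:
  assumes "1 \<le> k" "k < 2 * m" "1 \<le> e" "e \<le> 2 * m"
  shows "dual_sign k (2 * m + 1 - e) = step_sign (2 * m - k) e"
    and "step_flip k (2 * m + 1 - e) = 2 * m + 1 - step_flip (2 * m - k) e"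
proof -
  have e: "2 * m + 1 - e = k \<longleftrightarrow> e = Suc (2 * m - k)" "2 * m + 1 - e = Suc k \<longleftrightarrow> e = 2 * m - k"
    using assms by arith+
  show "dual_sign k (2 * m + 1 - e) = step_sign (2 * m - k) e"
    unfolding dual_sign_def step_sign_def e by simp
  have "2 * m + 1 - (2 * m - k) = Suc k" "2 * m + 1 - Suc (2 * m - k) = k"
    using assms by arith+
  then show "step_flip k (2 * m + 1 - e) = 2 * m + 1 - step_flip (2 * m - k) e"
    unfolding step_flip_def e by (simp only: if_distrib[where f = "\<lambda>x. 2 * m + 1 - x"]) simp
qed

lemma doubled_reflection:
  assumes "1 \<le> k" "k < 2 * m" "1 \<le> e'" "e' \<le> 2 * m"
  shows "relabel_A k L (doubled m e e') R =
      doubled m (if cyclic (step_sign k e) L (sign_excess (step_sign (2 * m - k) e') \<bullet> R) then step_flip k e else e)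
        (if cyclic (step_sign (2 * m - k) e') (L \<bullet> sign_excess (step_sign k e)) R
          then step_flip (2 * m - k) e' else e')"
    and "excess (step_sign k) (doubled m e e') =
      sign_excess (step_sign k e) \<bullet> sign_excess (step_sign (2 * m - k) e')"
  unfolding doubled_def relabel.simps excess.simps punctured_column_reflection[OF assms(1,2)]
    step_sign_complement[OF assms]
  by auto

abbreviation embed_letter :: "nat \<Rightarrow> letter \<Rightarrow> nat list" where
  "embed_letter m x \<equiv> doubled m (letter_index m x) (letter_index m x)"

definition virtual_word :: "nat \<Rightarrow> letter list \<Rightarrow> nat list" where
  "virtual_word m w = concat (map (embed_letter m) w)"

lemma virtual_word_simps [simp]:
  "virtual_word m [] = []"
  "virtual_word m (x # w) = embed_letter m x @ virtual_word m w"
  by (simp_all add: virtual_word_def)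

lemma letter_index_bounds: "x \<in> alphabet m \<Longrightarrow> 1 \<le> letter_index m x \<and> letter_index m x \<le> 2 * m"
  by (auto simp: alphabet_def)

lemma letter_index_inj:
  assumes "x \<in> alphabet m" "y \<in> alphabet m" "letter_index m x = letter_index m y"
  shows "x = y"
  using assms by (auto simp: alphabet_def)

lemma length_doubled: "1 \<le> e \<Longrightarrow> e \<le> 2 * m \<Longrightarrow> length (doubled m d e) = 2 * m"
proof -
  assume "1 \<le> e" "e \<le> 2 * m"
  have "distinct (punctured_column m (2 * m + 1 - e))"
    unfolding punctured_column_def by (intro distinct_filter) simp
  from distinct_card[OF this] have "length (punctured_column m (2 * m + 1 - e)) = card (set (punctured_column m (2 * m + 1 - e)))" ..
  also have "set (punctured_column m (2 * m + 1 - e)) = {1..2 * m} - {2 * m + 1 - e}"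
    by (auto simp: punctured_column_def simp del: upt_Suc)
  also have "card \<dots> = 2 * m - 1"
    using \<open>1 \<le> e\<close> \<open>e \<le> 2 * m\<close> by (subst card_Diff_singleton) auto
  finally show ?thesis
    using \<open>1 \<le> e\<close> \<open>e \<le> 2 * m\<close> by (simp add: doubled_def)
qed

lemma virtual_word_inj:
  assumes "set w \<subseteq> alphabet m" "set w' \<subseteq> alphabet m" "virtual_word m w = virtual_word m w'" "m > 0"
  shows "w = w'"
  using assms
proof (induction w arbitrary: w')
  case Nil
  then show ?case
    by (cases w') (auto simp: doubled_def)
next
  case (Cons x w)
  then obtain y v where w': "w' = y # v"
    by (cases w') (auto simp: doubled_def)
  have "embed_letter m x = embed_letter m y \<and>
      virtual_word m w = virtual_word m v"
    using Cons.prems letter_index_bounds[of x m] letter_index_bounds[of y m]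
    by (intro append_eq_append_conv[THEN iffD1]) (auto simp: w' length_doubled)
  then show ?case
    using Cons.IH[of v] Cons.prems letter_index_inj[of x m y] by (auto simp: w' doubled_def)
qed

lemma excess_relabel_disjoint:
  assumes "\<And>x. s (t x) = s x"
  shows "excess s (relabel P s' t L w R) = excess s w"
  by (induction w arbitrary: L) (auto simp: assms)

lemma sign_of_eq_step_sign:
  assumes "1 \<le> i" "i < m" "x \<in> alphabet m"
  shows "sign_of m i x = (case step_sign i (letter_index m x) of Some g \<Rightarrow> Some g
      | None \<Rightarrow> step_sign (2 * m - i) (letter_index m x))"
    and "letter_index m (flip_letter m i x) = step_flip (2 * m - i) (step_flip i (letter_index m x))"
proof -
  consider j where "x = Plain j" "1 \<le> j" "j \<le> m" | j where "x = Barred j" "1 \<le> j" "j \<le> m"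
    using assms(3) by (auto simp: alphabet_def)
  then have "sign_of m i x = (case step_sign i (letter_index m x) of Some g \<Rightarrow> Some g
      | None \<Rightarrow> step_sign (2 * m - i) (letter_index m x)) \<and>
    letter_index m (flip_letter m i x) = step_flip (2 * m - i) (step_flip i (letter_index m x))"
  proof cases
    case 1
    then have "step_sign (2 * m - i) j = None" "step_flip (2 * m - i) (step_flip i j) = step_flip i j"
      using assms by (auto simp: step_sign_None step_flip_def)
    then show ?thesis
      using 1 assms(2) by (auto simp: sign_of_def step_sign_def flip_letter_def step_flip_def)
  next
    case 2
    have e: "2 * m + 1 - j \<noteq> i" "2 * m + 1 - j \<noteq> Suc i"
      "2 * m + 1 - j = 2 * m - i \<longleftrightarrow> j = i + 1" "2 * m + 1 - j = Suc (2 * m - i) \<longleftrightarrow> j = i"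
      using 2 assms by arith+
    then have "step_sign i (2 * m + 1 - j) = None" "step_flip i (2 * m + 1 - j) = 2 * m + 1 - j"
      by (simp_all add: step_sign_None step_flip_def)
    moreover have "sign_of m i x = step_sign (2 * m - i) (2 * m + 1 - j)"
      using 2 assms(2) unfolding step_sign_def e by (simp add: sign_of_def)
    moreover have "letter_index m (flip_letter m i x) = step_flip (2 * m - i) (2 * m + 1 - j)"
      using 2 assms(1,2) unfolding step_flip_def e by (auto simp: flip_letter_def)
    ultimately show ?thesis
      unfolding 2(1) letter_index.simps by simp
  qed
  then show "sign_of m i x = (case step_sign i (letter_index m x) of Some g \<Rightarrow> Some g
      | None \<Rightarrow> step_sign (2 * m - i) (letter_index m x))"
    and "letter_index m (flip_letter m i x) = step_flip (2 * m - i) (step_flip i (letter_index m x))"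
    by blast+
qed

lemma step_sign_disjoint:
  assumes "Suc i < j"
  shows "step_sign i e = None \<or> step_sign j e = None"
    and "step_sign i e \<noteq> None \<Longrightarrow> step_flip j (step_flip i e) = step_flip i e"
    and "step_sign j e \<noteq> None \<Longrightarrow> step_flip j (step_flip i e) = step_flip j e"
    and "step_sign j (step_flip i e) = step_sign j e"
    and "step_sign i (step_flip j e) = step_sign i e"
  using assms by (auto simp: step_sign_def step_flip_def)

text \<open>
  For \<open>i < m\<close> the two type A reflections see the same unmatched signs as the type C reflection, and
  together change both parts of an embedded letter.
\<close>

lemma relabel_doubled_letter:
  assumes "1 \<le> i" "i < m" "x \<in> alphabet m"
  shows "relabel_A (2 * m - i) L (relabel_A i L (embed_letter m x) R) R =
     (let y = (if cyclic (sign_of m i x) L R then flip_letter m i x else x)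
      in embed_letter m y)" (is ?A)
    and "excess (step_sign i) (embed_letter m x) = sign_excess (sign_of m i x)" (is ?B)
    and "excess (step_sign (2 * m - i)) (embed_letter m x) =
      sign_excess (sign_of m i x)" (is ?C)
proof -
  let ?e = "letter_index m x" and ?j = "2 * m - i"
  have e: "1 \<le> ?e" "?e \<le> 2 * m"
    using letter_index_bounds[OF assms(3)] by auto
  have i: "1 \<le> i" "i < 2 * m" "1 \<le> ?j" "?j < 2 * m" "2 * m - ?j = i"
    using assms by auto
  note d = doubled_reflection[OF i(1,2)] doubled_reflection[OF i(3,4), unfolded i(5)]
  have ij: "Suc i < ?j"
    using assms(2) by linarith
  note s = sign_of_eq_step_sign[OF assms] step_sign_disjoint[OF ij, of ?e]
  have b: "1 \<le> step_flip ?j ?e" "step_flip ?j ?e \<le> 2 * m"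
    using e assms by (auto simp: step_flip_def)
  consider "step_sign i ?e \<noteq> None" "step_sign ?j ?e = None" | "step_sign i ?e = None" "step_sign ?j ?e \<noteq> None"
    | "step_sign i ?e = None" "step_sign ?j ?e = None"
    using s(3) by fast
  then have "?A \<and> ?B \<and> ?C"
    by cases (use e b s in \<open>auto simp: d Let_def\<close>)
  then show ?A ?B ?C by blast+
qed

lemma virtual_reflection:
  assumes "1 \<le> i" "i < m" "set w \<subseteq> alphabet m"
  shows "relabel_A (2 * m - i) L (relabel_A i L (virtual_word m w) R) R =
      virtual_word m (relabel cyclic (sign_of m i) (flip_letter m i) L w R)"
    and "excess (step_sign i) (virtual_word m w) = excess (sign_of m i) w"
    and "excess (step_sign (2 * m - i)) (virtual_word m w) = excess (sign_of m i) w"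
  using assms(3)
proof (induction w arbitrary: L)
  case (Cons x w)
  let ?j = "2 * m - i"
  case 1
  have x: "x \<in> alphabet m" "set w \<subseteq> alphabet m" using 1 by auto
  note d = relabel_doubled_letter[OF assms(1,2) x(1)]
  have "excess (step_sign ?j) (relabel_A i L v R) = excess (step_sign ?j) v" for L v R
    by (rule excess_relabel_disjoint, rule step_sign_disjoint(4)) (use assms(2) in linarith)
  then show ?case
    using Cons.IH(1)[of "L \<bullet> sign_excess (sign_of m i x)"] Cons.IH(2,3) x
    by (simp add: relabel_append d Let_def)
next
  case (Cons x w)
  case 2
  then show ?case
    using Cons.IH(2) relabel_doubled_letter[OF assms(1,2), of x] by (simp add: excess_append)
next
  case (Cons x w)
  case 3
  then show ?case
    using Cons.IH(3) relabel_doubled_letter[OF assms(1,2), of x] by (simp add: excess_append)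
qed simp_all

text \<open>
  For \<open>i = m\<close> every sign occurs twice in an embedded letter, and doubling is a homomorphism.
\<close>

definition twice :: "unmatched \<Rightarrow> unmatched" where
  "twice L = (2 * fst L, 2 * snd L)"

lemma twice_meld: "twice (L \<bullet> R) = twice L \<bullet> twice R"
  by (simp add: twice_def meld_def diff_mult_distrib2)

lemma sign_of_top:
  assumes "x \<in> alphabet m"
  shows "sign_of m m x = step_sign m (letter_index m x)"
    and "letter_index m (flip_letter m m x) = step_flip m (letter_index m x)"
  using assms by (auto simp: alphabet_def sign_of_def step_sign_def flip_letter_def step_flip_def)

lemma relabel_doubled_letter_top:
  assumes "m > 0" "x \<in> alphabet m"
  shows "relabel_A m (twice L) (embed_letter m x) (twice R) =
     (let y = (if cyclic (sign_of m m x) L R then flip_letter m m x else x)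
      in embed_letter m y)"
    and "excess (step_sign m) (embed_letter m x) =
      twice (sign_excess (sign_of m m x))"
proof -
  let ?e = "letter_index m x"
  have e: "1 \<le> ?e" "?e \<le> 2 * m"
    using letter_index_bounds[OF assms(2)] by auto
  have m: "1 \<le> m" "m < 2 * m" "2 * m - m = m"
    using assms by auto
  note d = doubled_reflection[OF m(1,2) e, unfolded m(3)]
  show "excess (step_sign m) (embed_letter m x) = twice (sign_excess (sign_of m m x))"
    unfolding d sign_of_top[OF assms(2)]
    by (cases "step_sign m ?e" rule: sign_excess.cases) (auto simp: twice_def meld_def)
  show "relabel_A m (twice L) (embed_letter m x) (twice R) =
     (let y = (if cyclic (sign_of m m x) L R then flip_letter m m x else x)
      in embed_letter m y)"
    unfolding d sign_of_top(1)[OF assms(2)]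
    by (cases "step_sign m ?e" rule: sign_excess.cases)
      (auto simp: twice_def meld_def Let_def sign_of_top(2)[OF assms(2)])
qed

lemma virtual_reflection_top:
  assumes "m > 0" "set w \<subseteq> alphabet m"
  shows "relabel_A m (twice L) (virtual_word m w) (twice R) =
      virtual_word m (relabel cyclic (sign_of m m) (flip_letter m m) L w R)"
    and "excess (step_sign m) (virtual_word m w) = twice (excess (sign_of m m) w)"
  using assms(2)
proof (induction w arbitrary: L)
  case (Cons x w)
  case 1
  have x: "x \<in> alphabet m" "set w \<subseteq> alphabet m" using 1 by auto
  note d = relabel_doubled_letter_top[OF assms(1) x(1)]
  show ?case
    using Cons.IH(1)[of "L \<bullet> sign_excess (sign_of m m x)"] Cons.IH(2) x
    by (simp add: relabel_append d Let_def twice_meld[symmetric])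
next
  case (Cons x w)
  case 2
  then show ?case
    using Cons.IH(2) relabel_doubled_letter_top[OF assms(1), of x] by (simp add: excess_append twice_meld)
qed (simp_all add: twice_def)

section \<open>The order of the Coxeter element on words\<close>

text \<open>
  Indices of the type A reflections that correspond to \<open>\<sigma>\<^sub>k \<dots> \<sigma>\<^sub>m\<close>. Applied with \<open>foldr\<close>, the last one acts
  first.
\<close>

definition coxeter_word :: "nat \<Rightarrow> nat \<Rightarrow> nat list" where
  "coxeter_word m k = concat (map (\<lambda>i. if i < m then [2 * m - i, i] else [m]) [k..<Suc m])"

lemma foldr_step_flip_coxeter_word:
  assumes "1 \<le> k" "k \<le> m"
  shows "foldr step_flip (coxeter_word m k) x =
     (if k \<le> x \<and> x < m then x + 1 else if x = m then 2 * m + 1 - k else if x = m + 1 then k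
      else if m + 1 < x \<and> x \<le> 2 * m + 1 - k then x - 1 else x)"
  using assms(2,1)
proof (induction k rule: inc_induct)
  case base
  then show ?case
    by (simp add: coxeter_word_def step_flip_def)
next
  case (step k)
  have "coxeter_word m k = [2 * m - k, k] @ coxeter_word m (Suc k)"
    using step.hyps by (simp add: coxeter_word_def upt_conv_Cons del: upt_Suc)
  then have "foldr step_flip (coxeter_word m k) x =
      step_flip (2 * m - k) (step_flip k (foldr step_flip (coxeter_word m (Suc k)) x))"
    by simp
  also have "foldr step_flip (coxeter_word m (Suc k)) x =
     (if Suc k \<le> x \<and> x < m then x + 1 else if x = m then 2 * m + 1 - Suc k else if x = m + 1 then Suc k
      else if m + 1 < x \<and> x \<le> 2 * m + 1 - Suc k then x - 1 else x)"
    by (rule step.IH) simp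
  also have "step_flip (2 * m - k) (step_flip k \<dots>) =
    (if k \<le> x \<and> x < m then x + 1 else if x = m then 2 * m + 1 - k else if x = m + 1 then k
      else if m + 1 < x \<and> x \<le> 2 * m + 1 - k then x - 1 else x)"
  proof -
    obtain d where m: "m = k + Suc d"
      using step.hyps less_imp_Suc_add by auto
    have e: "2 * m - k = k + 2 * d + 2" "2 * m + 1 - k = k + 2 * d + 3" "2 * m + 1 - Suc k = k + 2 * d + 2"
      by (simp_all add: m)
    consider "x < k" | "x = k" | "k < x" "x < m" | "x = m" | "x = m + 1"
      | "m + 1 < x" "x \<le> k + 2 * d + 2" | "x = k + 2 * d + 3" | "k + 2 * d + 3 < x"
      using m by linarith
    then show ?thesis
      unfolding e by cases (simp_all add: m step_flip_def, linarith?)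
  qed
  finally show ?case .
qed

text \<open>
  The points \<open>1, 2, \<dots>, m, 2m, 2m - 1, \<dots>, m + 1\<close> of the cycle by which the Coxeter element permutes the
  letters.
\<close>

definition cycle_point :: "nat \<Rightarrow> nat \<Rightarrow> nat" where
  "cycle_point m t = (if t < m then t + 1 else 3 * m - t)"

lemma coxeter_step:
  assumes "m > 0" "t < 2 * m"
  shows "foldr step_flip (coxeter_word m 1) (cycle_point m t) = cycle_point m (Suc t mod (2 * m))"
proof -
  have 1: "foldr step_flip (coxeter_word m 1) x =
     (if 1 \<le> x \<and> x < m then x + 1 else if x = m then 2 * m else if x = m + 1 then 1
      else if m + 1 < x \<and> x \<le> 2 * m then x - 1 else x)" for x
    using foldr_step_flip_coxeter_word[of 1 m x] assms by simp
  show ?thesis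
  proof (cases "Suc t = 2 * m")
    case True
    then show ?thesis
      unfolding 1 cycle_point_def using assms by auto
  next
    case False
    then have "Suc t mod (2 * m) = Suc t"
      using assms by simp
    then show ?thesis
      unfolding 1 cycle_point_def using assms False by auto
  qed
qed

lemma coxeter_power_cycle_point:
  assumes "m > 0" "t < 2 * m"
  shows "(foldr step_flip (coxeter_word m 1) ^^ n) (cycle_point m t) = cycle_point m ((t + n) mod (2 * m))"
proof (induction n)
  case (Suc n)
  have "(t + n) mod (2 * m) < 2 * m"
    using assms by simp
  from coxeter_step[OF assms(1) this] Suc show ?case
    by (simp add: mod_Suc_eq)
qed (use assms in simp)

lemma foldr_concat_replicate: "foldr f (concat (replicate n xs)) y = (foldr f xs ^^ n) y"
  by (induction n) simp_all

lemma coxeter_power: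
  assumes "m > 0"
  shows "foldr step_flip (concat (replicate (2 * m) (coxeter_word m 1))) x = x"
proof -
  consider "1 \<le> x" "x \<le> m" | "m < x" "x \<le> 2 * m" | "x = 0 \<or> 2 * m < x" by linarith
  then show ?thesis
  proof cases
    case 1
    then have "x = cycle_point m (x - 1)" "x - 1 < 2 * m"
      by (auto simp: cycle_point_def)
    then show ?thesis
      using coxeter_power_cycle_point[OF assms, of "x - 1" "2 * m"] by (simp add: foldr_concat_replicate)
  next
    case 2
    then have "x = cycle_point m (3 * m - x)" "3 * m - x < 2 * m"
      by (auto simp: cycle_point_def)
    then show ?thesis
      using coxeter_power_cycle_point[OF assms, of "3 * m - x" "2 * m"] by (simp add: foldr_concat_replicate)
  next
    case 3
    then have "foldr step_flip (coxeter_word m 1) x = x"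
      using foldr_step_flip_coxeter_word[of 1 m x] assms by auto
    then have "(foldr step_flip (coxeter_word m 1) ^^ n) x = x" for n
      by (induction n) simp_all
    then show ?thesis
      by (simp add: foldr_concat_replicate)
  qed
qed

text \<open>
  The action of \<open>\<sigma>\<^sub>1 \<dots> \<sigma>\<^sub>m\<close> on words.
\<close>

definition coxeter_reflect :: "nat \<Rightarrow> letter list \<Rightarrow> letter list" where
  "coxeter_reflect m = foldr (reflect_word m) [1..<Suc m]"

lemma set_relabel: "set (relabel P s t L w R) \<subseteq> set w \<union> t ` set w"
proof (induction w arbitrary: L)
  case (Cons x w)
  show ?case
    using Cons.IH[of "L \<bullet> sign_excess (s x)"] by auto
qed simp

lemma flip_letter_alphabet: "i \<in> {1..m} \<Longrightarrow> x \<in> alphabet m \<Longrightarrow> flip_letter m i x \<in> alphabet m"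
  by (auto simp: alphabet_def flip_letter_def)

lemma reflect_word_alphabet:
  assumes "i \<in> {1..m}" "set w \<subseteq> alphabet m"
  shows "set (reflect_word m i w) \<subseteq> alphabet m"
  using set_relabel[of cyclic "sign_of m i" "flip_letter m i" "(0, 0)" w "(0, 0)"]
    flip_letter_alphabet[OF assms(1)] assms(2) unfolding reflect_def by blast

lemma foldr_reflect_A_virtual:
  assumes "set is \<subseteq> {1..m}" "set w \<subseteq> alphabet m"
  shows "foldr reflect_A (concat (map (\<lambda>i. if i < m then [2 * m - i, i] else [m]) is)) (virtual_word m w) =
      virtual_word m (foldr (reflect_word m) is w) \<and>
    set (foldr (reflect_word m) is w) \<subseteq> alphabet m"
  using assms(1)
proof (induction "is")
  case (Cons i "is")
  let ?v = "foldr (reflect_word m) is w"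
  have v: "set ?v \<subseteq> alphabet m" and i: "1 \<le> i" "i \<le> m"
    using Cons by auto
  have "foldr reflect_A (if i < m then [2 * m - i, i] else [m]) (virtual_word m ?v) =
      virtual_word m (reflect_word m i ?v)"
  proof (cases "i < m")
    case True
    then show ?thesis
      using virtual_reflection(1)[OF i(1) True v, of "(0, 0)" "(0, 0)"] by (simp add: reflect_def)
  next
    case False
    then have "i = m" "m > 0" using i by auto
    then show ?thesis
      using virtual_reflection_top(1)[OF _ v, of "(0, 0)" "(0, 0)"] by (simp add: reflect_def twice_def)
  qed
  moreover have "set (reflect_word m i ?v) \<subseteq> alphabet m"
    using reflect_word_alphabet[OF _ v] i by simp
  ultimately show ?case
    using Cons by simp
qed (use assms in simp)

lemma coxeter_reflect_power_virtual:
  assumes "set w \<subseteq> alphabet m"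
  shows "(foldr reflect_A (coxeter_word m 1) ^^ n) (virtual_word m w) =
      virtual_word m ((coxeter_reflect m ^^ n) w) \<and> set ((coxeter_reflect m ^^ n) w) \<subseteq> alphabet m"
proof (induction n)
  case (Suc n)
  have "set [1..<Suc m] \<subseteq> {1..m}" by auto
  from foldr_reflect_A_virtual[OF this conjunct2[OF Suc.IH]] Suc.IH show ?case
    unfolding coxeter_word_def[symmetric] coxeter_reflect_def[symmetric] by simp
qed (use assms in simp)

theorem coxeter_reflect_order:
  assumes "m > 0" "set w \<subseteq> alphabet m"
  shows "(coxeter_reflect m ^^ (2 * m)) w = w"
proof -
  have "foldr reflect_A (concat (replicate (2 * m) (coxeter_word m 1))) (virtual_word m w) = virtual_word m w"
    by (rule foldr_reflect_A_eq_self) (rule coxeter_power[OF assms(1)])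
  then have "virtual_word m ((coxeter_reflect m ^^ (2 * m)) w) = virtual_word m w"
    using coxeter_reflect_power_virtual[OF assms(2), of "2 * m"] by (simp add: foldr_concat_replicate)
  then show ?thesis
    using virtual_word_inj coxeter_reflect_power_virtual[OF assms(2), of "2 * m"] assms by metis
qed

section \<open>Columns of a tableau\<close>

lemma down_closed_card:
  fixes S :: "nat set"
  assumes "finite S" "\<And>x y. x \<in> S \<Longrightarrow> y < x \<Longrightarrow> y \<in> S"
  shows "x \<in> S \<longleftrightarrow> x < card S"
proof -
  have "\<exists>k. S = {..<k}"
  proof (cases "S = {}")
    case False
    have "S = {..<Suc (Max S)}"
      using assms Max_in[OF assms(1) False] Max_ge[OF assms(1)]
      by (auto simp: less_Suc_eq_le) (metis le_neq_implies_less)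
    then show ?thesis by blast
  qed auto
  then show ?thesis by auto
qed

lemma cells_column_length:
  assumes "is_partition lam n"
  shows "(r, c) \<in> cells lam \<longleftrightarrow> r < column_length lam c"
proof -
  have "r' \<in> {r. (r, c) \<in> cells lam}" if "r \<in> {r. (r, c) \<in> cells lam}" "r' < r" for r r'
    using that assms sorted_wrt_nth_less[of "(\<ge>)" lam r' r] by (auto simp: cells_def is_partition_def)
  moreover have "finite {r. (r, c) \<in> cells lam}"
    by (rule finite_subset[of _ "{..<length lam}"]) (auto simp: cells_def)
  ultimately show ?thesis
    using down_closed_card[of "{r. (r, c) \<in> cells lam}" r] unfolding column_length_def by blast
qed

lemma num_columns_iff: "(0, c) \<in> cells lam \<longleftrightarrow> c < num_columns lam"
proof -
  have "finite {c. (0, c) \<in> cells lam}"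
    by (rule finite_subset[of _ "{..<lam ! 0}"]) (auto simp: cells_def)
  then show ?thesis
    using down_closed_card[of "{c. (0, c) \<in> cells lam}" c] unfolding num_columns_def
    by (auto simp: cells_def)
qed

lemma column_length_pos:
  assumes "is_partition lam n" "r < column_length lam c"
  shows "c < num_columns lam"
  using assms cells_column_length[OF assms(1), of 0 c] num_columns_iff[of c lam] by simp

lemma column_length_antimono:
  assumes "is_partition lam n" "c \<le> c'"
  shows "column_length lam c' \<le> column_length lam c"
proof (rule ccontr)
  assume "\<not> ?thesis"
  then have "(column_length lam c, c') \<in> cells lam"
    using cells_column_length[OF assms(1), of _ c'] by simp
  then have "(column_length lam c, c) \<in> cells lam"
    using assms(2) by (auto simp: cells_def)
  then show False
    using cells_column_length[OF assms(1), of _ c] by simp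
qed

definition column_cells :: "nat list \<Rightarrow> nat \<Rightarrow> (nat \<times> nat) list" where
  "column_cells lam c = map (\<lambda>r. (r, c)) (rev [0..<column_length lam c])"

lemma reading_order_columns: "reading_order lam = concat (map (column_cells lam) [0..<num_columns lam])"
  unfolding reading_order_def column_cells_def ..

lemma set_reading_order:
  assumes "is_partition lam n"
  shows "set (reading_order lam) = cells lam"
  using cells_column_length[OF assms] column_length_pos[OF assms]
  by (force simp: reading_order_columns column_cells_def)

lemma distinct_reading_order: "distinct (reading_order lam)"
proof -
  have "distinct (concat (map (column_cells lam) cs))" if "distinct cs" for cs
    using that
    by (induction cs) (auto simp: column_cells_def distinct_map inj_on_def)
  then show ?thesis
    by (simp add: reading_order_columns)
qed

lemma reading_word_inj:
  assumes "is_partition lam n" "T \<in> extensional (cells lam)" "T' \<in> extensional (cells lam)"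
    "reading_word lam T = reading_word lam T'"
  shows "T = T'"
proof (rule extensionalityI[OF assms(2,3)])
  fix x assume "x \<in> cells lam"
  then show "T x = T' x"
    using assms(4) set_reading_order[OF assms(1)] by (auto simp: reading_word_def)
qed

lemma filling_of_word_reading_word:
  assumes "is_partition lam n" "T \<in> extensional (cells lam)"
  shows "filling_of_word lam (reading_word lam T) = T"
  unfolding filling_of_word_def
  by (rule the_inv_into_f_f) (use assms reading_word_inj[OF assms(1)] in \<open>auto intro!: inj_onI\<close>)

lemma reading_word_update:
  assumes "reading_order lam = U @ x # V"
  shows "reading_word lam (T(x := y)) = map T U @ y # map T V"
proof -
  have "x \<notin> set U" "x \<notin> set V"
    using distinct_reading_order[of lam] assms by auto
  then show ?thesis
    by (auto simp: reading_word_def assms)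
qed

subsection \<open>Counting letters in a column\<close>

text \<open>
  A column is given by its length \<open>h\<close> and its entries \<open>g 0, \<dots>, g (h - 1)\<close> from top to bottom. The
  functions count the unbarred and the barred entries with index at most \<open>j\<close>.
\<close>

definition plain_count :: "nat \<Rightarrow> (nat \<Rightarrow> letter) \<Rightarrow> nat \<Rightarrow> nat" where
  "plain_count h g j = card {r. r < h \<and> g r \<le> Plain j}"

definition barred_count :: "nat \<Rightarrow> (nat \<Rightarrow> letter) \<Rightarrow> nat \<Rightarrow> nat" where
  "barred_count h g j = card {r. r < h \<and> Barred j \<le> g r}"

definition strict_column :: "nat \<Rightarrow> nat \<Rightarrow> (nat \<Rightarrow> letter) \<Rightarrow> bool" where
  "strict_column m h g \<longleftrightarrow> (\<forall>r<h. g r \<in> alphabet m) \<and> (\<forall>r r'. r < r' \<longrightarrow> r' < h \<longrightarrow> g r < g r')"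

lemma Plain_le_iff: "x \<le> Plain j \<longleftrightarrow> (\<exists>k\<le>j. x = Plain k)"
  by (cases x) auto

lemma Barred_le_iff: "Barred j \<le> x \<longleftrightarrow> (\<exists>k\<le>j. x = Barred k)"
  by (cases x) auto

lemma less_letter_simps [simp]:
  "Plain i < Plain j \<longleftrightarrow> i < j" "Plain i < Barred j" "\<not> Barred j < Plain i"
  "Barred i < Barred j \<longleftrightarrow> j < i"
  by (auto simp: less_letter_def)

lemma plain_count_iff:
  assumes "strict_column m h g" "r < h"
  shows "g r \<le> Plain j \<longleftrightarrow> r < plain_count h g j"
proof -
  let ?S = "{r. r < h \<and> g r \<le> Plain j}"
  have "y \<in> ?S" if "x \<in> ?S" "y < x" for x y
    using that assms(1) less_imp_le[of "g y" "g x"] order.trans[of "g y" "g x" "Plain j"]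
    unfolding strict_column_def by auto
  then show ?thesis
    using down_closed_card[of ?S r] assms(2) unfolding plain_count_def by auto
qed

lemma plain_count_le: "plain_count h g j \<le> h"
  unfolding plain_count_def using card_mono[of "{..<h}" "{r. r < h \<and> g r \<le> Plain j}"] by auto

lemma barred_count_compl: "barred_count h g j + card {r. r < h \<and> g r < Barred j} = h"
proof -
  have "{r. r < h \<and> Barred j \<le> g r} \<union> {r. r < h \<and> g r < Barred j} = {..<h}"
    by auto
  moreover have "{r. r < h \<and> Barred j \<le> g r} \<inter> {r. r < h \<and> g r < Barred j} = {}"
    by auto
  ultimately show ?thesis
    unfolding barred_count_def using card_Un_disjoint[of "{r. r < h \<and> Barred j \<le> g r}" "{r. r < h \<and> g r < Barred j}"]
    by auto
qed

lemma barred_count_le: "barred_count h g j \<le> h"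
  using barred_count_compl[of h g j] by linarith

lemma barred_count_iff:
  assumes "strict_column m h g" "r < h"
  shows "Barred j \<le> g r \<longleftrightarrow> h \<le> r + barred_count h g j"
proof -
  let ?S = "{r. r < h \<and> g r < Barred j}"
  have "y \<in> ?S" if "x \<in> ?S" "y < x" for x y
    using that assms(1) less_trans[of "g y" "g x" "Barred j"]
    unfolding strict_column_def by auto
  then have "g r < Barred j \<longleftrightarrow> r < card ?S"
    using down_closed_card[of ?S r] assms(2) by auto
  then show ?thesis
    using barred_count_compl[of h g j] by (auto simp: not_le[symmetric])
qed

lemma plain_count_0: "strict_column m h g \<Longrightarrow> plain_count h g 0 = 0"
  by (auto simp: plain_count_def strict_column_def alphabet_def Plain_le_iff)

lemma barred_count_0: "strict_column m h g \<Longrightarrow> barred_count h g 0 = 0"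
  by (auto simp: barred_count_def strict_column_def alphabet_def Barred_le_iff)

lemma plain_barred_count_top:
  assumes "strict_column m h g"
  shows "plain_count h g m + barred_count h g m = h"
proof -
  have "{r. r < h \<and> g r \<le> Plain m} = {r. r < h \<and> g r < Barred m}"
    using assms unfolding strict_column_def alphabet_def by (fastforce simp: Plain_le_iff)
  then show ?thesis
    using barred_count_compl[of h g m] by (simp add: plain_count_def)
qed

definition in_column :: "nat \<Rightarrow> (nat \<Rightarrow> letter) \<Rightarrow> letter \<Rightarrow> bool" where
  "in_column h g x \<longleftrightarrow> (\<exists>r<h. g r = x)"

lemma strict_column_inj:
  assumes "strict_column m h g" "r < h" "r' < h" "g r = g r'"
  shows "r = r'"
  using assms unfolding strict_column_def by (metis less_irrefl linorder_neqE_nat)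

lemma card_column_letter:
  assumes "strict_column m h g"
  shows "card {r. r < h \<and> g r = x} = of_bool (in_column h g x)"
proof (cases "in_column h g x")
  case True
  then obtain r where "r < h" "g r = x" by (auto simp: in_column_def)
  then have "{r. r < h \<and> g r = x} = {r}"
    using strict_column_inj[OF assms] by auto
  then show ?thesis using True by simp
next
  case False
  then have "{r. r < h \<and> g r = x} = {}" by (auto simp: in_column_def)
  then show ?thesis using False by simp
qed

lemma plain_count_Suc:
  assumes "strict_column m h g"
  shows "plain_count h g (Suc j) = plain_count h g j + of_bool (in_column h g (Plain (Suc j)))"
proof -
  have "{r. r < h \<and> g r \<le> Plain (Suc j)} = {r. r < h \<and> g r \<le> Plain j} \<union> {r. r < h \<and> g r = Plain (Suc j)}"
    by (auto simp: Plain_le_iff le_Suc_eq)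
  moreover have "card \<dots> = card {r. r < h \<and> g r \<le> Plain j} + card {r. r < h \<and> g r = Plain (Suc j)}"
    by (rule card_Un_disjoint) auto
  ultimately show ?thesis
    using card_column_letter[OF assms] by (simp add: plain_count_def)
qed

lemma barred_count_Suc:
  assumes "strict_column m h g"
  shows "barred_count h g (Suc j) = barred_count h g j + of_bool (in_column h g (Barred (Suc j)))"
proof -
  have "{r. r < h \<and> Barred (Suc j) \<le> g r} = {r. r < h \<and> Barred j \<le> g r} \<union> {r. r < h \<and> g r = Barred (Suc j)}"
    by (auto simp: Barred_le_iff le_Suc_eq)
  moreover have "card \<dots> = card {r. r < h \<and> Barred j \<le> g r} + card {r. r < h \<and> g r = Barred (Suc j)}"
    by (rule card_Un_disjoint) auto
  ultimately show ?thesis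
    using card_column_letter[OF assms] by (simp add: barred_count_def)
qed

lemma plain_count_row:
  assumes "strict_column m h g" "r < h" "g r = Plain j"
  shows "plain_count h g j = Suc r"
proof -
  have "r < plain_count h g j"
    using plain_count_iff[OF assms(1,2), of j] assms(3) by simp
  moreover have "\<not> Suc r < plain_count h g j"
  proof
    assume *: "Suc r < plain_count h g j"
    then have "Suc r < h" using plain_count_le[of h g j] by linarith
    then have "g (Suc r) \<le> Plain j" "g r < g (Suc r)"
      using plain_count_iff[OF assms(1)] * assms(1) by (auto simp: strict_column_def)
    then show False using assms(3) by simp
  qed
  ultimately show ?thesis by linarith
qed

lemma barred_count_row:
  assumes "strict_column m h g" "r < h" "g r = Barred j"
  shows "r + barred_count h g j = h"
proof -
  have "h \<le> r + barred_count h g j"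
    using barred_count_iff[OF assms(1,2), of j] assms(3) by simp
  moreover have "\<not> h < r + barred_count h g j"
  proof
    assume *: "h < r + barred_count h g j"
    then obtain r' where r': "r = Suc r'"
      using barred_count_le[of h g j] by (cases r) auto
    then have "Barred j \<le> g r'" "g r' < g r"
      using barred_count_iff[OF assms(1), of r' j] * assms(1,2) by (auto simp: strict_column_def)
    then show False using assms(3) by simp
  qed
  ultimately show ?thesis by linarith
qed

lemma card_update:
  fixes r h :: nat
  assumes "r < h"
  shows "card {s. s < h \<and> P ((g(r := y)) s)} + of_bool (P (g r)) = card {s. s < h \<and> P (g s)} + of_bool (P y)"
proof -
  let ?S = "{s. s < h \<and> s \<noteq> r \<and> P (g s)}"
  have "{s. s < h \<and> P ((g(r := y)) s)} = (if P y then insert r ?S else ?S)"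
    "{s. s < h \<and> P (g s)} = (if P (g r) then insert r ?S else ?S)"
    using assms by auto
  moreover have "finite ?S"
    by (rule finite_subset[of _ "{..<h}"]) auto
  then have "card (insert r ?S) = Suc (card ?S)"
    by simp
  ultimately show ?thesis by simp
qed

lemma plain_count_update:
  "r < h \<Longrightarrow> plain_count h (g(r := y)) j + of_bool (g r \<le> Plain j) = plain_count h g j + of_bool (y \<le> Plain j)"
  unfolding plain_count_def by (rule card_update[where P = "\<lambda>x. x \<le> Plain j"])

lemma barred_count_update:
  "r < h \<Longrightarrow> barred_count h (g(r := y)) j + of_bool (Barred j \<le> g r) = barred_count h g j + of_bool (Barred j \<le> y)"
  unfolding barred_count_def by (rule card_update[where P = "\<lambda>x. Barred j \<le> x"])

section \<open>Kashiwara--Nakashima tableaux by inequalities\<close>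

lemma rows_le_counts:
  assumes "h' \<le> h" "\<And>r. r < h' \<Longrightarrow> g r \<le> g' r"
  shows "plain_count h' g' j \<le> plain_count h g j"
    and "barred_count h g j + h' \<le> barred_count h' g' j + h"
proof -
  have sub: "{r. r < h' \<and> P (g' r)} \<subseteq> {r. r < h \<and> P (g r)}"
    if "\<And>x y. x \<le> y \<Longrightarrow> P y \<Longrightarrow> P x" for P
    using assms that less_le_trans by blast
  have fin: "finite {r. r < h \<and> P r}" for P
    by (rule finite_subset[of _ "{..<h}"]) auto
  show "plain_count h' g' j \<le> plain_count h g j"
    unfolding plain_count_def by (rule card_mono[OF fin sub]) (rule order.trans)
  have "card {r. r < h' \<and> g' r < Barred j} \<le> card {r. r < h \<and> g r < Barred j}"
    by (rule card_mono[OF fin sub]) (rule le_less_trans)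
  then show "barred_count h g j + h' \<le> barred_count h' g' j + h"
    using barred_count_compl[of h g j] barred_count_compl[of h' g' j] by linarith
qed

lemma count_growth:
  assumes "strict_column m h g" "a \<le> b"
  shows "plain_count h g b \<le> plain_count h g a + (b - a)" "plain_count h g a \<le> plain_count h g b"
    and "barred_count h g b \<le> barred_count h g a + (b - a)" "barred_count h g a \<le> barred_count h g b"
  using assms(2)
  by (induction b rule: dec_induct)
    (auto simp: plain_count_Suc[OF assms(1)] barred_count_Suc[OF assms(1)] Suc_diff_le)

text \<open>
  For one column this is the left side minus the right side of the column condition, extended to
  indices \<open>j\<close> that need not occur in the column. For two columns it mixes the unbarred entries of the
  first with the barred entries of the second.
\<close>

definition surplus :: "nat \<Rightarrow> (nat \<Rightarrow> letter) \<Rightarrow> nat \<Rightarrow> (nat \<Rightarrow> letter) \<Rightarrow> nat \<Rightarrow> int" where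
  "surplus h g h' g' j = int (plain_count h g j) + int (barred_count h' g' j) - int j"

text \<open>
  The inequalities that express semistandardness of two adjacent columns (for \<open>a = b\<close>) and their
  adjacent column condition (for the indices \<open>a + 1\<close> and \<open>b\<close>).
\<close>

definition good_pair :: "nat \<Rightarrow> nat \<Rightarrow> (nat \<Rightarrow> letter) \<Rightarrow> nat \<Rightarrow> (nat \<Rightarrow> letter) \<Rightarrow> bool" where
  "good_pair m h g h' g' \<longleftrightarrow> (\<forall>a b. a \<le> b \<longrightarrow> b \<le> m \<longrightarrow>
     surplus h' g' h' g' b \<le> surplus h g h' g' a \<and>
     surplus h g h g b \<le> surplus h g h' g' a + int h - int h')"

definition good_column :: "nat \<Rightarrow> nat \<Rightarrow> (nat \<Rightarrow> letter) \<Rightarrow> bool" where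
  "good_column m h g \<longleftrightarrow> strict_column m h g \<and> (\<forall>b\<le>m. surplus h g h g b \<le> 0)"

definition good_filling :: "nat list \<Rightarrow> nat \<Rightarrow> filling \<Rightarrow> bool" where
  "good_filling lam m T \<longleftrightarrow>
     (\<forall>c. good_column m (column_length lam c) (\<lambda>r. T (r, c))) \<and>
     (\<forall>c. good_pair m (column_length lam c) (\<lambda>r. T (r, c))
        (column_length lam (Suc c)) (\<lambda>r. T (r, Suc c)))"

lemma surplus_0: "strict_column m h g \<Longrightarrow> strict_column m h' g' \<Longrightarrow> surplus h g h' g' 0 = 0"
  by (simp add: surplus_def plain_count_0 barred_count_0)

lemma surplus_Suc:
  assumes "strict_column m h g" "strict_column m h' g'"
  shows "surplus h g h' g' (Suc j) = surplus h g h' g' j +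
     of_bool (in_column h g (Plain (Suc j))) + of_bool (in_column h' g' (Barred (Suc j))) - 1"
  by (simp add: surplus_def plain_count_Suc[OF assms(1)] barred_count_Suc[OF assms(2)])

text \<open>
  If \<open>b + 1\<close> does not occur both unbarred and barred, then the surplus does not increase from \<open>b\<close> to
  \<open>b + 1\<close>; otherwise the column condition applies.
\<close>

lemma good_columnI:
  assumes "strict_column m h g"
    and "\<And>i a b. a < h \<Longrightarrow> b < h \<Longrightarrow> g a = Plain i \<Longrightarrow> g b = Barred i \<Longrightarrow> (a + 1) + (h - b) \<le> i"
  shows "good_column m h g"
proof -
  have "surplus h g h g b \<le> 0" for b
  proof (induction b)
    case (Suc b)
    show ?case
    proof (cases "in_column h g (Plain (Suc b)) \<and> in_column h g (Barred (Suc b))")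
      case True
      then obtain p q where pq: "p < h" "g p = Plain (Suc b)" "q < h" "g q = Barred (Suc b)"
        by (auto simp: in_column_def)
      then have "plain_count h g (Suc b) = Suc p" "q + barred_count h g (Suc b) = h"
        using plain_count_row barred_count_row assms(1) by blast+
      then show ?thesis
        using assms(2)[OF pq(1,3,2,4)] by (simp add: surplus_def)
    next
      case False
      then show ?thesis
        using Suc by (auto simp: surplus_Suc[OF assms(1) assms(1)])
    qed
  qed (simp add: surplus_0[OF assms(1) assms(1)])
  then show ?thesis
    using assms(1) by (simp add: good_column_def)
qed

text \<open>
  Induction on the distance of the two indices. Unless the four letters of a forbidden configuration
  are present, one of the indices can be moved towards the other; and if they are present in rows that are
  not in the required order, then the inequality holds because counts grow by at most one per index.
\<close>

lemma good_pairI: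
  assumes C: "strict_column m h g" and D: "strict_column m h' g'"
    and rows: "h' \<le> h" "\<And>r. r < h' \<Longrightarrow> g r \<le> g' r"
    and cond1: "\<And>i j p q r s. i \<le> j \<Longrightarrow> p \<le> q \<Longrightarrow> q < r \<Longrightarrow> r \<le> s \<Longrightarrow>
        p < h \<Longrightarrow> g p = Plain i \<Longrightarrow> q < h' \<Longrightarrow> g' q = Plain j \<Longrightarrow>
        r < h' \<Longrightarrow> g' r = Barred j \<Longrightarrow> s < h' \<Longrightarrow> g' s = Barred i \<Longrightarrow> (q - p) + (s - r) < j - i"
    and cond2: "\<And>i j p q r s. i \<le> j \<Longrightarrow> p \<le> q \<Longrightarrow> q < r \<Longrightarrow> r \<le> s \<Longrightarrow>
        p < h \<Longrightarrow> g p = Plain i \<Longrightarrow> q < h \<Longrightarrow> g q = Plain j \<Longrightarrow>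
        r < h \<Longrightarrow> g r = Barred j \<Longrightarrow> s < h' \<Longrightarrow> g' s = Barred i \<Longrightarrow> (q - p) + (s - r) < j - i"
  shows "good_pair m h g h' g'"
proof -
  have before: "q < r" if "strict_column m k f" "q < k" "r < k" "f q = Plain i" "f r = Barred j" for k f q r i j
    using that by (metis less_letter_simps(2) less_letter_simps(3) linorder_neqE_nat strict_column_def letter.distinct(1))
  have "surplus h' g' h' g' (a + d) \<le> surplus h g h' g' a \<and>
     surplus h g h g (a + d) \<le> surplus h g h' g' a + int h - int h'" for a d
  proof (induction d arbitrary: a)
    case 0
    then show ?case
      using rows_le_counts[of h' h g g' a] rows by (simp add: surplus_def)
  next
    case (Suc d)
    show ?case
    proof (cases "in_column h g (Plain (Suc a)) \<and> in_column h' g' (Barred (Suc a))")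
      case False
      then have "surplus h g h' g' (Suc a) \<le> surplus h g h' g' a"
        by (auto simp: surplus_Suc[OF C D])
      then show ?thesis
        using Suc[of "Suc a"] by simp
    next
      case True
      then obtain p s where ps: "p < h" "g p = Plain (Suc a)" "s < h'" "g' s = Barred (Suc a)"
        by (auto simp: in_column_def)
      have cp: "plain_count h g (Suc a) = Suc p" and cs: "s + barred_count h' g' (Suc a) = h'"
        using plain_count_row[OF C ps(1,2)] barred_count_row[OF D ps(3,4)] by auto
      have step: "surplus h g h' g' (Suc a) = surplus h g h' g' a + 1"
        using True by (simp add: surplus_Suc[OF C D])
      let ?b = "Suc (a + d)"
      have 1: "surplus h' g' h' g' ?b \<le> surplus h g h' g' a"
      proof (cases "in_column h' g' (Plain ?b) \<and> in_column h' g' (Barred ?b)")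
        case False
        then have "surplus h' g' h' g' ?b \<le> surplus h' g' h' g' (a + d)"
          by (auto simp: surplus_Suc[OF D D])
        then show ?thesis
          using Suc[of a] by simp
      next
        case True
        then obtain q r where qr: "q < h'" "g' q = Plain ?b" "r < h'" "g' r = Barred ?b"
          by (auto simp: in_column_def)
        have cq: "plain_count h' g' ?b = Suc q" and cr: "r + barred_count h' g' ?b = h'"
          using plain_count_row[OF D qr(1,2)] barred_count_row[OF D qr(3,4)] by auto
        have "q < r" using before[OF D qr(1,3,2,4)] .
        have grow: "barred_count h' g' (Suc a) \<le> barred_count h' g' ?b"
          "barred_count h' g' ?b \<le> barred_count h' g' (Suc a) + d"
          using count_growth(3,4)[OF D, of "Suc a" ?b] by simp_all
        then have "r \<le> s" "s \<le> r + d" using cr cs by linarith+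
        have "int q - int p + int s - int r < int d"
        proof (cases "p \<le> q")
          case True
          then have "(q - p) + (s - r) < ?b - Suc a"
            using cond1[of "Suc a" ?b p q r s] ps qr \<open>q < r\<close> \<open>r \<le> s\<close> by simp
          then show ?thesis using True \<open>r \<le> s\<close> by linarith
        next
          case False
          then show ?thesis using \<open>s \<le> r + d\<close> by linarith
        qed
        then show ?thesis
          using step cp cs cq cr unfolding surplus_def by linarith
      qed
      have 2: "surplus h g h g ?b \<le> surplus h g h' g' a + int h - int h'"
      proof (cases "in_column h g (Plain ?b) \<and> in_column h g (Barred ?b)")
        case False
        then have "surplus h g h g ?b \<le> surplus h g h g (a + d)"
          by (auto simp: surplus_Suc[OF C C])
        then show ?thesis
          using Suc[of a] by simp
      next
        case True
        then obtain q r where qr: "q < h" "g q = Plain ?b" "r < h" "g r = Barred ?b"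
          by (auto simp: in_column_def)
        have cq: "plain_count h g ?b = Suc q" and cr: "r + barred_count h g ?b = h"
          using plain_count_row[OF C qr(1,2)] barred_count_row[OF C qr(3,4)] by auto
        have "q < r" using before[OF C qr(1,3,2,4)] .
        have grow: "plain_count h g (Suc a) \<le> plain_count h g ?b"
          "plain_count h g ?b \<le> plain_count h g (Suc a) + d"
          using count_growth(1,2)[OF C, of "Suc a" ?b] by simp_all
        then have "p \<le> q" "q \<le> p + d" using cp cq by linarith+
        have "int q - int p + int s - int r < int d"
        proof (cases "r \<le> s")
          case True
          then have "(q - p) + (s - r) < ?b - Suc a"
            using cond2[of "Suc a" ?b p q r s] ps qr \<open>q < r\<close> \<open>p \<le> q\<close> by simp
          then show ?thesis using True \<open>p \<le> q\<close> by linarith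
        next
          case False
          then show ?thesis using \<open>q \<le> p + d\<close> by linarith
        qed
        then show ?thesis
          using step cp cs cq cr unfolding surplus_def by linarith
      qed
      from 1 2 show ?thesis by simp
    qed
  qed
  then show ?thesis
    unfolding good_pair_def by (metis le_add_diff_inverse)
qed

lemma surplus_pair:
  assumes "good_pair m h g h' g'" "a \<le> b" "b \<le> m"
  shows "surplus h' g' h' g' b \<le> surplus h g h' g' a"
    and "surplus h g h g b \<le> surplus h g h' g' a + int h - int h'"
  using assms unfolding good_pair_def by blast+

lemma good_pair_rows:
  assumes C: "strict_column m h g" and D: "strict_column m h' g'" and le: "h' \<le> h"
    and good: "good_pair m h g h' g'" and r: "r < h'"
  shows "g r \<le> g' r"
proof (cases "g' r")
  case (Plain k)
  then have k: "1 \<le> k" "k \<le> m"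
    using D r by (auto simp: strict_column_def alphabet_def image_iff dest!: spec[of _ r])
  have "plain_count h' g' k \<le> plain_count h g k"
    using surplus_pair(1)[OF good order.refl k(2)] by (simp add: surplus_def)
  then have "r < plain_count h g k"
    using plain_count_row[OF D r Plain] by simp
  then show ?thesis
    using plain_count_iff[OF C, of r k] r le Plain by simp
next
  case (Barred k)
  then have k: "1 \<le> k" "k \<le> m"
    using D r by (auto simp: strict_column_def alphabet_def image_iff dest!: spec[of _ r])
  show ?thesis
  proof (rule ccontr)
    assume "\<not> ?thesis"
    then have "Barred (k - 1) \<le> g r"
      unfolding Barred k(1) by (cases "g r") auto
    then have "h \<le> r + barred_count h g (k - 1)"
      using barred_count_iff[OF C, of r] r le by simp
    moreover have "barred_count h g (k - 1) + h' \<le> barred_count h' g' (k - 1) + h"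
    proof -
      have "k - 1 \<le> m" using k by linarith
      from surplus_pair(2)[OF good order.refl this] show ?thesis
        unfolding surplus_def by linarith
    qed
    ultimately have "h' \<le> r + barred_count h' g' (k - 1)"
      by linarith
    then have "Barred (k - 1) \<le> Barred k"
      using barred_count_iff[OF D r] Barred by simp
    then show False using k by simp
  qed
qed

lemma surplus_pred_Plain_Barred:
  assumes "strict_column m h g" "strict_column m h' g'"
    and "p < h" "g p = Plain i" "s < h'" "g' s = Barred i" "1 \<le> i"
  shows "surplus h g h' g' (i - 1) = int p + int h' - int s - int i"
proof -
  have "plain_count h g i = Suc p" "s + barred_count h' g' i = h'"
    using plain_count_row[OF assms(1,3,4)] barred_count_row[OF assms(2,5,6)] by auto
  moreover have "in_column h g (Plain i)" "in_column h' g' (Barred i)"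
    using assms(3-6) by (auto simp: in_column_def)
  ultimately show ?thesis
    using surplus_Suc[OF assms(1,2), of "i - 1"] assms(7) by (simp add: surplus_def)
qed

lemma surplus_Plain_Barred:
  assumes "strict_column m h g" "q < h" "g q = Plain j" "r < h" "g r = Barred j"
  shows "surplus h g h g j = int q + 1 + int h - int r - int j"
  using plain_count_row[OF assms(1,2,3)] barred_count_row[OF assms(1,4,5)] by (simp add: surplus_def)

theorem SP_iff_good_filling:
  assumes part: "is_partition lam n"
  shows "T \<in> SP lam m \<longleftrightarrow> T \<in> extensional (cells lam) \<and> good_filling lam m T"
proof
  let ?h = "column_length lam"
  note cells = cells_column_length[OF part]
  note anti = column_length_antimono[OF part]
  assume T: "T \<in> SP lam m"
  then have ext: "T \<in> extensional (cells lam)" and alph: "\<And>x. x \<in> cells lam \<Longrightarrow> T x \<in> alphabet m"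
    and ss: "semistandard lam T" and cc: "column_condition lam T" and ac: "adjacent_columns_condition lam m T"
    by (auto simp: SP_def PiE_def)
  have strict: "strict_column m (?h c) (\<lambda>r. T (r, c))" for c
    using alph ss unfolding strict_column_def semistandard_def by (simp add: cells)
  have "good_column m (?h c) (\<lambda>r. T (r, c))" for c
    using cc unfolding column_condition_def has_entry_def cells by (intro good_columnI[OF strict]) blast
  moreover have "good_pair m (?h c) (\<lambda>r. T (r, c)) (?h (Suc c)) (\<lambda>r. T (r, Suc c))" for c
  proof (rule good_pairI[OF strict strict])
    show le: "?h (Suc c) \<le> ?h c"
      by (rule anti) simp
    show "T (r, c) \<le> T (r, Suc c)" if "r < ?h (Suc c)" for r
      using ss that le unfolding semistandard_def cells by auto
    have bounds: "1 \<le> i \<and> i \<le> m" if "T (r, c') = Plain i \<or> T (r, c') = Barred i" "r < ?h c'" for r c' i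
      using alph[of "(r, c')"] that unfolding cells by (auto simp: alphabet_def)
    fix i j p q r s :: nat
    assume *: "i \<le> j" "p \<le> q" "q < r" "r \<le> s"
    {
      assume a: "p < ?h c" "T (p, c) = Plain i"
        "q < ?h (Suc c)" "T (q, Suc c) = Plain j"
        "r < ?h (Suc c)" "T (r, Suc c) = Barred j"
        "s < ?h (Suc c)" "T (s, Suc c) = Barred i"
      have "1 \<le> i" "j \<le> m"
        using bounds[of p c i] bounds[of q "Suc c" j] a by auto
      then show "(q - p) + (s - r) < j - i"
        using ac * a unfolding adjacent_columns_condition_def has_entry_def cells by blast
    }
    {
      assume a: "p < ?h c" "T (p, c) = Plain i"
        "q < ?h c" "T (q, c) = Plain j"
        "r < ?h c" "T (r, c) = Barred j"
        "s < ?h (Suc c)" "T (s, Suc c) = Barred i"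
      have "1 \<le> i" "j \<le> m"
        using bounds[of p c i] bounds[of q c j] a by auto
      then show "(q - p) + (s - r) < j - i"
        using ac * a unfolding adjacent_columns_condition_def has_entry_def cells by blast
    }
  qed
  ultimately show "T \<in> extensional (cells lam) \<and> good_filling lam m T"
    using ext by (simp add: good_filling_def)
next
  let ?h = "column_length lam"
  note cells = cells_column_length[OF part]
  note anti = column_length_antimono[OF part]
  assume "T \<in> extensional (cells lam) \<and> good_filling lam m T"
  then have ext: "T \<in> extensional (cells lam)"
    and strict: "\<And>c. strict_column m (?h c) (\<lambda>r. T (r, c))"
    and neg: "\<And>c b. b \<le> m \<Longrightarrow> surplus (?h c) (\<lambda>r. T (r, c)) (?h c) (\<lambda>r. T (r, c)) b \<le> 0"
    and pair: "\<And>c. good_pair m (?h c) (\<lambda>r. T (r, c)) (?h (Suc c)) (\<lambda>r. T (r, Suc c))"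
    by (auto simp: good_filling_def good_column_def)
  have le: "?h (Suc c) \<le> ?h c" for c
    by (rule anti) simp
  have alph: "T (r, c) \<in> alphabet m" if "r < ?h c" for r c
    using strict[of c] that by (auto simp: strict_column_def)
  have bounds: "1 \<le> i \<and> i \<le> m" if "T (r, c') = Plain i \<or> T (r, c') = Barred i" "r < ?h c'" for r c' i
    using alph[of r c'] that by (auto simp: alphabet_def)
  have row: "T (r, c) \<le> T (r, Suc c)" if "r < ?h (Suc c)" for r c
    using good_pair_rows[OF strict strict le pair that] .
  have "T (r, c) \<le> T (r, c + d)" if "r < ?h (c + d)" for r c d
    using that
  proof (induction d)
    case (Suc d)
    then have "r < ?h (c + d)"
      using le[of "c + d"] by simp
    with Suc.IH row[of r "c + d"] Suc.prems show ?case by auto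
  qed simp
  then have rows: "T (r, c) \<le> T (r, c')" if "r < ?h c'" "c < c'" for r c c'
    using that by (metis le_add_diff_inverse less_imp_le)
  have "semistandard lam T"
    using rows strict unfolding semistandard_def cells strict_column_def by blast
  moreover have "column_condition lam T"
    unfolding column_condition_def has_entry_def cells
  proof (intro allI impI; elim conjE)
    fix c i a b :: nat
    assume *: "a < ?h c" "T (a, c) = Plain i" "b < ?h c" "T (b, c) = Barred i"
    then have "i \<le> m" using bounds by blast
    then show "(a + 1) + (?h c - b) \<le> i"
      using surplus_Plain_Barred[OF strict *] neg[of i c] *(3) by linarith
  qed
  moreover have "adjacent_columns_condition lam m T"
    unfolding adjacent_columns_condition_def has_entry_def cells
  proof (intro allI impI)
    fix c i j p q r s :: nat
    assume *: "1 \<le> i" "i \<le> j" "j \<le> m" "p \<le> q" "q < r" "r \<le> s"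
    assume "(p < ?h c \<and> T (p, c) = Plain i) \<and>
        (q < ?h (Suc c) \<and> T (q, Suc c) = Plain j) \<and>
        (r < ?h (Suc c) \<and> T (r, Suc c) = Barred j) \<and>
        (s < ?h (Suc c) \<and> T (s, Suc c) = Barred i) \<or>
        (p < ?h c \<and> T (p, c) = Plain i) \<and>
        (q < ?h c \<and> T (q, c) = Plain j) \<and>
        (r < ?h c \<and> T (r, c) = Barred j) \<and>
        (s < ?h (Suc c) \<and> T (s, Suc c) = Barred i)"
    then show "(q - p) + (s - r) < j - i"
    proof (elim disjE conjE)
      assume a: "p < ?h c" "T (p, c) = Plain i"
        "q < ?h (Suc c)" "T (q, Suc c) = Plain j"
        "r < ?h (Suc c)" "T (r, Suc c) = Barred j"
        "s < ?h (Suc c)" "T (s, Suc c) = Barred i"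
      have "i - 1 \<le> j" using * by linarith
      from surplus_pair(1)[OF pair this *(3), of c] show ?thesis
        unfolding surplus_pred_Plain_Barred[OF strict strict a(1,2,7,8) *(1)]
          surplus_Plain_Barred[OF strict a(3-6)]
        using * by linarith
    next
      assume a: "p < ?h c" "T (p, c) = Plain i"
        "q < ?h c" "T (q, c) = Plain j"
        "r < ?h c" "T (r, c) = Barred j"
        "s < ?h (Suc c)" "T (s, Suc c) = Barred i"
      have "i - 1 \<le> j" using * by linarith
      from surplus_pair(2)[OF pair this *(3), of c] show ?thesis
        unfolding surplus_pred_Plain_Barred[OF strict strict a(1,2,7,8) *(1)]
          surplus_Plain_Barred[OF strict a(3-6)]
        using * by linarith
    qed
  qed
  moreover have "T \<in> cells lam \<rightarrow>\<^sub>E alphabet m"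
    using ext alph by (auto simp: PiE_def cells)
  ultimately show "T \<in> SP lam m"
    by (simp add: SP_def)
qed

section \<open>Crystal operators preserve Kashiwara--Nakashima tableaux\<close>

text \<open>
  The letters with a sign, in the order in which they occur in the reading word of a column.
\<close>

definition active_letters :: "nat \<Rightarrow> nat \<Rightarrow> letter list" where
  "active_letters m i =
     (if i < m then [Barred i, Barred (Suc i), Plain (Suc i), Plain i] else [Barred m, Plain m])"

lemma excess_filter: "excess s (filter (\<lambda>x. s x \<noteq> None) xs) = excess s xs"
  by (induction xs) auto

lemma strictly_decreasing_unique:
  fixes xs ys :: "'a :: linorder list"
  assumes "sorted_wrt (>) xs" "sorted_wrt (>) ys" "set xs = set ys"
  shows "xs = ys"
proof -
  have "rev xs = rev ys"
    by (rule strict_sorted_equal) (use assms in \<open>auto simp: sorted_wrt_rev\<close>)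
  then show ?thesis by simp
qed

lemma excess_decreasing:
  assumes "sorted_wrt (>) xs" "i \<le> m"
  shows "excess (sign_of m i) xs = excess (sign_of m i) (filter (\<lambda>y. y \<in> set xs) (active_letters m i))"
proof -
  have "sorted_wrt (>) (active_letters m i)"
    by (simp add: active_letters_def)
  then have "filter (\<lambda>x. sign_of m i x \<noteq> None) xs = filter (\<lambda>y. y \<in> set xs) (active_letters m i)"
    using assms by (intro strictly_decreasing_unique sorted_wrt_filter)
      (auto simp: active_letters_def sign_of_def split: if_splits)
  then show ?thesis
    using excess_filter[of "sign_of m i" xs] by simp
qed

text \<open>
  The unmatched signs of a column, or a part of it, that contains the letters satisfying \<open>P\<close>.
\<close>

definition column_excess :: "nat \<Rightarrow> nat \<Rightarrow> (letter \<Rightarrow> bool) \<Rightarrow> unmatched" where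
  "column_excess m i P = excess (sign_of m i) (filter P (active_letters m i))"

lemma excess_column_segment:
  assumes "strict_column m h g" "b \<le> h" "i \<le> m"
  shows "excess (sign_of m i) (map g (rev [a..<b])) = column_excess m i (\<lambda>y. \<exists>r. a \<le> r \<and> r < b \<and> g r = y)"
proof -
  have "sorted_wrt (<) [a..<b]" by simp
  then have "sorted_wrt (\<lambda>r r'. g r < g r') [a..<b]"
    by (rule sorted_wrt_mono_rel[rotated]) (use assms in \<open>auto simp: strict_column_def\<close>)
  then have "sorted_wrt (>) (map g (rev [a..<b]))"
    by (simp add: sorted_wrt_rev sorted_wrt_map)
  from excess_decreasing[OF this assms(3)] show ?thesis
    unfolding column_excess_def by (auto intro!: arg_cong[where f = "excess (sign_of m i)"] filter_cong)
qed

lemma excess_column: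
  assumes "strict_column m h g" "i \<le> m"
  shows "excess (sign_of m i) (map g (rev [0..<h])) = column_excess m i (in_column h g)"
  using excess_column_segment[OF assms(1) order.refl assms(2), of 0] unfolding in_column_def by simp

lemma strict_column_less_iff:
  assumes "strict_column m h g" "r < h" "s < h"
  shows "g s < g r \<longleftrightarrow> s < r"
  using assms unfolding strict_column_def by (metis less_asym linorder_neqE_nat less_irrefl)

lemma excess_column_below:
  assumes "strict_column m h g" "r < h" "i \<le> m"
  shows "excess (sign_of m i) (map g (rev [Suc r..<h])) = column_excess m i (\<lambda>y. in_column h g y \<and> g r < y)"
proof -
  have "(\<exists>s. Suc r \<le> s \<and> s < h \<and> g s = y) \<longleftrightarrow> in_column h g y \<and> g r < y" for y
    using strict_column_less_iff[OF assms(1) _ assms(2)] unfolding in_column_def Suc_le_eq by metis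
  then show ?thesis
    using excess_column_segment[OF assms(1) order.refl assms(3), of "Suc r"] by simp
qed

lemma excess_column_above:
  assumes "strict_column m h g" "r < h" "i \<le> m"
  shows "excess (sign_of m i) (map g (rev [0..<r])) = column_excess m i (\<lambda>y. in_column h g y \<and> y < g r)"
proof -
  have "(\<exists>s. 0 \<le> s \<and> s < r \<and> g s = y) \<longleftrightarrow> in_column h g y \<and> y < g r" for y
    using strict_column_less_iff[OF assms(1,2)] less_trans[OF _ assms(2)] unfolding in_column_def
    by (metis zero_le)
  then show ?thesis
    using excess_column_segment[OF assms(1) less_imp_le[OF assms(2)] assms(3), of 0] by simp
qed

text \<open>
  The changes of the two counts at the index \<open>i\<close> when the letter \<open>x\<close> is flipped. At all other indices
  at most \<open>m\<close> the counts stay the same (\<open>count_flip\<close>).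
\<close>

definition plain_change :: "nat \<Rightarrow> nat \<Rightarrow> letter \<Rightarrow> int" where
  "plain_change m i x = (if x = Plain i then -1
     else if i < m \<and> x = Plain (Suc i) \<or> i = m \<and> x = Barred m then 1 else 0)"

definition barred_change :: "nat \<Rightarrow> nat \<Rightarrow> letter \<Rightarrow> int" where
  "barred_change m i x = (if x = Barred i then -1
     else if i < m \<and> x = Barred (Suc i) \<or> i = m \<and> x = Plain m then 1 else 0)"

lemma active_cases:
  assumes "sign_of m i x \<noteq> None" "i \<le> m"
  obtains "i < m" "x = Plain i" | "i < m" "x = Plain (Suc i)" | "i < m" "x = Barred (Suc i)"
    | "i < m" "x = Barred i" | "i = m" "x = Plain m" | "i = m" "x = Barred m"
  using assms by (auto simp: sign_of_def split: if_splits)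

lemma count_flip:
  assumes "r < h" "sign_of m i (g r) \<noteq> None" "i \<le> m" "j \<le> m"
  shows "int (plain_count h (g(r := flip_letter m i (g r))) j) =
      int (plain_count h g j) + (if j = i then plain_change m i (g r) else 0)"
    and "int (barred_count h (g(r := flip_letter m i (g r))) j) =
      int (barred_count h g j) + (if j = i then barred_change m i (g r) else 0)"
proof -
  note p = plain_count_update[OF assms(1), of g "flip_letter m i (g r)" j]
  note b = barred_count_update[OF assms(1), of g "flip_letter m i (g r)" j]
  show "int (plain_count h (g(r := flip_letter m i (g r))) j) =
      int (plain_count h g j) + (if j = i then plain_change m i (g r) else 0)"
  proof (cases rule: linorder_cases[of j i])
    case less
    with active_cases[OF assms(2,3)] p assms(3,4) show ?thesis
      by cases (auto simp: flip_letter_def plain_change_def)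
  next
    case equal
    with active_cases[OF assms(2,3)] p assms(3,4) show ?thesis
      by cases (auto simp: flip_letter_def plain_change_def)
  next
    case greater
    with active_cases[OF assms(2,3)] p assms(3,4) show ?thesis
      by cases (auto simp: flip_letter_def plain_change_def)
  qed
  show "int (barred_count h (g(r := flip_letter m i (g r))) j) =
      int (barred_count h g j) + (if j = i then barred_change m i (g r) else 0)"
  proof (cases rule: linorder_cases[of j i])
    case less
    with active_cases[OF assms(2,3)] b assms(3,4) show ?thesis
      by cases (auto simp: flip_letter_def barred_change_def)
  next
    case equal
    with active_cases[OF assms(2,3)] b assms(3,4) show ?thesis
      by cases (auto simp: flip_letter_def barred_change_def)
  next
    case greater
    with active_cases[OF assms(2,3)] b assms(3,4) show ?thesis
      by cases (auto simp: flip_letter_def barred_change_def)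
  qed
qed

lemma column_excess_simps:
  "i < m \<Longrightarrow> column_excess m i P =
     (0, of_bool (P (Barred i))) \<bullet> (of_bool (P (Barred (Suc i))), 0) \<bullet>
     (0, of_bool (P (Plain (Suc i)))) \<bullet> (of_bool (P (Plain i)), 0)"
  "column_excess m m P = (0, of_bool (P (Barred m))) \<bullet> (of_bool (P (Plain m)), 0)"
  by (auto simp: column_excess_def active_letters_def sign_of_def)

lemma neighbour_letters:
  assumes "sign_of m i x \<noteq> None" "1 \<le> i" "i \<le> m" "z \<in> alphabet m" "z \<noteq> x" "z \<noteq> flip_letter m i x"
  shows "z < x \<longleftrightarrow> z < flip_letter m i x" "x < z \<longleftrightarrow> flip_letter m i x < z"
proof -
  have "(z < x \<longleftrightarrow> z < flip_letter m i x) \<and> (x < z \<longleftrightarrow> flip_letter m i x < z)"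
  proof (cases z)
    case (Plain j)
    with active_cases[OF assms(1,3)] assms(2-) show ?thesis
      by cases (auto simp: flip_letter_def alphabet_def)
  next
    case (Barred j)
    with active_cases[OF assms(1,3)] assms(2-) show ?thesis
      by cases (auto simp: flip_letter_def alphabet_def)
  qed
  then show "z < x \<longleftrightarrow> z < flip_letter m i x" "x < z \<longleftrightarrow> flip_letter m i x < z"
    by blast+
qed

lemma flip_not_in_column:
  assumes "strict_column m h g" "r < h" "1 \<le> i" "i \<le> m" "sign_of m i (g r) \<noteq> None"
    and "snd (column_excess m i (\<lambda>y. in_column h g y \<and> g r < y)) = 0"
    and "fst (column_excess m i (\<lambda>y. in_column h g y \<and> y < g r)) = 0"
  shows "\<not> in_column h g (flip_letter m i (g r))"
  using active_cases[OF assms(5,4)] assms(6,7)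
  by cases (auto simp: column_excess_simps flip_letter_def meld_def)

lemma strict_column_flip:
  assumes strict: "strict_column m h g" and "r < h" "1 \<le> i" "i \<le> m" "sign_of m i (g r) \<noteq> None"
    and "\<not> in_column h g (flip_letter m i (g r))"
  shows "strict_column m h (g(r := flip_letter m i (g r)))"
proof -
  have alph: "g s \<in> alphabet m" if "s < h" for s
    using strict that by (auto simp: strict_column_def)
  have ne: "g s \<noteq> flip_letter m i (g r)" if "s < h" for s
    using assms(6) that by (auto simp: in_column_def)
  have other: "g s < g r \<longleftrightarrow> g s < flip_letter m i (g r)" "g r < g s \<longleftrightarrow> flip_letter m i (g r) < g s"
    if "s < h" "s \<noteq> r" for s
    using neighbour_letters[OF assms(5,3,4) alph[OF that(1)] _ ne[OF that(1)]]
      strict_column_inj[OF strict that(1) assms(2)] that(2) by blast+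
  show ?thesis
    unfolding strict_column_def
  proof (intro conjI allI impI)
    fix s assume "s < h"
    then show "(g(r := flip_letter m i (g r))) s \<in> alphabet m"
      using alph flip_letter_alphabet[of i m "g r"] assms(2-4) by simp
  next
    fix s s' assume *: "s < s'" "s' < h"
    then have "g s < g s'" using strict by (auto simp: strict_column_def)
    then show "(g(r := flip_letter m i (g r))) s < (g(r := flip_letter m i (g r))) s'"
      using * other[of s] other[of s'] by auto
  qed
qed

lemma good_column_flip:
  assumes good: "good_column m h g" and "r < h" "1 \<le> i" "i \<le> m" "sign_of m i (g r) \<noteq> None"
    and below: "snd (column_excess m i (\<lambda>y. in_column h g y \<and> g r < y)) = 0"
    and above: "fst (column_excess m i (\<lambda>y. in_column h g y \<and> y < g r)) = 0"
  shows "good_column m h (g(r := flip_letter m i (g r)))"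
proof -
  let ?g = "g(r := flip_letter m i (g r))" and ?N = "surplus h g h g"
  have strict: "strict_column m h g" and neg: "\<And>b. b \<le> m \<Longrightarrow> ?N b \<le> 0"
    using good by (auto simp: good_column_def)
  have x: "in_column h g (g r)" using assms(2) by (auto simp: in_column_def)
  obtain k where k: "i = Suc k" using assms(3) by (cases i) auto
  note step = surplus_Suc[OF strict strict, of k] surplus_Suc[OF strict strict, of i]
  have new: "surplus h ?g h ?g b = ?N b + (if b = i then plain_change m i (g r) + barred_change m i (g r) else 0)"
    if "b \<le> m" for b
    using count_flip[of r h m i g b] assms that by (simp add: surplus_def)
  have "?N i + plain_change m i (g r) + barred_change m i (g r) \<le> 0"
    using active_cases[OF assms(5,4)]
  proof cases
    case 1
    then show ?thesis using neg[of i] assms(4) by (simp add: plain_change_def barred_change_def)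
  next
    case 2
    then have "\<not> in_column h g (Plain i)"
      "in_column h g (Barred i) \<longrightarrow> in_column h g (Barred (Suc i))"
      using below above by (auto simp: column_excess_simps meld_def)
    then show ?thesis
      using 2 neg[of k] neg[of "Suc i"] step x k
      by (cases "in_column h g (Barred (Suc i))") (auto simp: plain_change_def barred_change_def)
  next
    case 3
    then have "\<not> in_column h g (Barred i)"
      "in_column h g (Plain i) \<longrightarrow> in_column h g (Plain (Suc i))"
      using below above by (auto simp: column_excess_simps meld_def)
    then show ?thesis
      using 3 neg[of k] neg[of "Suc i"] step x k
      by (cases "in_column h g (Plain i)") (auto simp: plain_change_def barred_change_def)
  next
    case 4
    then show ?thesis using neg[of i] assms(4) by (simp add: plain_change_def barred_change_def)
  next
    case 5
    then show ?thesis using neg[of i] assms(4) by (simp add: plain_change_def barred_change_def)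
  next
    case 6
    then show ?thesis using neg[of i] assms(4) by (simp add: plain_change_def barred_change_def)
  qed
  then have "surplus h ?g h ?g b \<le> 0" if "b \<le> m" for b
    using new[OF that] neg[OF that] by (cases "b = i") auto
  moreover have "strict_column m h ?g"
    by (rule strict_column_flip[OF strict assms(2-5)])
      (rule flip_not_in_column[OF strict assms(2-5) below above])
  ultimately show ?thesis
    by (simp add: good_column_def)
qed

text \<open>
  If the surpluses change at the index \<open>i\<close> only, then only the inequalities in which \<open>i\<close> occurs need to be
  checked.
\<close>

lemma good_pair_change:
  assumes "good_pair m h g h' g'"
    and new: "\<And>j. j \<le> m \<Longrightarrow> surplus h' G' h' G' j = surplus h' g' h' g' j + (if j = i then dD else 0)"
      "\<And>j. j \<le> m \<Longrightarrow> surplus h G h G j = surplus h g h g j + (if j = i then dC else 0)"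
      "\<And>j. j \<le> m \<Longrightarrow> surplus h G h' G' j = surplus h g h' g' j + (if j = i then dM else 0)"
    and ge: "\<And>b. i < b \<Longrightarrow> b \<le> m \<Longrightarrow> surplus h' g' h' g' b \<le> surplus h g h' g' i + dM \<and>
        surplus h g h g b \<le> surplus h g h' g' i + dM + int h - int h'"
    and eq: "surplus h' g' h' g' i + dD \<le> surplus h g h' g' i + dM \<and>
        surplus h g h g i + dC \<le> surplus h g h' g' i + dM + int h - int h'"
    and less: "\<And>a. a < i \<Longrightarrow> surplus h' g' h' g' i + dD \<le> surplus h g h' g' a \<and>
        surplus h g h g i + dC \<le> surplus h g h' g' a + int h - int h'"
  shows "good_pair m h G h' G'"
  unfolding good_pair_def
proof (intro allI impI)
  fix a b assume ab: "a \<le> b" "b \<le> m"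
  then have "a \<le> m" by simp
  note n = new(1,2)[OF ab(2)] new(3)[OF \<open>a \<le> m\<close>]
  note p = surplus_pair[OF assms(1) ab]
  consider "a = i" "b = i" | "a = i" "i < b" | "a < i" "b = i" | "a \<noteq> i" "b \<noteq> i"
    using ab by linarith
  then show "surplus h' G' h' G' b \<le> surplus h G h' G' a \<and>
      surplus h G h G b \<le> surplus h G h' G' a + int h - int h'"
    by cases (use n p eq ge[of b] less[of a] ab in auto)
qed

text \<open>
  Flipping an unmatched letter of the left one of two adjacent columns. The surpluses at the
  neighbouring indices \<open>k = i - 1\<close> and \<open>i + 1\<close> absorb the change at \<open>i\<close>: bracketing excludes the letter
  patterns for which neither of them does.
\<close>

lemma good_pair_flip_left:
  assumes good: "good_column m h g" "good_column m h' g'" "good_pair m h g h' g'"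
    and "r < h" "1 \<le> i" "i \<le> m" "sign_of m i (g r) \<noteq> None"
    and below: "snd (column_excess m i (\<lambda>y. in_column h g y \<and> g r < y)) = 0"
    and above: "fst (column_excess m i (\<lambda>y. in_column h g y \<and> y < g r)) = 0"
    and right: "fst (column_excess m i (\<lambda>y. in_column h g y \<and> y < g r) \<bullet> column_excess m i (in_column h' g')) = 0"
  shows "good_pair m h (g(r := flip_letter m i (g r))) h' g'"
proof -
  let ?g = "g(r := flip_letter m i (g r))"
  let ?C = "in_column h g" and ?D = "in_column h' g'"
  let ?NC = "surplus h g h g" and ?ND = "surplus h' g' h' g'" and ?M = "surplus h g h' g'"
  let ?p = "plain_change m i (g r)" and ?b = "barred_change m i (g r)" and ?K = "int h - int h'"
  have strict: "strict_column m h g" "strict_column m h' g'"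
    using good by (auto simp: good_column_def)
  have x: "?C (g r)" using assms(4) by (auto simp: in_column_def)
  obtain k where k: "i = Suc k" using assms(5) by (cases i) auto
  note sC = surplus_Suc[OF strict(1) strict(1), of k] surplus_Suc[OF strict(1) strict(1), of i]
  note sD = surplus_Suc[OF strict(2) strict(2), of k] surplus_Suc[OF strict(2) strict(2), of i]
  note sM = surplus_Suc[OF strict, of k] surplus_Suc[OF strict, of i]
  have P: "?ND b \<le> ?M a" "?NC b \<le> ?M a + ?K" if "a \<le> b" "b \<le> m" for a b
    using surplus_pair[OF good(3) that] by linarith+
  have Pi: "\<And>b. i < b \<Longrightarrow> b \<le> m \<Longrightarrow> ?ND b \<le> ?M i \<and> ?NC b \<le> ?M i + ?K"
    and Pk: "\<And>b. i < b \<Longrightarrow> b \<le> m \<Longrightarrow> ?ND b \<le> ?M k \<and> ?NC b \<le> ?M k + ?K"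
    and PS: "\<And>b. i < b \<Longrightarrow> b \<le> m \<Longrightarrow> ?ND b \<le> ?M (Suc i) \<and> ?NC b \<le> ?M (Suc i) + ?K"
    and Peq: "?ND i \<le> ?M i" "?NC i \<le> ?M i + ?K" "?ND i \<le> ?M k" "?NC i \<le> ?M k + ?K"
    and Pl: "\<And>a. a < i \<Longrightarrow> ?ND i \<le> ?M a \<and> ?NC i \<le> ?M a + ?K"
    using P assms(6) by (simp_all add: k)
  have main: "(\<forall>b. i < b \<longrightarrow> b \<le> m \<longrightarrow> ?ND b \<le> ?M i + ?p \<and> ?NC b \<le> ?M i + ?p + ?K) \<and>
      ?ND i \<le> ?M i + ?p \<and> ?NC i + (?p + ?b) \<le> ?M i + ?p + ?K \<and>
      (\<forall>a<i. ?ND i \<le> ?M a \<and> ?NC i + (?p + ?b) \<le> ?M a + ?K)"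
    using active_cases[OF assms(7,6)]
  proof cases
    case 1
    note [simp] = column_excess_simps(1)[OF 1(1)]
    have c: "\<not> ?C (Plain (Suc i))" "?D (Barred (Suc i)) \<longrightarrow> ?D (Barred i)"
      "?D (Plain i) \<longrightarrow> ?D (Plain (Suc i)) \<or> ?D (Barred i)"
      using 1 below right by (auto simp: meld_def of_bool_def split: if_splits)
    have pb: "?p = -1" "?b = 0" using 1 by (simp_all add: plain_change_def barred_change_def)
    show ?thesis
    proof (cases "?D (Barred i)")
      case True
      then have M: "?M k = ?M i - 1" using sM(1) x 1 k by simp
      show ?thesis
      unfolding pb
      by (intro conjI allI impI; (frule (1) Pk)?; (frule Pl)?; use M Peq in linarith)
    next
      case False
      then have M: "?M (Suc i) = ?M i - 1" using sM(2) c by simp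
      have ND: "?ND i \<le> ?M i - 1"
      proof (cases "?D (Plain i)")
        case True
        then have "?D (Plain (Suc i))" "\<not> ?D (Barred (Suc i))" using c False by auto
        then have "?ND (Suc i) = ?ND i" using sD(2) by simp
        then show ?thesis using M P(1)[of "Suc i" "Suc i"] 1 by simp
      next
        case F: False
        then have "?ND i = ?ND k - 1" "?M i = ?M k" using False sD(1) sM(1) x 1 k by simp_all
        then show ?thesis using P(1)[of k k] k assms(6) by simp
      qed
      show ?thesis
        unfolding pb
        by (intro conjI allI impI; (frule (1) PS)?; (frule Pl)?; use M ND Peq in linarith)
    qed
  next
    case 2
    note [simp] = column_excess_simps(1)[OF 2(1)]
    have c: "\<not> ?C (Plain i)" "?C (Barred i) \<longrightarrow> ?C (Barred (Suc i))"
      using 2 below above by (auto simp: meld_def)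
    have pb: "?p = 1" "?b = 0" using 2 by (simp_all add: plain_change_def barred_change_def)
    have n: "?NC (Suc i) = ?NC i + 1 \<or> ?NC k = ?NC i + 1"
      using sC c x 2 k by (cases "?C (Barred (Suc i))") auto
    have less: "?NC i + 1 \<le> ?M a + ?K" if "a < i" for a
      using n P(2)[of a "Suc i"] P(2)[of a k] that k 2 by auto
    show ?thesis
      unfolding pb
      by (intro conjI allI impI; (frule (1) Pi)?; (frule less)?; (frule Pl)?; use Peq in linarith)
  next
    case 3
    note [simp] = column_excess_simps(1)[OF 3(1)]
    have c: "\<not> ?C (Barred i)" "?C (Plain i) \<longrightarrow> ?C (Plain (Suc i))"
      using 3 below above by (auto simp: meld_def)
    have pb: "?p = 0" "?b = 1" using 3 by (simp_all add: plain_change_def barred_change_def)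
    have n: "?NC (Suc i) = ?NC i + 1 \<or> ?NC k = ?NC i + 1"
      using sC c x 3 k by (cases "?C (Plain i)") auto
    have less: "?NC i + 1 \<le> ?M a + ?K" if "a < i" for a
      using n P(2)[of a "Suc i"] P(2)[of a k] that k 3 by auto
    have eq: "?NC i + 1 \<le> ?M i + ?K"
    proof (cases "?C (Plain (Suc i))")
      case True
      then have "?NC (Suc i) = ?NC i + 1" using sC(2) x 3 by simp
      then show ?thesis using P(2)[of i "Suc i"] 3 by simp
    next
      case False
      then have nI: "\<not> ?C (Plain i)" using c by simp
      have d: "?D (Barred (Suc i)) \<longrightarrow> ?D (Barred i)"
        using right 3 False nI by (auto simp: meld_def of_bool_def split: if_splits)
      show ?thesis
      proof (cases "?D (Barred i)")
        case True
        then have "?M k = ?M i" "?NC k = ?NC i + 1" using sM(1) sC(1) nI c k by simp_all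
        then show ?thesis using P(2)[of k k] k assms(6) by simp
      next
        case F: False
        then have "?M (Suc i) = ?M i - 1" "?NC (Suc i) = ?NC i"
          using sM(2) sC(2) False d x 3 by simp_all
        then show ?thesis using P(2)[of "Suc i" "Suc i"] 3 by simp
      qed
    qed
    show ?thesis
      unfolding pb
      by (intro conjI allI impI; (frule (1) Pi)?; (frule less)?; (frule Pl)?; use eq Peq in linarith)
  next
    case 4
    have pb: "?p = 0" "?b = -1" using 4 by (simp_all add: plain_change_def barred_change_def)
    show ?thesis
      unfolding pb
      by (intro conjI allI impI; (frule (1) Pi)?; (frule Pl)?; use Peq in linarith)
  next
    case 5
    note [simp] = column_excess_simps(2)[of m]
    have c: "\<not> ?C (Barred m)" "?D (Plain m) \<longrightarrow> ?D (Barred m)"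
      using 5 below right by (auto simp: meld_def of_bool_def split: if_splits)
    have pb: "?p = -1" "?b = 1" using 5 by (simp_all add: plain_change_def barred_change_def)
    have ND: "?ND m \<le> ?M m - 1"
    proof (cases "?D (Barred m)")
      case True
      then have "?M k = ?M m - 1" using sM(1) x 5 k by simp
      then show ?thesis using P(1)[of k m] k 5 by simp
    next
      case False
      then have "?ND m = ?ND k - 1" "?M m = ?M k" using c sM(1) sD(1) x 5 k by simp_all
      then show ?thesis using P(1)[of k k] k 5 by simp
    qed
    \<comment> \<open>All entries are counted at the index \<open>m\<close>, so both inequalities at \<open>m\<close> are equivalent.\<close>
    have "?NC m = int h - int m" "?ND m = int h' - int m"
      using plain_barred_count_top[OF strict(1)] plain_barred_count_top[OF strict(2)]
      by (simp_all add: surplus_def)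
    then have NC: "?NC m \<le> ?M m - 1 + ?K" using ND by simp
    show ?thesis
      unfolding pb
      by (intro conjI allI impI; (frule Pl)?; use ND[folded 5(1)] NC[folded 5(1)] 5(1) Peq in linarith)
  next
    case 6
    have pb: "?p = 1" "?b = -1" using 6 by (simp_all add: plain_change_def barred_change_def)
    show ?thesis
      unfolding pb
      by (intro conjI allI impI; (frule (1) Pi)?; (frule Pl)?; use Peq in linarith)
  qed
  show ?thesis
    by (rule good_pair_change[OF good(3), where i = i and dD = 0 and dC = "?p + ?b" and dM = ?p])
      (use main count_flip[of r h m i g] assms(4,6,7) in \<open>auto simp: surplus_def\<close>)
qed

lemma good_pair_flip_right:
  assumes good: "good_column m h g" "good_column m h' g'" "good_pair m h g h' g'"
    and "r < h'" "1 \<le> i" "i \<le> m" "sign_of m i (g' r) \<noteq> None"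
    and below: "snd (column_excess m i (\<lambda>y. in_column h' g' y \<and> g' r < y)) = 0"
    and above: "fst (column_excess m i (\<lambda>y. in_column h' g' y \<and> y < g' r)) = 0"
    and left: "snd (column_excess m i (in_column h g) \<bullet> column_excess m i (\<lambda>y. in_column h' g' y \<and> g' r < y)) = 0"
  shows "good_pair m h g h' (g'(r := flip_letter m i (g' r)))"
proof -
  let ?g = "g'(r := flip_letter m i (g' r))"
  let ?C = "in_column h g" and ?D = "in_column h' g'"
  let ?NC = "surplus h g h g" and ?ND = "surplus h' g' h' g'" and ?M = "surplus h g h' g'"
  let ?p = "plain_change m i (g' r)" and ?b = "barred_change m i (g' r)" and ?K = "int h - int h'"
  have strict: "strict_column m h g" "strict_column m h' g'"
    using good by (auto simp: good_column_def)
  have x: "?D (g' r)" using assms(4) by (auto simp: in_column_def)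
  obtain k where k: "i = Suc k" using assms(5) by (cases i) auto
  note sC = surplus_Suc[OF strict(1) strict(1), of k] surplus_Suc[OF strict(1) strict(1), of i]
  note sD = surplus_Suc[OF strict(2) strict(2), of k] surplus_Suc[OF strict(2) strict(2), of i]
  note sM = surplus_Suc[OF strict, of k] surplus_Suc[OF strict, of i]
  have P: "?ND b \<le> ?M a" "?NC b \<le> ?M a + ?K" if "a \<le> b" "b \<le> m" for a b
    using surplus_pair[OF good(3) that] by linarith+
  have Pi: "\<And>b. i < b \<Longrightarrow> b \<le> m \<Longrightarrow> ?ND b \<le> ?M i \<and> ?NC b \<le> ?M i + ?K"
    and Pk: "\<And>b. i < b \<Longrightarrow> b \<le> m \<Longrightarrow> ?ND b \<le> ?M k \<and> ?NC b \<le> ?M k + ?K"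
    and PS: "\<And>b. i < b \<Longrightarrow> b \<le> m \<Longrightarrow> ?ND b \<le> ?M (Suc i) \<and> ?NC b \<le> ?M (Suc i) + ?K"
    and Peq: "?ND i \<le> ?M i" "?NC i \<le> ?M i + ?K" "?ND i \<le> ?M k" "?NC i \<le> ?M k + ?K"
    and Pl: "\<And>a. a < i \<Longrightarrow> ?ND i \<le> ?M a \<and> ?NC i \<le> ?M a + ?K"
    using P assms(6) by (simp_all add: k)
  have main: "(\<forall>b. i < b \<longrightarrow> b \<le> m \<longrightarrow> ?ND b \<le> ?M i + ?b \<and> ?NC b \<le> ?M i + ?b + ?K) \<and>
      ?ND i + (?p + ?b) \<le> ?M i + ?b \<and> ?NC i \<le> ?M i + ?b + ?K \<and>
      (\<forall>a<i. ?ND i + (?p + ?b) \<le> ?M a \<and> ?NC i \<le> ?M a + ?K)"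
    using active_cases[OF assms(7,6)]
  proof cases
    case 1
    have pb: "?p = -1" "?b = 0" using 1 by (simp_all add: plain_change_def barred_change_def)
    show ?thesis
      unfolding pb
      by (intro conjI allI impI; (frule (1) Pi)?; (frule Pl)?; use Peq in linarith)
  next
    case 2
    note [simp] = column_excess_simps(1)[OF 2(1)]
    have c: "\<not> ?D (Plain i)" "?D (Barred i) \<longrightarrow> ?D (Barred (Suc i))"
      using 2 below above by (auto simp: meld_def)
    have pb: "?p = 1" "?b = 0" using 2 by (simp_all add: plain_change_def barred_change_def)
    have n: "?ND (Suc i) = ?ND i + 1 \<or> ?ND k = ?ND i + 1"
      using sD c x 2 k by (cases "?D (Barred (Suc i))") auto
    have less: "?ND i + 1 \<le> ?M a" if "a < i" for a
      using n P(1)[of a "Suc i"] P(1)[of a k] that k 2 by auto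
    have eq: "?ND i + 1 \<le> ?M i"
    proof (cases "?D (Barred (Suc i))")
      case True
      then have "?ND (Suc i) = ?ND i + 1" using sD(2) x 2 by simp
      then show ?thesis using P(1)[of i "Suc i"] 2 by simp
    next
      case False
      then have nI: "\<not> ?D (Barred i)" using c by simp
      have d: "?C (Plain (Suc i)) \<longrightarrow> ?C (Plain i)"
        using left 2 False nI by (auto simp: meld_def of_bool_def split: if_splits)
      show ?thesis
      proof (cases "?C (Plain i)")
        case True
        then have "?M k = ?M i" "?ND k = ?ND i + 1" using sM(1) sD(1) nI c k by simp_all
        then show ?thesis using P(1)[of k k] k assms(6) by simp
      next
        case F: False
        then have "?M (Suc i) = ?M i - 1" "?ND (Suc i) = ?ND i"
          using sM(2) sD(2) False d x 2 by simp_all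
        then show ?thesis using P(1)[of "Suc i" "Suc i"] 2 by simp
      qed
    qed
    show ?thesis
      unfolding pb
      by (intro conjI allI impI; (frule (1) Pi)?; (frule less)?; (frule Pl)?; use eq Peq in linarith)
  next
    case 3
    note [simp] = column_excess_simps(1)[OF 3(1)]
    have c: "\<not> ?D (Barred i)" "?D (Plain i) \<longrightarrow> ?D (Plain (Suc i))"
      using 3 below above by (auto simp: meld_def)
    have pb: "?p = 0" "?b = 1" using 3 by (simp_all add: plain_change_def barred_change_def)
    have n: "?ND (Suc i) = ?ND i + 1 \<or> ?ND k = ?ND i + 1"
      using sD c x 3 k by (cases "?D (Plain i)") auto
    have less: "?ND i + 1 \<le> ?M a" if "a < i" for a
      using n P(1)[of a "Suc i"] P(1)[of a k] that k 3 by auto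
    show ?thesis
      unfolding pb
      by (intro conjI allI impI; (frule (1) Pi)?; (frule less)?; (frule Pl)?; use Peq in linarith)
  next
    case 4
    note [simp] = column_excess_simps(1)[OF 4(1)]
    have c: "\<not> ?D (Barred (Suc i))" "?C (Plain (Suc i)) \<longrightarrow> ?C (Plain i)"
      "?C (Barred i) \<longrightarrow> ?C (Barred (Suc i)) \<or> ?C (Plain i)"
      using 4 above left by (auto simp: meld_def of_bool_def split: if_splits)
    have pb: "?p = 0" "?b = -1" using 4 by (simp_all add: plain_change_def barred_change_def)
    show ?thesis
    proof (cases "?C (Plain i)")
      case True
      then have M: "?M k = ?M i - 1" using sM(1) x 4 k by simp
      show ?thesis
        unfolding pb
        by (intro conjI allI impI; (frule (1) Pk)?; (frule Pl)?; use M Peq in linarith)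
    next
      case False
      then have M: "?M (Suc i) = ?M i - 1" using sM(2) c by simp
      have NC: "?NC i \<le> ?M i - 1 + ?K"
      proof (cases "?C (Barred i)")
        case True
        then have "?C (Barred (Suc i))" "\<not> ?C (Plain (Suc i))" using c False by auto
        then have "?NC (Suc i) = ?NC i" using sC(2) by simp
        then show ?thesis using M P(2)[of "Suc i" "Suc i"] 4 by simp
      next
        case F: False
        then have "?NC i = ?NC k - 1" "?M i = ?M k" using False sC(1) sM(1) x 4 k by simp_all
        then show ?thesis using P(2)[of k k] k assms(6) by simp
      qed
      show ?thesis
        unfolding pb
        by (intro conjI allI impI; (frule (1) PS)?; (frule Pl)?; use M NC Peq in linarith)
    qed
  next
    case 5
    have pb: "?p = -1" "?b = 1" using 5 by (simp_all add: plain_change_def barred_change_def)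
    show ?thesis
      unfolding pb
      by (intro conjI allI impI; (frule (1) Pi)?; (frule Pl)?; use Peq in linarith)
  next
    case 6
    note [simp] = column_excess_simps(2)[of m]
    have c: "\<not> ?D (Plain m)" "?C (Barred m) \<longrightarrow> ?C (Plain m)"
      using 6 above left by (auto simp: meld_def of_bool_def split: if_splits)
    have pb: "?p = 1" "?b = -1" using 6 by (simp_all add: plain_change_def barred_change_def)
    have NC: "?NC m \<le> ?M m - 1 + ?K"
    proof (cases "?C (Plain m)")
      case True
      then have "?M k = ?M m - 1" using sM(1) x 6 k by simp
      then show ?thesis using P(2)[of k m] k 6 by simp
    next
      case False
      then have "?NC m = ?NC k - 1" "?M m = ?M k" using c sM(1) sC(1) x 6 k by simp_all
      then show ?thesis using P(2)[of k k] k 6 by simp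
    qed
    \<comment> \<open>All entries are counted at the index \<open>m\<close>, so both inequalities at \<open>m\<close> are equivalent.\<close>
    have "?NC m = int h - int m" "?ND m = int h' - int m"
      using plain_barred_count_top[OF strict(1)] plain_barred_count_top[OF strict(2)]
      by (simp_all add: surplus_def)
    then have ND: "?ND m \<le> ?M m - 1" using NC by simp
    show ?thesis
      unfolding pb
      by (intro conjI allI impI; (frule Pl)?; use ND[folded 6(1)] NC[folded 6(1)] 6(1) Peq in linarith)
  qed
  show ?thesis
    by (rule good_pair_change[OF good(3), where i = i and dD = "?p + ?b" and dC = 0 and dM = ?b])
      (use main count_flip[of r h' m i g'] assms(4,6,7) in \<open>auto simp: surplus_def\<close>)
qed

text \<open>
  The cells read after \<open>(r, c)\<close> begin with those above it and the next column; the cells read before it end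
  with the previous column and those below it.
\<close>

lemma reading_order_cell:
  assumes part: "is_partition lam n" and ro: "reading_order lam = U @ (r, c) # V"
  shows "r < column_length lam c"
    and "\<exists>V'. V = map (\<lambda>s. (s, c)) (rev [0..<r]) @ column_cells lam (Suc c) @ V'"
    and "\<exists>U'. U = U' @ map (\<lambda>s. (s, c)) (rev [Suc r..<column_length lam c])"
    and "0 < c \<Longrightarrow> \<exists>U'. U = U' @ column_cells lam (c - 1) @ map (\<lambda>s. (s, c)) (rev [Suc r..<column_length lam c])"
proof -
  have "(r, c) \<in> cells lam"
    using set_reading_order[OF part] ro by auto
  then show r: "r < column_length lam c"
    using cells_column_length[OF part] by simp
  have c: "c < num_columns lam"
    using column_length_pos[OF part r] .
  let ?pre = "concat (map (column_cells lam) [0..<c])"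
  let ?post = "concat (map (column_cells lam) [Suc c..<num_columns lam])"
  let ?below = "map (\<lambda>s. (s, c)) (rev [Suc r..<column_length lam c])"
  let ?above = "map (\<lambda>s. (s, c)) (rev [0..<r])"
  have "[0..<num_columns lam] = [0..<c] @ c # [Suc c..<num_columns lam]"
    using c upt_add_eq_append[of 0 c "num_columns lam - c"] by (simp add: upt_conv_Cons)
  moreover have "[0..<column_length lam c] = [0..<r] @ r # [Suc r..<column_length lam c]"
    using r upt_add_eq_append[of 0 r "column_length lam c - r"] by (simp add: upt_conv_Cons)
  then have "column_cells lam c = ?below @ (r, c) # ?above"
    by (simp add: column_cells_def)
  ultimately have eq: "U @ (r, c) # V = (?pre @ ?below) @ (r, c) # (?above @ ?post)"
    using ro unfolding reading_order_columns by simp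
  have "(r, c) \<notin> set U" "(r, c) \<notin> set V"
    using distinct_reading_order[of lam] ro by auto
  then have UV: "U = ?pre @ ?below" "V = ?above @ ?post"
    using append_Cons_eq_iff[of "(r, c)" U V "?pre @ ?below" "?above @ ?post"] eq by auto
  show "\<exists>U'. U = U' @ ?below"
    using UV by blast
  show "\<exists>V'. V = ?above @ column_cells lam (Suc c) @ V'"
  proof (cases "Suc c < num_columns lam")
    case True
    then show ?thesis
      using UV(2) by (simp add: upt_conv_Cons)
  next
    case False
    \<comment> \<open>Beyond the last column the list of cells is empty, so the statement remains true.\<close>
    then have "column_length lam (Suc c) = 0"
      using column_length_pos[OF part, of 0 "Suc c"] by auto
    then show ?thesis
      using UV(2) by (simp add: column_cells_def)
  qed
  show "\<exists>U'. U = U' @ column_cells lam (c - 1) @ ?below" if "0 < c"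
  proof -
    have "[0..<c] = [0..<c - 1] @ [c - 1]"
      using that upt_Suc[of 0 "c - 1"] by simp
    then have "?pre = concat (map (column_cells lam) [0..<c - 1]) @ column_cells lam (c - 1)"
      by simp
    then show ?thesis
      using UV(1) by auto
  qed
qed

text \<open>
  The condition on \<open>U\<close> and \<open>V\<close> says that \<open>x\<close> carries the last unmatched minus or the first unmatched plus
  of the reading word, so the theorem covers both \<open>f\<^sub>i\<close> and \<open>e\<^sub>i\<close>.
\<close>

theorem SP_flip:
  assumes part: "is_partition lam n" and T: "T \<in> SP lam m" and i: "1 \<le> i" "i \<le> m"
    and ro: "reading_order lam = U @ x # V"
    and active: "sign_of m i (T x) \<noteq> None"
    and U: "snd (excess (sign_of m i) (map T U)) = 0"
    and V: "fst (excess (sign_of m i) (map T V)) = 0"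
  shows "T(x := flip_letter m i (T x)) \<in> SP lam m"
proof -
  obtain r c where x: "x = (r, c)" by fastforce
  let ?h = "column_length lam" and ?g = "\<lambda>c r. T (r, c)" and ?T = "T(x := flip_letter m i (T x))"
  let ?s = "sign_of m i"
  have ext: "T \<in> extensional (cells lam)" and good: "\<And>c. good_column m (?h c) (?g c)"
    and pair: "\<And>c. good_pair m (?h c) (?g c) (?h (Suc c)) (?g (Suc c))"
    using T unfolding SP_iff_good_filling[OF part] good_filling_def by auto
  have strict: "strict_column m (?h c) (?g c)" for c
    using good[of c] by (simp add: good_column_def)
  note cell = reading_order_cell[OF part ro[unfolded x]]
  have r: "r < ?h c" by (rule cell(1))
  have col: "excess ?s (map T (column_cells lam d)) = column_excess m i (in_column (?h d) (?g d))" for d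
    using excess_column[OF strict[of d] i(2)] by (simp add: column_cells_def comp_def)
  have above: "excess ?s (map T (map (\<lambda>s. (s, c)) (rev [0..<r]))) =
      column_excess m i (\<lambda>y. in_column (?h c) (?g c) y \<and> y < ?g c r)"
    using excess_column_above[OF strict[of c] r i(2)] by (simp add: comp_def)
  have below: "excess ?s (map T (map (\<lambda>s. (s, c)) (rev [Suc r..<?h c]))) =
      column_excess m i (\<lambda>y. in_column (?h c) (?g c) y \<and> ?g c r < y)"
    using excess_column_below[OF strict[of c] r i(2)] by (simp add: comp_def)
  have fst_prefix: "fst (excess ?s u) = 0" if "fst (excess ?s (u @ v)) = 0" for u v
    using that by (simp add: excess_append meld_def)
  have snd_suffix: "snd (excess ?s v) = 0" if "snd (excess ?s (u @ v)) = 0" for u v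
    using that by (simp add: excess_append meld_def)
  obtain V' where "map T V = (map T (map (\<lambda>s. (s, c)) (rev [0..<r])) @ map T (column_cells lam (Suc c))) @ map T V'"
    using cell(2) by auto
  then have V2: "fst (excess ?s (map T (map (\<lambda>s. (s, c)) (rev [0..<r])) @ map T (column_cells lam (Suc c)))) = 0"
    using V fst_prefix by metis
  have V1: "fst (column_excess m i (\<lambda>y. in_column (?h c) (?g c) y \<and> y < ?g c r)) = 0"
    using fst_prefix[OF V2] unfolding above .
  have V2: "fst (column_excess m i (\<lambda>y. in_column (?h c) (?g c) y \<and> y < ?g c r) \<bullet>
      column_excess m i (in_column (?h (Suc c)) (?g (Suc c)))) = 0"
    using V2 unfolding excess_append above col .
  obtain U' where "map T U = map T U' @ map T (map (\<lambda>s. (s, c)) (rev [Suc r..<?h c]))"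
    using cell(3) by auto
  then have U1: "snd (column_excess m i (\<lambda>y. in_column (?h c) (?g c) y \<and> ?g c r < y)) = 0"
    using U snd_suffix below by metis
  have U2: "snd (column_excess m i (in_column (?h d) (?g d)) \<bullet>
      column_excess m i (\<lambda>y. in_column (?h c) (?g c) y \<and> ?g c r < y)) = 0" if "c = Suc d" for d
  proof -
    have "0 < c" "c - 1 = d" using that by simp_all
    with cell(4) obtain U' where
      "U = U' @ column_cells lam d @ map (\<lambda>s. (s, c)) (rev [Suc r..<?h c])"
      by metis
    then have "map T U = map T U' @ (map T (column_cells lam d) @ map T (map (\<lambda>s. (s, c)) (rev [Suc r..<?h c])))"
      by simp
    then have "snd (excess ?s (map T (column_cells lam d) @ map T (map (\<lambda>s. (s, c)) (rev [Suc r..<?h c])))) = 0"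
      using U snd_suffix by metis
    then show ?thesis
      unfolding excess_append below col .
  qed
  have active': "sign_of m i (?g c r) \<noteq> None"
    using active x by simp
  let ?f = "(?g c)(r := flip_letter m i (?g c r))"
  have new: "(\<lambda>s. ?T (s, d)) = (if d = c then ?f else ?g d)" for d
    by (auto simp: x)
  have "good_column m (?h d) (\<lambda>s. ?T (s, d))" for d
    unfolding new using good good_column_flip[OF good r i active' U1 V1] by simp
  moreover have "good_pair m (?h d) (\<lambda>s. ?T (s, d)) (?h (Suc d)) (\<lambda>s. ?T (s, Suc d))" for d
  proof -
    consider "d = c" | "c = Suc d" | "d \<noteq> c" "Suc d \<noteq> c" by blast
    then show ?thesis
    proof cases
      case 1
      show ?thesis
        unfolding new using 1 good_pair_flip_left[OF good good pair r i active' U1 V1 V2] by simp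
    next
      case 2
      have "good_pair m (?h d) (?g d) (?h c) ?f"
        by (rule good_pair_flip_right[OF good good _ r i active' U1 V1 U2[OF 2]]) (use pair[of d] 2 in simp)
      then show ?thesis
        unfolding new using 2 by simp
    next
      case 3
      then show ?thesis
        unfolding new using pair by simp
    qed
  qed
  moreover have "?T \<in> extensional (cells lam)"
    using ext cells_column_length[OF part, of r c] r by (auto simp: x extensional_def)
  ultimately show ?thesis
    unfolding SP_iff_good_filling[OF part] good_filling_def by blast
qed

section \<open>Reflections of tableaux\<close>

lemma SP_flip_word:
  assumes part: "is_partition lam n" and T: "T \<in> SP lam m" and i: "1 \<le> i" "i \<le> m"
    and w: "reading_word lam T = u @ x # v" "sign_of m i x \<noteq> None"
      "snd (excess (sign_of m i) u) = 0" "fst (excess (sign_of m i) v) = 0"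
  shows "filling_of_word lam (u @ flip_letter m i x # v) \<in> SP lam m \<and>
    reading_word lam (filling_of_word lam (u @ flip_letter m i x # v)) = u @ flip_letter m i x # v"
proof -
  obtain U c V where *: "reading_order lam = U @ c # V" "map T U = u" "T c = x" "map T V = v"
    using w(1) unfolding reading_word_def by (auto simp: map_eq_append_conv map_eq_Cons_conv)
  let ?T = "T(c := flip_letter m i (T c))"
  have "?T \<in> SP lam m"
    by (rule SP_flip[OF part T i *(1)]) (use w * in auto)
  moreover have "reading_word lam ?T = u @ flip_letter m i x # v"
    using reading_word_update[OF *(1)] * by simp
  moreover have "filling_of_word lam (reading_word lam ?T) = ?T"
    using filling_of_word_reading_word[OF part] \<open>?T \<in> SP lam m\<close> by (auto simp: SP_def PiE_def)
  ultimately show ?thesis by simp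
qed

lemma SP_f_word:
  assumes "is_partition lam n" "T \<in> SP lam m" "1 \<le> i" "i \<le> m" "f_word m i (reading_word lam T) = Some w"
  shows "filling_of_word lam w \<in> SP lam m \<and> reading_word lam (filling_of_word lam w) = w"
  using assms(5) by (rule f_word_SomeD) (use SP_flip_word[OF assms(1-4)] in auto)

lemma SP_e_word:
  assumes "is_partition lam n" "T \<in> SP lam m" "1 \<le> i" "i \<le> m" "e_word m i (reading_word lam T) = Some w"
  shows "filling_of_word lam w \<in> SP lam m \<and> reading_word lam (filling_of_word lam w) = w"
  using assms(5) by (rule e_word_SomeD) (use SP_flip_word[OF assms(1-4)] in auto)

lemma iterate_SP:
  assumes step: "\<And>T w. T \<in> SP lam m \<Longrightarrow> h (reading_word lam T) = Some w \<Longrightarrow>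
      filling_of_word lam w \<in> SP lam m \<and> reading_word lam (filling_of_word lam w) = w"
    and "T \<in> SP lam m" "iterate k h (reading_word lam T) = Some w"
  shows "\<exists>T' \<in> SP lam m. iterate k (\<lambda>T. map_option (filling_of_word lam) (h (reading_word lam T))) T = Some T' \<and>
    reading_word lam T' = w"
  using assms(2,3)
proof (induction k arbitrary: T)
  case (Suc k)
  obtain v where v: "h (reading_word lam T) = Some v" "iterate k h v = Some w"
    using Suc.prems(2) unfolding iterate_Suc_bind by (cases "h (reading_word lam T)") auto
  from step[OF Suc.prems(1) v(1)] Suc.IH[of "filling_of_word lam v"] v show ?case
    unfolding iterate_Suc_bind by simp
qed simp

lemma wt_eq_word_weight:
  assumes "is_partition lam n"
  shows "wt lam T = word_weight (reading_word lam T)"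
proof
  fix j
  have "count_list (map T xs) y = card {x \<in> set xs. T x = y}" if "distinct xs" for xs y
    using that
  proof (induction xs)
    case (Cons a xs)
    have "{x \<in> set (a # xs). T x = y} = (if T a = y then insert a {x \<in> set xs. T x = y} else {x \<in> set xs. T x = y})"
      by auto
    then show ?case
      using Cons by simp
  qed simp
  from this[OF distinct_reading_order] show "wt lam T j = word_weight (reading_word lam T) j"
    unfolding wt_def word_weight_def reading_word_def by (simp add: set_reading_order[OF assms])
qed

lemma reflection_SP:
  assumes part: "is_partition lam n" and T: "T \<in> SP lam m" and i: "1 \<le> i" "i \<le> m"
  shows "reflection lam m i T \<in> SP lam m \<and>
    reading_word lam (reflection lam m i T) = reflect_word m i (reading_word lam T)"
proof -
  let ?w = "reading_word lam T"
  define k where "k = coroot_value m i (word_weight ?w)"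
  have k: "(if i < m then wt lam T i - wt lam T (i + 1) else wt lam T m) = k"
    unfolding k_def coroot_value_def wt_eq_word_weight[OF part] ..
  have it: "(if k \<ge> 0 then iterate (nat k) (f_word m i) ?w else iterate (nat (- k)) (e_word m i) ?w) =
      Some (reflect_word m i ?w)"
    unfolding k_def by (rule iterate_reflect_word(1))
  have "\<exists>T' \<in> SP lam m. (if k \<ge> 0 then iterate (nat k) (f_op lam m i) T
      else iterate (nat (- k)) (e_op lam m i) T) = Some T' \<and> reading_word lam T' = reflect_word m i ?w"
  proof (cases "k \<ge> 0")
    case True
    then have it': "iterate (nat k) (f_word m i) ?w = Some (reflect_word m i ?w)"
      using it by simp
    have "\<exists>T' \<in> SP lam m. iterate (nat k) (f_op lam m i) T = Some T' \<and> reading_word lam T' = reflect_word m i ?w"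
      unfolding f_op_def[abs_def] by (rule iterate_SP[OF _ T it']) (rule SP_f_word[OF part _ i])
    then show ?thesis
      using True by simp
  next
    case False
    then have it': "iterate (nat (- k)) (e_word m i) ?w = Some (reflect_word m i ?w)"
      using it by simp
    have "\<exists>T' \<in> SP lam m. iterate (nat (- k)) (e_op lam m i) T = Some T' \<and> reading_word lam T' = reflect_word m i ?w"
      unfolding e_op_def[abs_def] by (rule iterate_SP[OF _ T it']) (rule SP_e_word[OF part _ i])
    then show ?thesis
      using False by simp
  qed
  then obtain T' where "T' \<in> SP lam m" "reading_word lam T' = reflect_word m i ?w"
    "(if k \<ge> 0 then iterate (nat k) (f_op lam m i) T else iterate (nat (- k)) (e_op lam m i) T) = Some T'"
    by blast
  then show ?thesis
    unfolding reflection_def k Let_def by simp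
qed

lemma sigma_SP:
  assumes part: "is_partition lam n" and T: "T \<in> SP lam m"
  shows "sigma lam m T \<in> SP lam m \<and>
    reading_word lam (sigma lam m T) = coxeter_reflect m (reading_word lam T)"
proof -
  have comp: "foldr (\<lambda>i g. f i \<circ> g) is id = foldr f is" for f :: "nat \<Rightarrow> filling \<Rightarrow> filling" and "is"
    by (induction "is") auto
  have "foldr (reflection lam m) is T \<in> SP lam m \<and>
      reading_word lam (foldr (reflection lam m) is T) = foldr (reflect_word m) is (reading_word lam T)"
    if "set is \<subseteq> {1..m}" for "is"
    using that
  proof (induction "is")
    case (Cons i "is")
    then show ?case
      using reflection_SP[OF part, of "foldr (reflection lam m) is T" m i] by simp
  qed (use T in simp)
  moreover have "set [1..<Suc m] \<subseteq> {1..m}" by auto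
  ultimately show ?thesis
    unfolding sigma_def comp coxeter_reflect_def by blast
qed

lemma sigma_power_SP:
  assumes part: "is_partition lam n" and T: "T \<in> SP lam m"
  shows "(sigma lam m ^^ k) T \<in> SP lam m \<and>
    reading_word lam ((sigma lam m ^^ k) T) = (coxeter_reflect m ^^ k) (reading_word lam T)"
  by (induction k) (use sigma_SP[OF part] T in auto)

lemma SP_extensional: "T \<in> SP lam m \<Longrightarrow> T \<in> extensional (cells lam)"
  by (auto simp: SP_def PiE_def)

lemma reading_word_alphabet:
  assumes "is_partition lam n" "T \<in> SP lam m"
  shows "set (reading_word lam T) \<subseteq> alphabet m"
  using assms(2) set_reading_order[OF assms(1)] by (auto simp: SP_def reading_word_def)

lemma sigma_order:
  assumes part: "is_partition lam n" and T: "T \<in> SP lam m" and "m > 0"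
  shows "(sigma lam m ^^ (2 * m)) T = T"
proof (rule reading_word_inj[OF part])
  show "reading_word lam ((sigma lam m ^^ (2 * m)) T) = reading_word lam T"
    using sigma_power_SP[OF part T] coxeter_reflect_order[OF assms(3) reading_word_alphabet[OF part T]] by simp
qed (use sigma_power_SP[OF part T] T SP_extensional in auto)

section \<open>The action on weights\<close>

text \<open>
  The product \<open>\<sigma>\<^sub>k \<dots> \<sigma>\<^sub>m\<close> negates the last coordinate of the weight and moves it to the position \<open>k\<close>.
\<close>

lemma weight_foldr_reflect_word:
  assumes "1 \<le> k" "k \<le> m"
  shows "word_weight (foldr (reflect_word m) [k..<Suc m] w) j =
     (if j = k then - word_weight w m else if k < j \<and> j \<le> m then word_weight w (j - 1) else word_weight w j)"
  using assms(2,1)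
proof (induction k arbitrary: j rule: inc_induct)
  case base
  then show ?case
    by (simp add: iterate_reflect_word(2) coroot_value_def simple_root_def)
next
  case (step k)
  have "[k..<Suc m] = k # [Suc k..<Suc m]"
    using step.hyps by (simp add: upt_conv_Cons del: upt_Suc)
  then show ?case
    using step.IH step.hyps
    by (simp add: iterate_reflect_word(2) coroot_value_def simple_root_def del: upt_Suc)
qed

lemma weight_coxeter_reflect:
  assumes "m > 0"
  shows "word_weight (coxeter_reflect m w) 1 = - word_weight w m"
    and "1 < j \<Longrightarrow> j \<le> m \<Longrightarrow> word_weight (coxeter_reflect m w) j = word_weight w (j - 1)"
  using weight_foldr_reflect_word[of 1 m w] assms unfolding coxeter_reflect_def by simp_all

text \<open>
  The extension of the weight from \<open>1, \<dots>, m\<close> to the integers that changes its sign under the shift by \<open>m\<close>.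
\<close>

definition antiperiodic :: "nat \<Rightarrow> (nat \<Rightarrow> int) \<Rightarrow> int \<Rightarrow> int" where
  "antiperiodic m \<chi> z = (if even ((z - 1) div int m) then 1 else -1) * \<chi> (nat ((z - 1) mod int m) + 1)"

lemma antiperiodic_shift:
  assumes "m > 0"
  shows "antiperiodic m \<chi> (z + int m) = - antiperiodic m \<chi> z"
proof -
  have "z + int m - 1 = (z - 1) + int m" by simp
  moreover have "((z - 1) + int m) div int m = (z - 1) div int m + 1"
    by (rule div_add_self2) (use assms in simp)
  moreover have "((z - 1) + int m) mod int m = (z - 1) mod int m"
    by (rule mod_add_self2)
  ultimately have "(z + int m - 1) div int m = (z - 1) div int m + 1" "(z + int m - 1) mod int m = (z - 1) mod int m"
    by (simp_all only:)
  then show ?thesis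
    unfolding antiperiodic_def by simp
qed

lemma antiperiodic_base:
  assumes "1 \<le> j" "j \<le> m"
  shows "antiperiodic m \<chi> (int j) = \<chi> j"
proof -
  have "(int j - 1) div int m = 0" "(int j - 1) mod int m = int j - 1"
    using assms by (simp_all add: div_pos_pos_trivial mod_pos_pos_trivial)
  then show ?thesis
    using assms by (simp add: antiperiodic_def nat_diff_distrib)
qed

lemma weight_coxeter_power:
  assumes "m > 0" "1 \<le> j" "j \<le> m"
  shows "word_weight ((coxeter_reflect m ^^ t) w) j = antiperiodic m (word_weight w) (int j - int t)"
  using assms(2,3)
proof (induction t arbitrary: j)
  case 0
  then show ?case by (simp add: antiperiodic_base)
next
  case (Suc t)
  let ?v = "(coxeter_reflect m ^^ t) w" and ?Y = "antiperiodic m (word_weight w)"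
  show ?case
  proof (cases "j = 1")
    case True
    have "word_weight ?v m = ?Y (int m - int t)"
      using Suc.IH[of m] assms(1) by simp
    also have "\<dots> = - ?Y (- int t)"
      using antiperiodic_shift[OF assms(1), of "word_weight w" "- int t"] by (simp add: algebra_simps)
    finally show ?thesis
      using True weight_coxeter_reflect(1)[OF assms(1), of ?v] by simp
  next
    case False
    then have "word_weight ?v (j - 1) = ?Y (int (j - 1) - int t)"
      using Suc by simp
    moreover have "int (j - 1) - int t = int j - int (Suc t)"
      using Suc.prems by simp
    ultimately have "word_weight ?v (j - 1) = ?Y (int j - int (Suc t))"
      by metis
    then show ?thesis
      using False Suc.prems weight_coxeter_reflect(2)[OF assms(1), of j ?v] by simp
  qed
qed

lemma period_multiple:
  fixes f :: "int \<Rightarrow> 'a"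
  assumes "\<And>z. f (z + d) = f z"
  shows "f (z + k * d) = f z"
proof -
  have pos: "f (z + int n * d) = f z" for n z
  proof (induction n)
    case (Suc n)
    then show ?case
      using assms[of "z + int n * d"] by (simp add: algebra_simps)
  qed simp
  show ?thesis
  proof (cases "0 \<le> k")
    case True
    then show ?thesis using pos[of z "nat k"] by simp
  next
    case False
    then show ?thesis using pos[of "z + k * d" "nat (- k)"] by simp
  qed
qed

lemma sum_periodic:
  fixes f :: "nat \<Rightarrow> int"
  assumes "\<And>j. f (j + d) = f j"
  shows "sum f {..<k * d} = int k * sum f {..<d}"
proof -
  have split: "sum f {..<a + b} = sum f {..<a} + (\<Sum>i<b. f (i + a))" for a b
    by (induction b) (simp_all add: add.commute)
  have shift: "f (i + k * d) = f i" for i k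
  proof (induction k)
    case (Suc k)
    then show ?case
      using assms[of "i + k * d"] by (simp add: algebra_simps)
  qed simp
  show ?thesis
  proof (induction k)
    case (Suc k)
    have "sum f {..<Suc k * d} = sum f {..<k * d} + (\<Sum>i<d. f (i + k * d))"
      using split[of "k * d" d] by (simp add: add.commute)
    then show ?case
      unfolding shift Suc by (simp add: distrib_right)
  qed simp
qed

text \<open>
  Indices are shifted by one, so the sums range over the positions \<open>1, \<dots>, m\<close>.
\<close>

lemma antiperiodic_not_periodic:
  fixes Y :: "int \<Rightarrow> int" and m n t :: nat
  assumes m: "m > 0" and anti: "\<And>z. Y (z + int m) = - Y z" and per: "\<And>z. Y (z + int t) = Y z"
    and t: "0 < t" "t < 2 * m"
    and odd_sum: "odd (\<Sum>j<m. Y (int j + 1))" and bound: "(\<Sum>j<m. \<bar>Y (int j + 1)\<bar>) \<le> int n"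
    and coprime: "\<And>p::nat. prime p \<Longrightarrow> odd p \<Longrightarrow> p \<le> n \<Longrightarrow> gcd m p = 1"
  shows False
proof -
  have per2: "Y (z + int (2 * m)) = Y z" for z
    using anti[of z] anti[of "z + int m"] by (simp add: algebra_simps)
  define g where "g = gcd t (2 * m)"
  have g: "g > 0" "g dvd 2 * m" "g \<le> t"
    using t by (auto simp: g_def intro: gcd_le1_nat)
  have perg: "Y (z + int g) = Y z" for z
  proof -
    obtain u v where uv: "u * int t + v * int (2 * m) = int g"
      using bezout_int[of "int t" "int (2 * m)"] unfolding gcd_int_int_eq g_def by blast
    have "Y (z + int g) = Y ((z + u * int t) + v * int (2 * m))"
      unfolding uv[symmetric] by (simp add: algebra_simps)
    then show ?thesis
      using period_multiple[of Y "int (2 * m)", OF per2] period_multiple[of Y "int t", OF per] by simp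
  qed
  obtain q where q: "2 * m = g * q" using g(2) by blast
  have "q \<noteq> 1" using q g(3) t(2) by auto
  have nonzero: "\<not> (\<forall>z. Y z = 0)"
  proof
    assume "\<forall>z. Y z = 0"
    then show False using odd_sum by simp
  qed
  \<comment> \<open>An even quotient would make \<open>m\<close> a period, which together with antiperiodicity forces \<open>Y = 0\<close>.\<close>
  have "odd q"
  proof
    assume "even q"
    then obtain s where "q = 2 * s" by blast
    then have "int m = int s * int g" using q by (simp add: mult.commute flip: of_nat_mult)
    then have "Y (z + int m) = Y z" for z
      using period_multiple[of Y "int g", OF perg] by metis
    then have "Y z = 0" for z
      using anti[of z] by simp
    then show False using nonzero by blast
  qed
  obtain p where p: "prime p" "p dvd q"
    using \<open>q \<noteq> 1\<close> prime_factor_nat by blast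
  have "odd p" using p(2) \<open>odd q\<close> by (meson dvd_trans)
  have "p dvd 2 * m" using p(2) q by simp
  then have "p dvd m"
    using p(1) \<open>odd p\<close> by (metis prime_dvd_mult_iff primes_dvd_imp_eq two_is_prime_nat dvd_refl)
  then obtain m' where m': "m = p * m'" by blast
  obtain q' where "q = p * q'" using p(2) by blast
  then have "p * (2 * m') = p * (g * q')" using q m' by (simp add: algebra_simps)
  then have "2 * m' = g * q'" using p(1) by (simp add: prime_gt_0_nat)
  then have "int (2 * m') = int q' * int g" by (simp add: mult.commute flip: of_nat_mult)
  then have per2': "Y (z + int (2 * m')) = Y z" for z
    using period_multiple[of Y "int g", OF perg] by metis
  obtain s where s: "p = 2 * s + 1" using \<open>odd p\<close> by (elim oddE)
  \<comment> \<open>As \<open>m = s * (2 * m') + m'\<close>, the shift by \<open>m'\<close> agrees with the shift by \<open>m\<close>, which changes the sign.\<close>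
  have abs_per: "\<bar>Y (z + int m')\<bar> = \<bar>Y z\<bar>" for z
  proof -
    have "z + int m = (z + int m') + int s * int (2 * m')"
      unfolding m' s by (simp add: algebra_simps)
    then have "Y (z + int m) = Y (z + int m')"
      using period_multiple[of Y "int (2 * m')", OF per2'] by metis
    then show ?thesis using anti[of z] by simp
  qed
  define f where "f j = \<bar>Y (int j + 1)\<bar>" for j
  have "f (j + m') = f j" for j
    using abs_per[of "int j + 1"] by (simp add: f_def algebra_simps)
  from sum_periodic[of f m', OF this, of p] have sum: "sum f {..<m} = int p * sum f {..<m'}"
    by (simp add: m')
  have "even (\<bar>x\<bar> - x)" for x :: int by (simp add: abs_if)
  then have "even (\<Sum>j<m. \<bar>Y (int j + 1)\<bar> - Y (int j + 1))"
    by (intro dvd_sum) simp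
  then have "odd (sum f {..<m})"
    using odd_sum unfolding f_def sum_subtractf by simp
  then have "sum f {..<m'} \<noteq> 0"
    unfolding sum by auto
  moreover have "sum f {..<m'} \<ge> 0"
    by (rule sum_nonneg) (simp add: f_def)
  ultimately have "int p * 1 \<le> int p * sum f {..<m'}"
    by (intro mult_left_mono) auto
  also have "\<dots> \<le> int n"
    using bound unfolding sum[symmetric] f_def .
  finally have "p \<le> n" by simp
  then have "gcd m p = 1" using coprime[OF p(1) \<open>odd p\<close>] by simp
  then show False
    using \<open>p dvd m\<close> p(1) by (metis gcd_nat.absorb2 not_prime_1)
qed

lemma length_word_counts:
  assumes "set w \<subseteq> alphabet m"
  shows "int (length w) = (\<Sum>j<m. int (count_list w (Plain (Suc j))) + int (count_list w (Barred (Suc j))))"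
  using assms
proof (induction w)
  case (Cons x w)
  have one: "(\<Sum>j<m. (of_bool (x = Plain (Suc j)) + of_bool (x = Barred (Suc j)) :: int)) = 1"
  proof -
    obtain j where j: "j < m" "x = Plain (Suc j) \<or> x = Barred (Suc j)"
      using Cons.prems by (auto simp: alphabet_def) (metis Suc_le_D Suc_le_lessD)+
    then have "(\<Sum>k<m. (of_bool (x = Plain (Suc k)) + of_bool (x = Barred (Suc k)) :: int)) =
        (\<Sum>k<m. if k = j then 1 else 0)"
      by (intro sum.cong) auto
    then show ?thesis using j by simp
  qed
  have "(\<Sum>j<m. int (count_list (x # w) (Plain (Suc j))) + int (count_list (x # w) (Barred (Suc j)))) =
     (\<Sum>j<m. (of_bool (x = Plain (Suc j)) + of_bool (x = Barred (Suc j))) +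
       (int (count_list w (Plain (Suc j))) + int (count_list w (Barred (Suc j)))))"
    by (intro sum.cong) auto
  then show ?case
    using Cons one by (simp add: sum.distrib)
qed simp

lemma card_cells:
  assumes "is_partition lam n"
  shows "card (cells lam) = n"
proof -
  have "cells lam = Sigma {..<length lam} (\<lambda>r. {..<lam ! r})"
    by (auto simp: cells_def)
  then have "card (cells lam) = (\<Sum>r<length lam. lam ! r)"
    by (simp add: card_SigmaI)
  also have "\<dots> = sum_list lam"
    by (simp add: sum_list_sum_nth atLeast0LessThan)
  finally show ?thesis
    using assms by (simp add: is_partition_def)
qed

lemma sigma_power_neq:
  assumes m: "m > 0" and part: "is_partition lam n" and "odd n" and T: "T \<in> SP lam m"
    and coprime: "\<And>p::nat. prime p \<Longrightarrow> odd p \<Longrightarrow> p \<le> n \<Longrightarrow> gcd m p = 1"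
    and t: "0 < t" "t < 2 * m"
  shows "(sigma lam m ^^ t) T \<noteq> T"
proof
  assume fixed: "(sigma lam m ^^ t) T = T"
  let ?w = "reading_word lam T"
  let ?Y = "antiperiodic m (word_weight ?w)"
  have w: "(coxeter_reflect m ^^ t) ?w = ?w"
    using sigma_power_SP[OF part T, of t] fixed by simp
  have base: "?Y (int j - int t) = ?Y (int j)" if "1 \<le> j" "j \<le> m" for j
    using weight_coxeter_power[OF m that, of t ?w] weight_coxeter_power[OF m that, of 0 ?w] w by simp
  note anti = antiperiodic_shift[OF m, of "word_weight ?w"]
  \<comment> \<open>The difference vanishes at \<open>1, \<dots>, m\<close>, and its absolute value has period \<open>m\<close>.\<close>
  define W where "W z = \<bar>?Y (z - int t) - ?Y z\<bar>" for z
  have "W (z + int m) = W z" for z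
    using anti[of z] anti[of "z - int t"] by (simp add: W_def algebra_simps)
  note shift = period_multiple[of W "int m", OF this]
  have "W z = W ((z - 1) mod int m + 1)" for z
  proof -
    have "(z - 1) mod int m + 1 + (z - 1) div int m * int m = z"
      using div_mult_mod_eq[of "z - 1" "int m"] by linarith
    then show ?thesis
      using shift[of "(z - 1) mod int m + 1" "(z - 1) div int m"] by simp
  qed
  moreover have "W ((z - 1) mod int m + 1) = 0" for z
  proof -
    let ?j = "nat ((z - 1) mod int m) + 1"
    have "0 \<le> (z - 1) mod int m" "(z - 1) mod int m < int m"
      using m by simp_all
    then have j: "1 \<le> ?j" "?j \<le> m" "int ?j = (z - 1) mod int m + 1"
      by linarith+
    show ?thesis
      using base[OF j(1,2)] unfolding j(3) W_def by simp
  qed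
  ultimately have zero: "?Y (z - int t) = ?Y z" for z
    by (simp add: W_def)
  have per: "?Y (z + int t) = ?Y z" for z
    using zero[of "z + int t"] by simp
  have len: "int n = (\<Sum>j<m. int (count_list ?w (Plain (Suc j))) + int (count_list ?w (Barred (Suc j))))"
    using length_word_counts[OF reading_word_alphabet[OF part T]] card_cells[OF part]
      distinct_card[OF distinct_reading_order[of lam]] set_reading_order[OF part]
    by (simp add: reading_word_def)
  have Y: "?Y (int j + 1) = int (count_list ?w (Plain (Suc j))) - int (count_list ?w (Barred (Suc j)))"
    if "j < m" for j
    using antiperiodic_base[of "Suc j" m "word_weight ?w"] that by (simp add: word_weight_def add.commute)
  have "int n - (\<Sum>j<m. ?Y (int j + 1)) = (\<Sum>j<m. 2 * int (count_list ?w (Barred (Suc j))))"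
    unfolding len sum_subtractf[symmetric] by (intro sum.cong) (auto simp: Y)
  then have "odd (\<Sum>j<m. ?Y (int j + 1))"
  proof -
    assume eq: "int n - (\<Sum>j<m. ?Y (int j + 1)) = (\<Sum>j<m. 2 * int (count_list ?w (Barred (Suc j))))"
    have "even (\<Sum>j<m. 2 * int (count_list ?w (Barred (Suc j))))"
      by (intro dvd_sum) simp
    then have "even (int n - (\<Sum>j<m. ?Y (int j + 1)))"
      unfolding eq .
    then show ?thesis
      using \<open>odd n\<close> by simp
  qed
  moreover have "(\<Sum>j<m. \<bar>?Y (int j + 1)\<bar>) \<le> int n"
    unfolding len by (intro sum_mono) (auto simp: Y)
  ultimately show False
    using antiperiodic_not_periodic[of m ?Y t n, OF m anti per t] coprime by blast
qed

section \<open>Orbits of a cyclic group of permutations\<close>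

lemma cyclic_orbit:
  fixes g :: "'a \<Rightarrow> 'a"
  assumes closed: "\<And>x. x \<in> S \<Longrightarrow> g x \<in> S" and order: "\<And>x. x \<in> S \<Longrightarrow> (g ^^ N) x = x" and N: "N > 0"
    and x: "x \<in> S"
  shows "orbit (subgroup_generated (BijGroup S) {restrict g S}) (\<lambda>h. h) x = (\<lambda>k. (g ^^ k) x) ` {..<N}"
proof -
  let ?G = "BijGroup S" and ?r = "restrict g S"
  interpret G: group ?G by (rule group_BijGroup)
  have pow: "(g ^^ k) y \<in> S" if "y \<in> S" for k y
    using that closed by (induction k) auto
  have cancel: "(g ^^ (N - 1)) (g y) = y" "g ((g ^^ (N - 1)) y) = y" if "y \<in> S" for y
  proof -
    obtain K where K: "N = Suc K" using N by (cases N) auto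
    show "g ((g ^^ (N - 1)) y) = y" using order[OF that] by (simp add: K)
    show "(g ^^ (N - 1)) (g y) = y" using order[OF that] by (simp add: K funpow_swap1)
  qed
  have bij: "bij_betw g S S"
    by (rule bij_betw_byWitness[where f' = "g ^^ (N - 1)"]) (use cancel pow closed in auto)
  then have r: "?r \<in> Bij S"
    by (auto simp: Bij_def bij_betw_restrict_eq)
  then have carrier: "carrier (subgroup_generated ?G {?r}) = generate ?G {?r}"
    by (simp add: carrier_subgroup_generated BijGroup_def)
  have mult: "(h1 \<otimes>\<^bsub>?G\<^esub> h2) y = h1 (h2 y)" if "h1 \<in> Bij S" "h2 \<in> Bij S" "y \<in> S" for h1 h2 y
    using that by (simp add: BijGroup_def compose_def)
  have sub: "generate ?G {?r} \<subseteq> Bij S"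
    using G.generate_incl[of "{?r}"] r by (simp add: BijGroup_def)
  have power: "\<exists>k. \<forall>y\<in>S. h y = (g ^^ k) y" if "h \<in> generate ?G {?r}" for h
    using that
  proof (induction rule: generate.induct)
    case one
    then show ?case by (intro exI[of _ 0]) (simp add: BijGroup_def)
  next
    case (incl h)
    then show ?case by (intro exI[of _ 1]) simp
  next
    case (inv h)
    have "inv\<^bsub>?G\<^esub> ?r = (\<lambda>y \<in> S. inv_into S ?r y)"
      by (rule inv_BijGroup[OF r])
    moreover have "inv_into S ?r y = (g ^^ (N - 1)) y" if "y \<in> S" for y
    proof -
      have "inv_into S ?r (?r ((g ^^ (N - 1)) y)) = (g ^^ (N - 1)) y"
        by (rule inv_into_f_f) (use r pow that in \<open>auto simp: Bij_def bij_betw_def\<close>)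
      then show ?thesis
        using pow[OF that] cancel(2)[OF that] by simp
    qed
    ultimately show ?case
      using inv by (intro exI[of _ "N - 1"]) simp
  next
    case (eng h1 h2)
    then obtain a b where ab: "\<forall>y\<in>S. h1 y = (g ^^ a) y" "\<forall>y\<in>S. h2 y = (g ^^ b) y"
      by blast
    have "(h1 \<otimes>\<^bsub>?G\<^esub> h2) y = (g ^^ (a + b)) y" if "y \<in> S" for y
    proof -
      have "h1 \<in> Bij S" "h2 \<in> Bij S"
        using eng.hyps sub by blast+
      from mult[OF this that] show ?thesis
        using ab pow[OF that] that by (simp add: funpow_add)
    qed
    then show ?case by blast
  qed
  have 1: "h x \<in> (\<lambda>k. (g ^^ k) x) ` {..<N}" if h: "h \<in> generate ?G {?r}" for h
  proof -
    obtain k where "h x = (g ^^ k) x"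
      using power[OF h] x by blast
    also have "\<dots> = (g ^^ (k mod N)) x"
      by (rule funpow_mod_eq[OF order[OF x], symmetric])
    finally show ?thesis
      using N by auto
  qed
  have "\<exists>h \<in> generate ?G {?r}. \<forall>y\<in>S. h y = (g ^^ k) y" for k
  proof (induction k)
    case 0
    show ?case
      by (rule bexI[OF _ generate.one]) (simp add: BijGroup_def)
  next
    case (Suc k)
    then obtain h where h: "h \<in> generate ?G {?r}" "\<forall>y\<in>S. h y = (g ^^ k) y" by blast
    have "?r \<otimes>\<^bsub>?G\<^esub> h \<in> generate ?G {?r}"
      by (intro generate.eng generate.incl h) simp
    moreover have "(?r \<otimes>\<^bsub>?G\<^esub> h) y = (g ^^ Suc k) y" if "y \<in> S" for y
    proof -
      have "h \<in> Bij S"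
        using h(1) sub by blast
      from mult[OF r this that] show ?thesis
        using h(2) pow[OF that] that by simp
    qed
    ultimately show ?case by blast
  qed
  then have 2: "(g ^^ k) x \<in> (\<lambda>h. h x) ` generate ?G {?r}" for k
    using x by (metis image_eqI)
  show ?thesis
    unfolding orbit_def carrier using 1 2 by auto
qed

lemma sigma_power_inj:
  assumes m: "m > 0" and part: "is_partition lam n" and "odd n" and T: "T \<in> SP lam m"
    and coprime: "\<And>p::nat. prime p \<Longrightarrow> odd p \<Longrightarrow> p \<le> n \<Longrightarrow> gcd m p = 1"
  shows "inj_on (\<lambda>k. (sigma lam m ^^ k) T) {..<2 * m}"
proof (rule linorder_inj_onI)
  fix a b assume ab: "a < b" "a \<in> {..<2 * m}" "b \<in> {..<2 * m}"
  let ?s = "sigma lam m"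
  show "(?s ^^ a) T \<noteq> (?s ^^ b) T"
  proof
    assume eq: "(?s ^^ a) T = (?s ^^ b) T"
    have add: "(?s ^^ x) ((?s ^^ y) T) = (?s ^^ (x + y)) T" for x y
      by (simp add: funpow_add)
    have "(?s ^^ (b - a)) T = (?s ^^ (b - a)) ((?s ^^ (2 * m)) T)"
      by (simp add: sigma_order[OF part T m])
    also have "\<dots> = (?s ^^ (2 * m - a)) ((?s ^^ b) T)"
      unfolding add using ab by (intro arg_cong[where f = "\<lambda>k. (?s ^^ k) T"]) simp
    also have "\<dots> = (?s ^^ (2 * m)) T"
      unfolding eq[symmetric] add using ab by simp
    finally have "(?s ^^ (b - a)) T = T"
      by (simp add: sigma_order[OF part T m])
    moreover have "0 < b - a" "b - a < 2 * m" using ab by auto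
    ultimately show False
      using sigma_power_neq[OF m part \<open>odd n\<close> T coprime] by blast
  qed
qed auto

theorem corollary5p1:
  fixes m n :: nat and lam :: "nat list"
  assumes "m > 0"
    and "is_partition lam n"
    and "length lam \<le> m"
    and "odd n"
    and "\<And>p::nat. prime p \<Longrightarrow> odd p \<Longrightarrow> p \<le> n \<Longrightarrow> gcd m p = 1"
  shows "\<forall>Orb \<in> orbits (sigma_group lam m) (SP lam m) (\<lambda>g. g). card Orb = 2 * m"
proof
  fix Orb assume "Orb \<in> orbits (sigma_group lam m) (SP lam m) (\<lambda>g. g)"
  then obtain T where T: "T \<in> SP lam m" "Orb = orbit (sigma_group lam m) (\<lambda>g. g) T"
    by (auto simp: orbits_def)
  have "Orb = (\<lambda>k. (sigma lam m ^^ k) T) ` {..<2 * m}"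
    unfolding T(2) sigma_group_def
    by (rule cyclic_orbit) (use assms(1,2) sigma_SP sigma_order T(1) in auto)
  moreover have "inj_on (\<lambda>k. (sigma lam m ^^ k) T) {..<2 * m}"
    by (rule sigma_power_inj[OF assms(1,2,4) T(1) assms(5)])
  ultimately show "card Orb = 2 * m"
    by (simp add: card_image)
qed

end
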